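(* Let $\bar\phi:\mathbb R^n\to\mathbb R$ be measurable and bounded and define $\phi:\mathcal H\to\mathbb R$ by $\phi(x)=\bar\phi(x_0)$ for $x=(x_0,x_1)\in\mathcal H$. Assume that $Q_t^0$ is invertible (for $t>0$). Then: (i) The function $(t,x)\mapsto R_t[\phi](x)$ belongs to $C_b((0,+\infty)\times\mathcal H)$. Moreover it is Lipschitz continuous in $x$ uniformly in $t\in[t_0,t_1]$ for all $0<t_0<t_1<+\infty$. (ii) Fix any $t>0$. $R_t[\phi]$ is Fréchet differentiable and, for every $x,h\in\mathcal H$, $$\langle\nabla(R_t[\phi])(x),h\rangle_{\mathcal H}=\int_{\mathbb R^n}\bar\phi\left(z_0+(e^{tA}x)_0\right)\left\langle(Q_t^0)^{-1/2}(e^{tA}h)_0,(Q_t^0)^{-1/2}z_0\right\rangle_{\mathbb R^n}\mathcal N(0,Q_t^0)(dz_0),$$ and $$|\langle\nabla(R_t[\phi])(x),h\rangle_{\mathcal H}|\le\|\bar\phi\|_\infty\left\|(Q_t^0)^{-1/2}(e^{tA})_0\right\|_{\mathcal L(\mathcal H;\mathbb R^n)}|h|_{\mathcal H}.$$ Hence for all $T>0$ there exists $C_T$ such that $$|\langle\nabla R_t[\phi](x),h\rangle_{\mathcal H}|\le C_T\,t^{-r-1/2}\,\|\bar\phi\|_\infty\,|h|_{\mathcal H},\qquad t\in(0,T],$$ where $r$ is the Kalman exponent, which is $0$ if and only if $\sigma$ is onto. (iii) Fix any $t>0$. $R_t[\phi]$ is $B$-Fréchet differentiable and, for every $x\in\mathcal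 H$, $k\in\mathbb R^m$, $$\langle\nabla^B(R_t[\phi])(x),k\rangle_{\mathbb R^m}=\int_{\mathbb R^n}\bar\phi\left(z_0+(e^{tA}x)_0\right)\left\langle(Q_t^0)^{-1/2}(e^{tA}Bk)_0,(Q_t^0)^{-1/2}z_0\right\rangle_{\mathbb R^n}\mathcal N(0,Q_t^0)(dz_0),$$ and $$|\langle\nabla^B(R_t[\phi])(x),k\rangle_{\mathbb R^m}|\le\|\bar\phi\|_\infty\left\|(Q_t^0)^{-1/2}(e^{tA}B)_0\right\|_{\mathcal L(\mathbb R^m;\mathbb R^n)}|k|_{\mathbb R^m}.$$ Hence for all $T>0$ there exists $C_T$ such that $$|\langle\nabla^BR_t[\phi](x),k\rangle_{\mathbb R^m}|\le C_T\,t^{-r-1/2}\,\|\bar\phi\|_\infty\,|k|_{\mathbb R^m},\qquad t\in(0,T],$$ where $r$ is the Kalman exponent, which is $0$ if and only if $\sigma$ is onto.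
   Context: Model: $a_0\in\mathcal L(\mathbb R^n;\mathbb R^n)$, $\sigma\in\mathcal L(\mathbb R^q;\mathbb R^n)$, $b_0\in\mathcal L(\mathbb R^m;\mathbb R^n)$, $d>0$, and $b_1$ is a matrix of finite signed Radon measures on $[-d,0]$ (an element of the dual of $C([-d,0],\mathcal L(\mathbb R^m;\mathbb R^n))$, so that $b_1(dr)k$ is an $\mathbb R^n$-valued measure for $k\in\mathbb R^m$); a density $b_1\in L^2([-d,0],\mathcal L(\mathbb R^m;\mathbb R^n))$ is identified with $b_1(r)dr$. $\mathcal H=\mathbb R^n\times L^2([-d,0],\mathbb R^n)$, with elements $x=(x_0,x_1)$; $(\cdot)_0$ is the first component. $A(y_0,y_1)=(a_0y_0+y_1(0),-y_1')$ with domain $\{(y_0,y_1)\in\mathcal H: y_1\in W^{1,2}([-d,0],\mathbb R^n),\,y_1(-d)=0\}$ generates the $C_0$-semigroup $$e^{tA}(y_0,y_1)=\Big(e^{ta_0}y_0+\int_{-d}^01_{[-t,0]}(s)e^{(t+s)a_0}y_1(s)ds,\;\; y_1(\cdot-t)1_{[-d+t,0]}(\cdot)\Big).$$ $G:\mathbb R^q\to\mathcal H$, $Gy=(\sigma y,0)$. $Bk=(b_0k,b_1k)$, a bounded operator $\mathbb R^m\to\mathcal H$ if $b_1\in L^2$, and in general $B:\mathbb R^m\to\mathbb R^n\times C^*([-d,0],\mathbb R^n)$ ($C^*$ the dual of $C$). In all cases $$(e^{tA}B)_0k=(e^{tA}Bk)_0:=e^{ta_0}b_0k+\int_{-d}^01_{[-t,0]}(r)e^{(t+r)a_0}b_1(dr)k.$$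 $Q_t=\int_0^te^{sA}GG^*e^{sA^*}ds$ on $\mathcal H$, $Q_t^0=\int_0^te^{sa_0}\sigma\sigma^*e^{sa_0^*}ds$ on $\mathbb R^n$; $R_t[f](x)=\int_{\mathcal H}f(z+e^{tA}x)\,\mathcal N(0,Q_t)(dz)$ for bounded Borel $f$, with $\mathcal N(0,Q)$ the centered Gaussian measure with covariance $Q$. $C_b$ denotes continuous bounded functions. The Kalman exponent $r$ is the minimal integer $r\ge0$ such that $\operatorname{Im}(\sigma,a_0\sigma,\dots,a_0^r\sigma)=\mathbb R^n$ (invertibility of $Q_t^0$ for $t>0$ is equivalent to $\operatorname{Im}(\sigma,a_0\sigma,\dots,a_0^{n-1}\sigma)=\mathbb R^n$). $B$-derivative: $\nabla^Bf(x)\in\mathbb R^m$ is defined by $\langle\nabla^Bf(x),k\rangle=\lim_{s\to0}\frac{f(x+sBk)-f(x)}{s}$; $f$ is $B$-Fréchet differentiable at $x$ if the limit exists for every $k\in\mathbb R^m$, is linear and bounded in $k$, and is uniform for $k$ in the unit ball. If $b_1$ is a measure and $Bk\notin\mathcal H$, this is used for functions of the form $f(x)=g((e^{tA}x)_0)$, with $f(x+sBk)$ understood as $g((e^{tA}x)_0+s(e^{tA}Bk)_0)$. The constants $C_T$ do not depend on $t$, $x$, $h$, $k$, $\bar\phi$. *)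

theory Defs
  imports "HOL-Probability.Probability"
begin

section \<open>The Hilbert space of square integrable functions\<close>

definition sq_integrable :: "(real \<Rightarrow> 'a::euclidean_space) \<Rightarrow> bool" where
  "sq_integrable f \<longleftrightarrow> f \<in> borel_measurable lborel \<and> integrable lborel (\<lambda>s. (norm (f s))\<^sup>2)"

definition ae_eq :: "(real \<Rightarrow> 'a::euclidean_space) \<Rightarrow> (real \<Rightarrow> 'a) \<Rightarrow> bool" where
  "ae_eq f g \<longleftrightarrow> sq_integrable f \<and> sq_integrable g \<and> (AE s in lborel. f s = g s)"

lemma sq_integrable_inner:
  assumes "sq_integrable f" "sq_integrable g"
  shows "integrable lborel (\<lambda>s. f s \<bullet> g s)"
proof (rule Bochner_Integration.integrable_bound)
  show "integrable lborel (\<lambda>s. (norm (f s))\<^sup>2 + (norm (g s))\<^sup>2)"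
    using assms by (auto simp: sq_integrable_def)
  show "(\<lambda>s. f s \<bullet> g s) \<in> borel_measurable lborel"
    using assms by (auto simp: sq_integrable_def)
  have "norm (f s \<bullet> g s) \<le> norm ((norm (f s))\<^sup>2 + (norm (g s))\<^sup>2)" for s
  proof -
    have "\<bar>f s \<bullet> g s\<bar> \<le> norm (f s) * norm (g s)"
      by (rule Cauchy_Schwarz_ineq2)
    also have "\<dots> \<le> (norm (f s))\<^sup>2 + (norm (g s))\<^sup>2"
      using sum_squares_bound[of "norm (f s)" "norm (g s)"]
        mult_nonneg_nonneg[of "norm (f s)" "norm (g s)"] norm_ge_zero[of "f s"] norm_ge_zero[of "g s"]
      unfolding mult.assoc by linarith
    finally show ?thesis by simp
  qed
  then show "AE s in lborel. norm (f s \<bullet> g s) \<le> norm ((norm (f s))\<^sup>2 + (norm (g s))\<^sup>2)"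
    by simp
qed

lemma sq_integrable_0: "sq_integrable (\<lambda>_. 0)"
  by (simp add: sq_integrable_def)

lemma sq_integrable_scaleR: "sq_integrable f \<Longrightarrow> sq_integrable (\<lambda>s. c *\<^sub>R f s)"
  by (auto simp: sq_integrable_def power_mult_distrib)

lemma sq_integrable_add:
  assumes "sq_integrable f" "sq_integrable g"
  shows "sq_integrable (\<lambda>s. f s + g s)"
proof -
  have "integrable lborel (\<lambda>s. (norm (f s))\<^sup>2 + (norm (g s))\<^sup>2 + 2 * (f s \<bullet> g s))"
    using assms sq_integrable_inner[OF assms] by (auto simp: sq_integrable_def)
  moreover have "(norm (f s))\<^sup>2 + (norm (g s))\<^sup>2 + 2 * (f s \<bullet> g s) = (norm (f s + g s))\<^sup>2" for s
    by (simp add: power2_norm_eq_inner inner_add inner_commute)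
  ultimately show ?thesis
    using assms by (auto simp: sq_integrable_def)
qed

quotient_type (overloaded) 'a L2 = "real \<Rightarrow> 'a::euclidean_space" / partial: ae_eq
proof (rule part_equivpI)
  show "\<exists>f::real \<Rightarrow> 'a. ae_eq f f"
    using sq_integrable_0 by (auto simp: ae_eq_def intro!: exI[of _ "\<lambda>_. 0"])
  show "symp (ae_eq :: (real \<Rightarrow> 'a) \<Rightarrow> _)"
    by (auto simp: symp_def ae_eq_def)
  show "transp (ae_eq :: (real \<Rightarrow> 'a) \<Rightarrow> _)"
    by (auto simp: transp_def ae_eq_def)
qed

instantiation L2 :: (euclidean_space) real_vector
begin

lift_definition zero_L2 :: "'a L2" is "\<lambda>_. 0"
  by (simp add: ae_eq_def sq_integrable_0)

lift_definition plus_L2 :: "'a L2 \<Rightarrow> 'a L2 \<Rightarrow> 'a L2" is "\<lambda>f g s. f s + g s"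
  by (auto simp: ae_eq_def intro: sq_integrable_add)

lift_definition scaleR_L2 :: "real \<Rightarrow> 'a L2 \<Rightarrow> 'a L2" is "\<lambda>c f s. c *\<^sub>R f s"
  by (auto simp: ae_eq_def intro: sq_integrable_scaleR)

definition uminus_L2 :: "'a L2 \<Rightarrow> 'a L2" where
  "uminus_L2 f = (-1) *\<^sub>R f"

definition minus_L2 :: "'a L2 \<Rightarrow> 'a L2 \<Rightarrow> 'a L2" where
  "minus_L2 f g = f + (-1) *\<^sub>R g"

instance
proof
  fix f g h :: "'a L2" and c c' :: real
  show "f + g + h = f + (g + h)"
    by transfer (auto simp: ae_eq_def add.assoc intro!: sq_integrable_add)
  show "f + g = g + f"
    by transfer (auto simp: ae_eq_def add.commute intro!: sq_integrable_add)
  show "0 + f = f"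
    by transfer (auto simp: ae_eq_def)
  show "- f + f = 0"
    unfolding uminus_L2_def by transfer (auto simp: ae_eq_def sq_integrable_0)
  show "f - g = f + - g"
    unfolding uminus_L2_def minus_L2_def ..
  show "c *\<^sub>R (f + g) = c *\<^sub>R f + c *\<^sub>R g"
    by transfer (auto simp: ae_eq_def scaleR_add_right
        intro!: sq_integrable_add sq_integrable_scaleR)
  show "(c + c') *\<^sub>R f = c *\<^sub>R f + c' *\<^sub>R f"
    by transfer (auto simp: ae_eq_def scaleR_add_left
        intro!: sq_integrable_add sq_integrable_scaleR)
  show "c *\<^sub>R c' *\<^sub>R f = (c * c') *\<^sub>R f"
    by transfer (auto simp: ae_eq_def intro: sq_integrable_scaleR)
  show "1 *\<^sub>R f = f"
    by transfer (auto simp: ae_eq_def)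
qed

end

instantiation L2 :: (euclidean_space) real_inner
begin

lift_definition inner_L2 :: "'a L2 \<Rightarrow> 'a L2 \<Rightarrow> real" is "\<lambda>f g. LINT s|lborel. f s \<bullet> g s"
  by (rule integral_cong_AE) (auto simp: ae_eq_def sq_integrable_def)

definition norm_L2 :: "'a L2 \<Rightarrow> real" where
  "norm_L2 f = sqrt (f \<bullet> f)"

definition sgn_L2 :: "'a L2 \<Rightarrow> 'a L2" where
  "sgn_L2 f = f /\<^sub>R norm f"

definition dist_L2 :: "'a L2 \<Rightarrow> 'a L2 \<Rightarrow> real" where
  "dist_L2 f g = norm (f - g)"

definition uniformity_L2 :: "('a L2 \<times> 'a L2) filter" where
  "uniformity_L2 = (INF e\<in>{0<..}. principal {(x, y). dist x y < e})"

definition open_L2 :: "'a L2 set \<Rightarrow> bool" where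
  "open_L2 U \<longleftrightarrow> (\<forall>x\<in>U. \<forall>\<^sub>F (x', y) in uniformity. x' = x \<longrightarrow> y \<in> U)"

instance
proof
  fix f g h :: "'a L2" and c :: real
  show "sgn f = f /\<^sub>R norm f"
    by (rule sgn_L2_def)
  show "dist f g = norm (f - g)"
    by (rule dist_L2_def)
  show "(uniformity :: ('a L2 \<times> 'a L2) filter) = (INF e\<in>{0<..}. principal {(x, y). dist x y < e})"
    by (rule uniformity_L2_def)
  show "open U \<longleftrightarrow> (\<forall>x\<in>U. \<forall>\<^sub>F (x', y) in uniformity. x' = x \<longrightarrow> y \<in> U)" for U :: "'a L2 set"
    by (rule open_L2_def)
  show "f \<bullet> g = g \<bullet> f"
    by transfer (simp add: inner_commute)
  show "(f + g) \<bullet> h = f \<bullet> h + g \<bullet> h"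
    by transfer (simp add: ae_eq_def inner_add_left sq_integrable_inner)
  show "(c *\<^sub>R f) \<bullet> g = c * (f \<bullet> g)"
    by transfer simp
  show "0 \<le> f \<bullet> f"
    by transfer simp
  show "f \<bullet> f = 0 \<longleftrightarrow> f = 0"
  proof (transfer)
    fix f :: "real \<Rightarrow> 'a"
    assume "ae_eq f f"
    then have sq: "sq_integrable f"
      by (simp add: ae_eq_def)
    show "(LINT s|lborel. f s \<bullet> f s) = 0 \<longleftrightarrow> ae_eq f (\<lambda>_. 0)"
      using integral_nonneg_eq_0_iff_AE[OF sq_integrable_inner[OF sq sq]] sq
      by (simp add: ae_eq_def sq_integrable_0)
  qed
  show "norm f = sqrt (f \<bullet> f)"
    by (rule norm_L2_def)
qed

end

text \<open>\<open>L2_class f\<close> is the class of a square integrable \<open>f\<close>; \<open>L2_fun u\<close> is some representative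
  of the class \<open>u\<close>.\<close>

definition L2_class :: "(real \<Rightarrow> 'a::euclidean_space) \<Rightarrow> 'a L2" where
  "L2_class = abs_L2"

definition L2_fun :: "'a::euclidean_space L2 \<Rightarrow> real \<Rightarrow> 'a" where
  "L2_fun = rep_L2"

lemma L2_class_fun: "L2_class (L2_fun u) = u"
  unfolding L2_class_def L2_fun_def by (rule Quotient_abs_rep[OF Quotient_L2])

lemma sq_integrable_L2_fun: "sq_integrable (L2_fun u)"
  using Quotient_rep_reflp[OF Quotient_L2, of u] by (simp add: L2_fun_def ae_eq_def)

lemma L2_fun_class: "sq_integrable f \<Longrightarrow> AE s in lborel. L2_fun (L2_class f) s = f s"
  using Quotient_rep_abs[OF Quotient_L2, of f]
  by (simp add: L2_fun_def L2_class_def ae_eq_def)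

text \<open>The interval \<open>[-d,0]\<close> depends on the parameter \<open>d\<close>, so \<open>L\<^sup>2([-d,0])\<close> is realized as the
  closed subspace of \<open>L\<^sup>2(\<real>)\<close> of the functions vanishing outside \<open>[-d,0]\<close>; \<open>Hsp d\<close> is the Hilbert
  space \<open>\<real>\<^sup>n \<times> L\<^sup>2([-d,0], \<real>\<^sup>n)\<close>, with the inner product and the topology of the ambient product type.
  All notions on \<open>Hsp d\<close> below are relative to this subspace.\<close>

definition Hsp :: "real \<Rightarrow> ((real^'n) \<times> (real^'n) L2) set" where
  "Hsp d = {x. AE s in lborel. s \<notin> {-d..0} \<longrightarrow> L2_fun (snd x) s = 0}"


section \<open>Matrices\<close>

definition mexp :: "real^'n^'n \<Rightarrow> real^'n^'n" where
  "mexp a = (\<Sum>k. (1 / fact k) *\<^sub>R ((\<lambda>m. a ** m) ^^ k) (mat 1))"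

text \<open>The positive semidefinite square root.\<close>

definition msqrt :: "real^'n^'n \<Rightarrow> real^'n^'n" where
  "msqrt Q = (THE S. transpose S = S \<and> (\<forall>x. 0 \<le> x \<bullet> (S *v x)) \<and> S ** S = Q)"

definition inv_msqrt :: "real^'n^'n \<Rightarrow> real^'n^'n" where
  "inv_msqrt Q = matrix_inv (msqrt Q)"

definition opnorm_on :: "'a::real_normed_vector set \<Rightarrow> ('a \<Rightarrow> 'b::real_normed_vector) \<Rightarrow> real" where
  "opnorm_on S f = (SUP x\<in>S. norm (f x) / norm x)"

text \<open>The minimal \<open>r\<close> such that the block operator \<open>(\<sigma>, a\<^sub>0 \<sigma>, \<dots>, a\<^sub>0\<^sup>r \<sigma>)\<close> is onto.\<close>

definition kalman_exponent :: "real^'n^'n \<Rightarrow> real^'q^'n \<Rightarrow> nat" where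
  "kalman_exponent a0 \<sigma> =
     (LEAST r. range (\<lambda>u::nat \<Rightarrow> real^'q. \<Sum>i\<le>r. ((\<lambda>y. a0 *v y) ^^ i) (\<sigma> *v u i)) = UNIV)"


section \<open>Finite signed measures\<close>

text \<open>On a compact interval every finite signed Borel measure is Radon.\<close>

definition finite_signed_measure_on :: "real set \<Rightarrow> (real set \<Rightarrow> real) \<Rightarrow> bool" where
  "finite_signed_measure_on S \<nu> \<longleftrightarrow>
     (\<forall>E::nat \<Rightarrow> real set. range E \<subseteq> sets (restrict_space borel S) \<longrightarrow> disjoint_family E \<longrightarrow>
        (\<lambda>i. \<nu> (E i)) sums \<nu> (\<Union>i. E i))"

text \<open>The integral is taken through the Jordan decomposition; \<open>ennreal\<close> sends negative values to 0,
  which does not affect the supremum because of \<open>A = {}\<close>.\<close>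

definition pos_variation :: "real set \<Rightarrow> (real set \<Rightarrow> real) \<Rightarrow> real measure" where
  "pos_variation S \<nu> = measure_of S (sets (restrict_space borel S))
     (\<lambda>E. SUP A\<in>{A \<in> sets (restrict_space borel S). A \<subseteq> E}. ennreal (\<nu> A))"

definition signed_integral :: "real set \<Rightarrow> (real set \<Rightarrow> real) \<Rightarrow> (real \<Rightarrow> real) \<Rightarrow> real" where
  "signed_integral S \<nu> f =
     (LINT r|pos_variation S \<nu>. f r) - (LINT r|pos_variation S (\<lambda>E. - \<nu> E). f r)"


section \<open>Gaussian measures\<close>

definition normal_law :: "real \<Rightarrow> real measure" where
  "normal_law v = (if v = 0 then return borel 0 else density lborel (normal_density 0 (sqrt v)))"

text \<open>A centered Gaussian measure with covariance \<open>Q\<close> on the subspace \<open>S\<close>: under it every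
  continuous linear functional \<open>z \<mapsto> \<langle>h, z\<rangle>\<close>, \<open>h \<in> S\<close>, has the law \<open>\<N>(0, \<langle>Qh, h\<rangle>)\<close>.\<close>

definition is_centered_gaussian_on ::
  "'a::real_inner set \<Rightarrow> ('a \<Rightarrow> 'a) \<Rightarrow> 'a measure \<Rightarrow> bool" where
  "is_centered_gaussian_on S Q \<mu> \<longleftrightarrow>
     prob_space \<mu> \<and> sets \<mu> = sets (restrict_space borel S) \<and>
     (\<forall>h\<in>S. distr \<mu> borel (\<lambda>z. h \<bullet> z) = normal_law (Q h \<bullet> h))"

definition gaussian_on :: "'a::real_inner set \<Rightarrow> ('a \<Rightarrow> 'a) \<Rightarrow> 'a measure" where
  "gaussian_on S Q = (THE \<mu>. is_centered_gaussian_on S Q \<mu>)"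


section \<open>The delay equation\<close>

text \<open>The semigroup \<open>e\<^bsup>tA\<^esup>\<close>, \<open>t \<ge> 0\<close>. The formula only sees the restriction of the second component
  to \<open>[-d,0]\<close> and takes values in \<open>Hsp d\<close>, so that on the ambient space this is the semigroup on
  \<open>Hsp d\<close> composed with the orthogonal projection; hence its ambient adjoint restricts to the
  adjoint on \<open>Hsp d\<close>.\<close>

definition sgA :: "real \<Rightarrow> real^'n^'n \<Rightarrow> real \<Rightarrow>
    (real^'n) \<times> (real^'n) L2 \<Rightarrow> (real^'n) \<times> (real^'n) L2" where
  "sgA d a0 t y =
     (mexp (t *\<^sub>R a0) *v fst y +
        (LINT s:{-d..0}|lborel.
           indicat_real {-t..0} s *\<^sub>R (mexp ((t + s) *\<^sub>R a0) *v L2_fun (snd y) s)),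
      L2_class (\<lambda>s. indicat_real {-d+t..0} s *\<^sub>R L2_fun (snd y) (s - t)))"

definition Gop :: "real^'q^'n \<Rightarrow> real^'q \<Rightarrow> (real^'n) \<times> (real^'n) L2" where
  "Gop \<sigma> y = (\<sigma> *v y, 0)"

definition Qt :: "real \<Rightarrow> real^'n^'n \<Rightarrow> real^'q^'n \<Rightarrow> real \<Rightarrow>
    (real^'n) \<times> (real^'n) L2 \<Rightarrow> (real^'n) \<times> (real^'n) L2" where
  "Qt d a0 \<sigma> t h =
     integral {0..t} (\<lambda>s. sgA d a0 s (Gop \<sigma> (adjoint (Gop \<sigma>) (adjoint (sgA d a0 s) h))))"

definition Qt0 :: "real^'n^'n \<Rightarrow> real^'q^'n \<Rightarrow> real \<Rightarrow> real^'n^'n" where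
  "Qt0 a0 \<sigma> t =
     integral {0..t} (\<lambda>s. mexp (s *\<^sub>R a0) ** \<sigma> ** transpose \<sigma> ** mexp (s *\<^sub>R transpose a0))"

definition Rt :: "real \<Rightarrow> real^'n^'n \<Rightarrow> real^'q^'n \<Rightarrow> real \<Rightarrow>
    ((real^'n) \<times> (real^'n) L2 \<Rightarrow> real) \<Rightarrow> (real^'n) \<times> (real^'n) L2 \<Rightarrow> real" where
  "Rt d a0 \<sigma> t f x = (LINT z|gaussian_on (Hsp d) (Qt d a0 \<sigma> t). f (z + sgA d a0 t x))"

text \<open>\<open>(e\<^bsup>tA\<^esup> B)\<^sub>0\<close> as a matrix; \<open>b1 E $ l $ j\<close> is the value on \<open>E\<close> of the \<open>(l,j)\<close> entry of the matrix
  of signed measures.\<close>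

definition etB0 :: "real \<Rightarrow> real^'n^'n \<Rightarrow> real^'m^'n \<Rightarrow> (real set \<Rightarrow> real^'m^'n) \<Rightarrow>
    real \<Rightarrow> real^'m^'n" where
  "etB0 d a0 b0 b1 t = mexp (t *\<^sub>R a0) ** b0 +
     (\<chi> i j. \<Sum>l\<in>UNIV. signed_integral {-d..0} (\<lambda>E. b1 E $ l $ j)
        (\<lambda>r. indicat_real {-t..0} r * mexp ((t + r) *\<^sub>R a0) $ i $ l))"

text \<open>\<open>b1\<close> is the measure \<open>\<beta>(r) dr\<close> with \<open>\<beta> \<in> L\<^sup>2([-d,0])\<close>. In this case \<open>B\<close> takes values in \<open>Hsp d\<close>.\<close>

definition has_L2_density :: "real \<Rightarrow> (real set \<Rightarrow> real^'m^'n) \<Rightarrow> (real \<Rightarrow> real^'m^'n) \<Rightarrow> bool" where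
  "has_L2_density d b1 \<beta> \<longleftrightarrow>
     sq_integrable (\<lambda>r. indicat_real {-d..0} r *\<^sub>R \<beta> r) \<and>
     (\<forall>E\<in>sets (restrict_space borel {-d..0}). b1 E = (LINT r:E|lborel. \<beta> r))"

definition Bop :: "real \<Rightarrow> real^'m^'n \<Rightarrow> (real \<Rightarrow> real^'m^'n) \<Rightarrow>
    real^'m \<Rightarrow> (real^'n) \<times> (real^'n) L2" where
  "Bop d b0 \<beta> k = (b0 *v k, L2_class (\<lambda>r. indicat_real {-d..0} r *\<^sub>R (\<beta> r *v k)))"


section \<open>Derivatives\<close>

definition has_gradient_on :: "'a::real_inner set \<Rightarrow> ('a \<Rightarrow> real) \<Rightarrow> 'a \<Rightarrow> 'a \<Rightarrow> bool" where
  "has_gradient_on S f x g \<longleftrightarrow> g \<in> S \<and> (f has_derivative (\<lambda>h. g \<bullet> h)) (at x within S)"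

definition gradient_on :: "'a::real_inner set \<Rightarrow> ('a \<Rightarrow> real) \<Rightarrow> 'a \<Rightarrow> 'a" where
  "gradient_on S f x = (THE g. has_gradient_on S f x g)"

text \<open>Here \<open>F s k\<close> stands for \<open>f(x + sBk)\<close>, and \<open>D\<close> for the \<open>B\<close>-gradient at \<open>x\<close>.\<close>

definition directional_gradient :: "(real \<Rightarrow> real^'m \<Rightarrow> real) \<Rightarrow> real^'m \<Rightarrow> bool" where
  "directional_gradient F D \<longleftrightarrow>
     (\<forall>k. ((\<lambda>s. (F s k - F 0 k) / s) \<longlongrightarrow> D \<bullet> k) (at 0)) \<and>
     uniform_limit (cball 0 1) (\<lambda>s k. (F s k - F 0 k) / s) (\<lambda>k. D \<bullet> k) (at 0)"

text \<open>\<open>B\<close>-Frechet differentiability at \<open>x\<close> with \<open>B\<close>-gradient \<open>D\<close>. If \<open>b1\<close> has an \<open>L\<^sup>2\<close> density, then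
  \<open>x + sBk\<close> is a point of \<open>Hsp d\<close>. Otherwise \<open>f\<close> has to be of the form \<open>y \<mapsto> g((e\<^bsup>tA\<^esup> y)\<^sub>0)\<close> on \<open>Hsp d\<close>,
  where \<open>g\<close> is unique since \<open>y \<mapsto> (e\<^bsup>tA\<^esup> y)\<^sub>0\<close> is onto.\<close>

definition has_B_gradient :: "real \<Rightarrow> real^'n^'n \<Rightarrow> real^'m^'n \<Rightarrow> (real set \<Rightarrow> real^'m^'n) \<Rightarrow> real \<Rightarrow>
    ((real^'n) \<times> (real^'n) L2 \<Rightarrow> real) \<Rightarrow> (real^'n) \<times> (real^'n) L2 \<Rightarrow> real^'m \<Rightarrow> bool" where
  "has_B_gradient d a0 b0 b1 t f x D \<longleftrightarrow>
     (if \<exists>\<beta>. has_L2_density d b1 \<beta>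
      then \<forall>\<beta>. has_L2_density d b1 \<beta> \<longrightarrow>
             directional_gradient (\<lambda>s k. f (x + s *\<^sub>R Bop d b0 \<beta> k)) D
      else \<exists>g. (\<forall>y\<in>Hsp d. f y = g (fst (sgA d a0 t y))) \<and>
             directional_gradient
               (\<lambda>s k. g (fst (sgA d a0 t x) + s *\<^sub>R (etB0 d a0 b0 b1 t *v k))) D)"

definition B_gradient :: "real \<Rightarrow> real^'n^'n \<Rightarrow> real^'m^'n \<Rightarrow> (real set \<Rightarrow> real^'m^'n) \<Rightarrow> real \<Rightarrow>
    ((real^'n) \<times> (real^'n) L2 \<Rightarrow> real) \<Rightarrow> (real^'n) \<times> (real^'n) L2 \<Rightarrow> real^'m" where
  "B_gradient d a0 b0 b1 t f x = (THE D. has_B_gradient d a0 b0 b1 t f x D)"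

end

theory Submission
  imports Defs
begin

text \<open>The covariance \<open>Q\<^sub>t\<close> is \<open>Q\<^sub>t\<^sup>0\<close> on the first component and zero elsewhere, so \<open>\<N>(0, Q\<^sub>t)\<close> is the image of
  \<open>\<N>(0, Q\<^sub>t\<^sup>0)\<close> under \<open>v \<mapsto> (v, 0)\<close> and \<open>R\<^sub>t[\<phi>](x) = P\<^sub>t((e\<^bsup>tA\<^esup> x)\<^sub>0)\<close>, where \<open>P\<^sub>t\<close> is the average of \<open>\<phi>\<close> over a
  translated nondegenerate Gaussian measure on \<open>\<real>\<^sup>n\<close>. After whitening by \<open>(Q\<^sub>t\<^sup>0)\<^bsup>-1/2\<^esup>\<close>, the
  Cameron-Martin density \<open>e\<^bsup>h \<bullet> w - |h|\<^sup>2/2\<^esup>\<close> gives a first order expansion of \<open>P\<^sub>t\<close> with remainder at most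
  \<open>\<parallel>\<phi>\<parallel> |h|\<^sup>2\<close>; both gradients and their bounds follow. Continuity in \<open>t\<close> comes from
  \<open>\<N>(0, Q\<^sub>t\<^sup>0) = \<N>(0, Q\<^sub>s\<^sup>0) * \<N>(0, Q\<^sub>t\<^sup>0 - Q\<^sub>s\<^sup>0)\<close> for \<open>s \<le> t\<close> and the Lipschitz continuity of \<open>P\<^sub>s\<close>. The rate
  in \<open>t\<close> is the lower bound \<open>y \<bullet> Q\<^sub>t\<^sup>0 y = \<integral>\<^sub>0\<^sup>t |\<sigma>\<^sup>* e\<^bsup>s a\<^sub>0\<^sup>*\<^esup> y|\<^sup>2 ds \<ge> c t\<^bsup>2r+1\<^esup> |y|\<^sup>2\<close>, obtained by replacing the
  integrand by its Taylor polynomial of degree \<open>r\<close>.\<close>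

section \<open>Gaussian measures on Euclidean spaces\<close>

text \<open>Gaussian measures, gradients and \<open>msqrt\<close> are definite descriptions, so each
  identity about them rests on a uniqueness proof. For measures on R^n this is the Cramer-Wold
  theorem. On \<open>Hsp d\<close> it is reduced to R^n: the variance vanishes along countably many
  functionals of the second component, which confines the measure to vectors \<open>(v, 0)\<close>.
  The function \<open>\<phi>\<close> is only bounded and measurable. Hence every derivative has to
  fall on the Gaussian density, and continuity in time cannot come from pointwise convergence of
  \<open>\<phi>\<close>; two times are compared through the smoothing already achieved at the
  earlier one. The exponent \<open>r + 1/2\<close> is half of \<open>2 * r + 1\<close>. The squared
  Taylor remainder contributes only the order \<open>2 * r + 3\<close>, so it is absorbed for small
  times, and monotonicity of \<open>Qt0\<close> in time carries the bound to any
  \<open>(0, T]\<close>. Both gradients come from one vector \<open>q\<close> of R^n representing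
  the derivative of the finite-dimensional average: the first is \<open>adj0\<close> at
  \<open>q\<close>, the second \<open>transpose (etB0 ...) *v q\<close>. A control operator with
  measure values thus enters through the matrix \<open>etB0\<close> alone.\<close>

definition std_gauss_density :: "'a::euclidean_space \<Rightarrow> real" where
  "std_gauss_density x = (\<Prod>b\<in>Basis. std_normal_density (x \<bullet> b))"

definition std_gauss :: "'a::euclidean_space measure" where
  "std_gauss = density lborel (\<lambda>x. ennreal (std_gauss_density x))"

lemma std_gauss_density_nonneg [simp]: "0 \<le> std_gauss_density x"
  by (simp add: std_gauss_density_def prod_nonneg)

lemma std_gauss_density_eq:
  fixes x :: "'a::euclidean_space"
  shows "std_gauss_density x = (1 / sqrt (2 * pi)) ^ DIM('a) * exp (- (norm x)\<^sup>2 / 2)"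
proof -
  have "(\<Sum>b\<in>Basis. - (x \<bullet> b)\<^sup>2 / 2) = - (norm x)\<^sup>2 / 2"
    unfolding norm_eq_sqrt_inner
    by (subst (2) euclidean_inner)
      (simp add: sum_nonneg sum_negf power2_eq_square flip: sum_divide_distrib)
  then show ?thesis
    by (simp add: std_gauss_density_def std_normal_density_def power_divide prod_dividef prod.distrib flip: exp_sum)
qed

lemma std_gauss_density_measurable [measurable]: "std_gauss_density \<in> borel_measurable borel"
  unfolding std_gauss_density_def[abs_def] by measurable

lemma sets_std_gauss [simp, measurable_cong]: "sets std_gauss = sets borel"
  and space_std_gauss [simp]: "space std_gauss = UNIV"
  by (simp_all add: std_gauss_def)

text \<open>The density is a product over the coordinates, so Tonelli splits the integral over a box
  into one-dimensional integrals.\<close>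

lemma std_gauss_box_prod:
  fixes A :: "'a::euclidean_space \<Rightarrow> real set"
  assumes [measurable]: "\<And>b. b \<in> Basis \<Longrightarrow> A b \<in> sets borel"
  shows "emeasure std_gauss {x. \<forall>b\<in>Basis. x \<bullet> b \<in> A b}
    = (\<Prod>b\<in>Basis. emeasure std_normal_distribution (A b))"
proof -
  have "emeasure std_gauss {x. \<forall>b\<in>Basis. x \<bullet> b \<in> A b}
     = (\<integral>\<^sup>+x. (\<Prod>b\<in>Basis. ennreal (std_normal_density (x \<bullet> b)) * indicator (A b) (x \<bullet> b)) \<partial>lborel)"
    unfolding std_gauss_def
    by (subst emeasure_density)
      (auto simp: std_gauss_density_def prod_ennreal[symmetric] prod.distrib indicator_def intro!: nn_integral_cong)
  also have "\<dots> = (\<Prod>b\<in>Basis. emeasure std_normal_distribution (A b))"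
    by (subst nn_integral_lborel_prod) (auto simp: emeasure_density)
  finally show ?thesis .
qed

lemma prob_space_std_normal_distribution: "prob_space std_normal_distribution"
  by (rule prob_space_normal_density) simp

lemma prob_space_std_gauss: "prob_space (std_gauss :: 'a::euclidean_space measure)"
proof
  show "emeasure (std_gauss :: 'a measure) (space std_gauss) = 1"
    using std_gauss_box_prod[of "\<lambda>_::'a. UNIV"] prob_space.emeasure_space_1[OF prob_space_std_normal_distribution]
    by simp
qed

lemma distr_std_gauss_Basis:
  fixes b :: "'a::euclidean_space"
  assumes "b \<in> Basis"
  shows "distr std_gauss borel (\<lambda>x. x \<bullet> b) = std_normal_distribution"
proof (rule measure_eqI)
  fix X assume "X \<in> sets (distr std_gauss borel (\<lambda>x. x \<bullet> b))"
  then have [measurable]: "X \<in> sets borel" by simp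
  let ?A = "\<lambda>c. if c = b then X else UNIV"
  have "emeasure (distr std_gauss borel (\<lambda>x. x \<bullet> b)) X = emeasure std_gauss {x. \<forall>c\<in>Basis. x \<bullet> c \<in> ?A c}"
    using assms by (auto simp: emeasure_distr intro!: arg_cong[where f="emeasure std_gauss"])
  also have "\<dots> = (\<Prod>c\<in>Basis. emeasure std_normal_distribution (?A c))"
    by (rule std_gauss_box_prod) auto
  also have "\<dots> = (\<Prod>c\<in>Basis. if c = b then emeasure std_normal_distribution X else 1)"
    using prob_space.emeasure_space_1[OF prob_space_std_normal_distribution]
    by (intro prod.cong) auto
  also have "\<dots> = emeasure std_normal_distribution X"
    using assms by simp
  finally show "emeasure (distr std_gauss borel (\<lambda>x. x \<bullet> b)) X = emeasure std_normal_distribution X" .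
qed simp

text \<open>Independence is checked on the Borel sets themselves, an intersection-stable generator,
  where it is the product formula \<open>std_gauss_box_prod\<close>.\<close>

lemma indep_vars_std_gauss:
  "prob_space.indep_vars (std_gauss :: 'a::euclidean_space measure) (\<lambda>_. borel) (\<lambda>b x. x \<bullet> b) Basis"
proof -
  interpret prob_space "std_gauss :: 'a measure" by (rule prob_space_std_gauss)
  show ?thesis
  proof (subst indep_vars_finite[where E="\<lambda>_. sets borel"])
    show "\<forall>A\<in>Basis \<rightarrow> sets borel. prob (\<Inter>b\<in>Basis. (\<lambda>x::'a. x \<bullet> b) -` A b \<inter> space std_gauss) =
      (\<Prod>b\<in>Basis. prob ((\<lambda>x. x \<bullet> b) -` A b \<inter> space std_gauss))"
    proof
      fix A :: "'a \<Rightarrow> real set" assume A: "A \<in> Basis \<rightarrow> sets borel"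
      have 1: "prob {x. \<forall>b\<in>Basis. x \<bullet> b \<in> A b} = (\<Prod>b\<in>Basis. measure std_normal_distribution (A b))"
        using std_gauss_box_prod[of A] A
          finite_measure.emeasure_eq_measure[OF prob_space.finite_measure[OF prob_space_std_normal_distribution]]
        by (simp add: Pi_iff emeasure_eq_measure prod_ennreal prod_nonneg)
      have 2: "measure std_normal_distribution (A b) = prob ((\<lambda>x. x \<bullet> b) -` A b \<inter> space std_gauss)"
        if "b \<in> Basis" for b
        using that A
        by (subst distr_std_gauss_Basis[OF that, symmetric], subst measure_distr) (auto simp: Pi_iff)
      have 3: "(\<Inter>b\<in>Basis. (\<lambda>x::'a. x \<bullet> b) -` A b \<inter> space std_gauss) = {x. \<forall>b\<in>Basis. x \<bullet> b \<in> A b}"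
        by auto
      show "prob (\<Inter>b\<in>Basis. (\<lambda>x::'a. x \<bullet> b) -` A b \<inter> space std_gauss) =
        (\<Prod>b\<in>Basis. prob ((\<lambda>x. x \<bullet> b) -` A b \<inter> space std_gauss))"
        unfolding 3 1 using 2 by simp
    qed
  qed (use sets.sigma_sets_eq[of "borel :: real measure"] in \<open>simp_all add: Int_stable_def\<close>)
qed

lemma char_distr_scale:
  assumes "f \<in> borel_measurable M"
  shows "char (distr M borel (\<lambda>x. c * f x)) t = char (distr M borel f) (c * t)"
  using assms by (simp add: char_def integral_distr mult_ac)

text \<open>\<open>h \<bullet> x\<close> is a sum of independent scaled standard normal variables,
  so its characteristic function is a product of Gaussian factors whose exponents add up to the
  squared norm of \<open>h\<close>.\<close>

lemma char_std_gauss_inner: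
  fixes h :: "'a::euclidean_space"
  shows "char (distr std_gauss borel (\<lambda>x. h \<bullet> x)) t = exp (- (norm h)\<^sup>2 * t\<^sup>2 / 2)"
proof -
  interpret prob_space "std_gauss :: 'a measure" by (rule prob_space_std_gauss)
  have eq: "(\<lambda>x. h \<bullet> x) = (\<lambda>x. \<Sum>b\<in>Basis. (h \<bullet> b) * (x \<bullet> b))"
    by (rule ext) (rule euclidean_inner)
  have *: "char (distr std_gauss borel (\<lambda>x. (h \<bullet> b) * (x \<bullet> b))) t = exp (- ((h \<bullet> b) * t)\<^sup>2 / 2)"
    if "b \<in> Basis" for b
    using that by (simp add: char_distr_scale distr_std_gauss_Basis char_std_normal_distribution)
  have "indep_vars (\<lambda>_. borel) (\<lambda>b x::'a. (h \<bullet> b) * (x \<bullet> b)) Basis"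
    using indep_vars_compose2[OF indep_vars_std_gauss, where Y="\<lambda>b x. (h \<bullet> b) * x" and N="\<lambda>_. borel"]
    by simp
  then have "char (distr std_gauss borel (\<lambda>x. h \<bullet> x)) t
     = (\<Prod>b\<in>Basis. char (distr std_gauss borel (\<lambda>x. (h \<bullet> b) * (x \<bullet> b))) t)"
    by (subst (1) eq) (rule char_distr_sum)
  also have "\<dots> = (\<Prod>b\<in>Basis. exp (- ((h \<bullet> b) * t)\<^sup>2 / 2))"
    using * by simp
  also have "\<dots> = exp (\<Sum>b\<in>Basis. - ((h \<bullet> b) * t)\<^sup>2 / 2)"
    by (simp add: exp_sum)
  also have "(\<Sum>b\<in>Basis. - ((h \<bullet> b) * t)\<^sup>2 / 2) = - (norm h)\<^sup>2 * t\<^sup>2 / 2"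
    unfolding power2_norm_eq_inner euclidean_inner[of h h]
    by (simp add: sum_negf power2_eq_square sum_distrib_left mult_ac flip: sum_divide_distrib)
  finally show ?thesis by simp
qed

lemma real_distribution_normal_law: "0 \<le> v \<Longrightarrow> real_distribution (normal_law v)"
  unfolding real_distribution_def real_distribution_axioms_def normal_law_def
  by (auto intro!: prob_space_return prob_space_normal_density)

text \<open>For positive \<open>v\<close> the law is the image of the standard normal law under
  multiplication by \<open>sqrt v\<close>; for \<open>v = 0\<close> it is a Dirac mass.\<close>

lemma char_normal_law:
  assumes "0 \<le> v"
  shows "char (normal_law v) t = exp (- v * t\<^sup>2 / 2)"
proof (cases "v = 0")
  case True
  then show ?thesis by (simp add: normal_law_def char_def integral_return)
next
  case False
  interpret prob_space std_normal_distribution by (rule prob_space_std_normal_distribution)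
  have "distributed std_normal_distribution lborel (\<lambda>x. x) std_normal_density"
    by (auto simp: distributed_def distr_id2)
  from normal_density_affine[OF this, of "sqrt v" 0]
  have "distributed std_normal_distribution lborel (\<lambda>x. sqrt v * x) (normal_density 0 (sqrt v))"
    using False assms by simp
  then have "normal_law v = distr std_normal_distribution lborel (\<lambda>x. sqrt v * x)"
    using False by (simp add: normal_law_def distributed_def)
  also have "\<dots> = distr std_normal_distribution borel (\<lambda>x. sqrt v * x)"
    by (rule distr_cong) auto
  finally have "char (normal_law v) t = char (distr std_normal_distribution borel (\<lambda>x. x)) (sqrt v * t)"
    using char_distr_scale[of "\<lambda>x. x" std_normal_distribution "sqrt v" t] by simp
  then show ?thesis
    using assms by (simp add: distr_id2 char_std_normal_distribution power_mult_distrib)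
qed

lemma distr_std_gauss_inner:
  fixes h :: "'a::euclidean_space"
  shows "distr std_gauss borel (\<lambda>x. h \<bullet> x) = normal_law ((norm h)\<^sup>2)"
proof (rule Levy_uniqueness)
  interpret prob_space "std_gauss :: 'a measure" by (rule prob_space_std_gauss)
  show "real_distribution (distr std_gauss borel (\<lambda>x. h \<bullet> x))"
    by (auto simp: real_distribution_def real_distribution_axioms_def intro!: prob_space_distr)
  show "real_distribution (normal_law ((norm h)\<^sup>2))"
    by (rule real_distribution_normal_law) simp
  show "char (distr std_gauss borel (\<lambda>x. h \<bullet> x)) = char (normal_law ((norm h)\<^sup>2))"
    by (rule ext) (simp add: char_std_gauss_inner char_normal_law)
qed

text \<open>The Cameron-Martin formula: translation invariance of Lebesgue measure moves the shift
  into the density, and expanding the square in the exponent yields the factor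
  \<open>exp (h \<bullet> x - (norm h)\<^sup>2 / 2)\<close>.\<close>

lemma std_gauss_shift:
  fixes h :: "'a::euclidean_space"
  shows "distr std_gauss borel (\<lambda>x. x + h)
    = density std_gauss (\<lambda>x. ennreal (exp (h \<bullet> x - (norm h)\<^sup>2 / 2)))" (is "?L = ?R")
proof (rule measure_eqI)
  fix X :: "'a set" assume "X \<in> sets ?L"
  then have [measurable]: "X \<in> sets borel" by simp
  have [measurable]: "(\<lambda>x. x + h) \<in> borel \<rightarrow>\<^sub>M borel" by simp
  have dens: "std_gauss_density (x - h) = std_gauss_density x * exp (h \<bullet> x - (norm h)\<^sup>2 / 2)" for x :: 'a
  proof -
    have "- (norm (x - h))\<^sup>2 / 2 = - (norm x)\<^sup>2 / 2 + (h \<bullet> x - (norm h)\<^sup>2 / 2)"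
      by (simp add: power2_norm_eq_inner inner_diff inner_commute field_simps)
    then show ?thesis by (simp add: std_gauss_density_eq flip: exp_add)
  qed
  have "emeasure ?L X = (\<integral>\<^sup>+x. indicator X (x + h) \<partial>std_gauss)"
    by (simp add: nn_integral_distr flip: nn_integral_indicator)
  also have "\<dots> = (\<integral>\<^sup>+x. ennreal (std_gauss_density x) * indicator X (x + h) \<partial>lborel)"
    by (simp add: std_gauss_def nn_integral_density)
  also have "\<dots> = (\<integral>\<^sup>+x. ennreal (std_gauss_density ((h + x) - h)) * indicator X (h + x) \<partial>lborel)"
    by (simp add: add.commute)
  also have "\<dots> = (\<integral>\<^sup>+x. ennreal (std_gauss_density (x - h)) * indicator X x \<partial>distr lborel borel ((+) h))"
    by (subst nn_integral_distr) auto
  also have "\<dots> = emeasure ?R X"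
    by (simp add: lborel_distr_plus std_gauss_def density_density_eq emeasure_density dens ennreal_mult)
  finally show "emeasure ?L X = emeasure ?R X" .
qed simp

section \<open>Measures are determined by their one-dimensional projections\<close>

lemma nn_integral_std_gauss_affine:
  fixes f :: "'a::euclidean_space \<Rightarrow> ennreal"
  assumes [measurable]: "f \<in> borel_measurable borel" and c: "c > 0"
  shows "(\<integral>\<^sup>+w. f (z + (1 / c) *\<^sub>R w) \<partial>std_gauss)
    = ennreal (c ^ DIM('a)) * (\<integral>\<^sup>+x. f x * ennreal (std_gauss_density (c *\<^sub>R (x - z))) \<partial>lborel)"
proof -
  have [measurable]: "(\<lambda>w::'a. z + (1 / c) *\<^sub>R w) \<in> borel \<rightarrow>\<^sub>M borel" by simp
  have "(\<integral>\<^sup>+x. f x * ennreal (std_gauss_density (c *\<^sub>R (x - z))) \<partial>lborel)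
    = ennreal (\<bar>1 / c\<bar> ^ DIM('a)) * (\<integral>\<^sup>+w. f (z + (1 / c) *\<^sub>R w) * ennreal (std_gauss_density w) \<partial>lborel)"
    using c
    by (subst lborel_affine[of "1 / c" z])
      (auto simp: nn_integral_density nn_integral_distr nn_integral_cmult)
  then have "ennreal (c ^ DIM('a)) * (\<integral>\<^sup>+x. f x * ennreal (std_gauss_density (c *\<^sub>R (x - z))) \<partial>lborel)
    = ennreal (c ^ DIM('a) * \<bar>1 / c\<bar> ^ DIM('a)) * (\<integral>\<^sup>+w. f (z + (1 / c) *\<^sub>R w) * ennreal (std_gauss_density w) \<partial>lborel)"
    using c by (simp add: ennreal_mult mult.assoc)
  also have "c ^ DIM('a) * \<bar>1 / c\<bar> ^ DIM('a) = 1"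
    using c by (simp add: power_divide)
  finally show ?thesis
    by (simp add: std_gauss_def nn_integral_density mult.commute)
qed

text \<open>The Gaussian kernel is itself a Fourier transform: its value at
  \<open>c *\<^sub>R (x - z)\<close> is the mean of
  \<open>iexp ((c *\<^sub>R (x - z)) \<bullet> w)\<close> under \<open>std_gauss\<close>. Fubini
  then leaves the characteristic function of \<open>z \<mapsto> w \<bullet> z\<close> at
  \<open>-c\<close>, which only sees a projection of the measure.\<close>

lemma gaussian_kernel_integral_eq:
  fixes \<mu> \<nu> :: "'a::euclidean_space measure"
  assumes "prob_space \<mu>" "prob_space \<nu>" and sets: "sets \<mu> = sets borel" "sets \<nu> = sets borel"
    and eq: "\<And>h. distr \<mu> borel (\<lambda>z. h \<bullet> z) = distr \<nu> borel (\<lambda>z. h \<bullet> z)"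
  shows "(LINT z|\<mu>. exp (- (norm (c *\<^sub>R (x - z)))\<^sup>2 / 2)) = (LINT z|\<nu>. exp (- (norm (c *\<^sub>R (x - z)))\<^sup>2 / 2))"
proof -
  have *: "complex_of_real (LINT z|M. exp (- (norm (c *\<^sub>R (x - z)))\<^sup>2 / 2))
     = (CLINT w|std_gauss. iexp (c * (w \<bullet> x)) * char (distr M borel (\<lambda>z. w \<bullet> z)) (- c))"
    if M: "prob_space M" and s: "sets M = sets borel" for M :: "'a measure"
  proof -
    interpret M: prob_space M by fact
    interpret G: prob_space "std_gauss :: 'a measure" by (rule prob_space_std_gauss)
    interpret pair_prob_space M "std_gauss :: 'a measure" ..
    note [measurable_cong] = s
    have k: "complex_of_real (exp (- (norm (c *\<^sub>R (x - z)))\<^sup>2 / 2))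
      = (CLINT w|std_gauss. iexp (c * (w \<bullet> x)) * iexp (- c * (w \<bullet> z)))" for z
    proof -
      have "complex_of_real (exp (- (norm (c *\<^sub>R (x - z)))\<^sup>2 / 2)) = (CLINT w|std_gauss. iexp ((c *\<^sub>R (x - z)) \<bullet> w))"
        using char_std_gauss_inner[of "c *\<^sub>R (x - z)" 1] by (simp add: char_def integral_distr)
      also have "\<dots> = (CLINT w|std_gauss. iexp (c * (w \<bullet> x)) * iexp (- c * (w \<bullet> z)))"
        by (intro Bochner_Integration.integral_cong refl)
          (simp add: inner_commute inner_diff_right algebra_simps flip: exp_add)
      finally show ?thesis .
    qed
    have "complex_of_real (LINT z|M. exp (- (norm (c *\<^sub>R (x - z)))\<^sup>2 / 2))
      = (CLINT z|M. CLINT w|std_gauss. iexp (c * (w \<bullet> x)) * iexp (- c * (w \<bullet> z)))"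
      by (subst k[symmetric]) (simp add: integral_complex_of_real)
    also have "\<dots> = (CLINT w|std_gauss. CLINT z|M. iexp (c * (w \<bullet> x)) * iexp (- c * (w \<bullet> z)))"
      by (rule Fubini_integral[symmetric])
        (auto intro!: P.integrable_const_bound[where B=1] simp: split_beta norm_mult)
    also have "\<dots> = (CLINT w|std_gauss. iexp (c * (w \<bullet> x)) * char (distr M borel (\<lambda>z. w \<bullet> z)) (- c))"
      by (simp add: char_def integral_distr)
    finally show ?thesis .
  qed
  have "complex_of_real (LINT z|\<mu>. exp (- (norm (c *\<^sub>R (x - z)))\<^sup>2 / 2))
    = complex_of_real (LINT z|\<nu>. exp (- (norm (c *\<^sub>R (x - z)))\<^sup>2 / 2))"
    using *[OF assms(1) sets(1)] *[OF assms(2) sets(2)] by (simp only: eq)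
  then show ?thesis by (simp only: of_real_eq_iff)
qed

text \<open>After the substitution \<open>x = z + (1 / c) *\<^sub>R w\<close> and Tonelli, the
  smoothed integral becomes a Lebesgue integral of \<open>f\<close> against the kernel averaged over
  the measure, and this average is fixed by \<open>gaussian_kernel_integral_eq\<close>.\<close>

lemma nn_integral_gaussian_smoothing_eq:
  fixes \<mu> \<nu> :: "'a::euclidean_space measure"
  assumes "prob_space \<mu>" "prob_space \<nu>" and sets: "sets \<mu> = sets borel" "sets \<nu> = sets borel"
    and eq: "\<And>h. distr \<mu> borel (\<lambda>z. h \<bullet> z) = distr \<nu> borel (\<lambda>z. h \<bullet> z)"
    and [measurable]: "f \<in> borel_measurable borel" and c: "c > 0"
  shows "(\<integral>\<^sup>+z. \<integral>\<^sup>+w. f (z + (1 / c) *\<^sub>R w) \<partial>std_gauss \<partial>\<mu>)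
    = (\<integral>\<^sup>+z. \<integral>\<^sup>+w. f (z + (1 / c) *\<^sub>R w) \<partial>std_gauss \<partial>\<nu>)"
proof -
  let ?K = "(1 / sqrt (2 * pi)) ^ DIM('a)"
  have *: "(\<integral>\<^sup>+z. \<integral>\<^sup>+w. f (z + (1 / c) *\<^sub>R w) \<partial>std_gauss \<partial>M) = ennreal (c ^ DIM('a)) *
     (\<integral>\<^sup>+x. f x * ennreal (?K * (LINT z|M. exp (- (norm (c *\<^sub>R (x - z)))\<^sup>2 / 2))) \<partial>lborel)"
    if M: "prob_space M" and s: "sets M = sets borel" for M :: "'a measure"
  proof -
    interpret M: prob_space M by fact
    interpret pair_sigma_finite M "lborel :: 'a measure" ..
    note [measurable_cong] = s
    have "(\<integral>\<^sup>+z. \<integral>\<^sup>+w. f (z + (1 / c) *\<^sub>R w) \<partial>std_gauss \<partial>M)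
      = ennreal (c ^ DIM('a)) * (\<integral>\<^sup>+z. \<integral>\<^sup>+x. f x * ennreal (std_gauss_density (c *\<^sub>R (x - z))) \<partial>lborel \<partial>M)"
      by (simp add: nn_integral_std_gauss_affine c nn_integral_cmult)
    also have "(\<integral>\<^sup>+z. \<integral>\<^sup>+x. f x * ennreal (std_gauss_density (c *\<^sub>R (x - z))) \<partial>lborel \<partial>M)
      = (\<integral>\<^sup>+x. \<integral>\<^sup>+z. f x * ennreal (std_gauss_density (c *\<^sub>R (x - z))) \<partial>M \<partial>lborel)"
      by (rule Fubini'[symmetric]) measurable
    also have "\<dots> = (\<integral>\<^sup>+x. f x * ennreal (?K * (LINT z|M. exp (- (norm (c *\<^sub>R (x - z)))\<^sup>2 / 2))) \<partial>lborel)"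
    proof (intro nn_integral_cong)
      fix x :: 'a
      have "(\<integral>\<^sup>+z. ennreal (std_gauss_density (c *\<^sub>R (x - z))) \<partial>M)
        = ennreal (LINT z|M. ?K * exp (- (norm (c *\<^sub>R (x - z)))\<^sup>2 / 2))"
        unfolding std_gauss_density_eq
        by (rule nn_integral_eq_integral)
          (auto intro!: M.integrable_const_bound[where B=1])
      then show "(\<integral>\<^sup>+z. f x * ennreal (std_gauss_density (c *\<^sub>R (x - z))) \<partial>M)
        = f x * ennreal (?K * (LINT z|M. exp (- (norm (c *\<^sub>R (x - z)))\<^sup>2 / 2)))"
        by (subst nn_integral_cmult) auto
    qed
    finally show ?thesis .
  qed
  show ?thesis
    unfolding *[OF assms(1) sets(1)] *[OF assms(2) sets(2)]
    by (simp only: gaussian_kernel_integral_eq[OF assms(1,2) sets eq])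
qed

text \<open>The smoothing is removed by letting \<open>c = Suc k\<close> tend to infinity, with
  dominated convergence on the product of the measure with \<open>std_gauss\<close>; this is where
  continuity of \<open>f\<close> enters.\<close>

lemma nn_integral_continuous_eq:
  fixes \<mu> \<nu> :: "'a::euclidean_space measure" and f :: "'a \<Rightarrow> real"
  assumes "prob_space \<mu>" "prob_space \<nu>" and sets: "sets \<mu> = sets borel" "sets \<nu> = sets borel"
    and eq: "\<And>h. distr \<mu> borel (\<lambda>z. h \<bullet> z) = distr \<nu> borel (\<lambda>z. h \<bullet> z)"
    and cont: "continuous_on UNIV f" and bd: "\<And>x. 0 \<le> f x" "\<And>x. f x \<le> 1"
  shows "(\<integral>\<^sup>+z. f z \<partial>\<mu>) = (\<integral>\<^sup>+z. f z \<partial>\<nu>)"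
proof -
  have [measurable]: "f \<in> borel_measurable borel"
    using cont by (rule borel_measurable_continuous_onI)
  have *: "(\<lambda>k. \<integral>\<^sup>+z. \<integral>\<^sup>+w. f (z + (1 / real (Suc k)) *\<^sub>R w) \<partial>std_gauss \<partial>M) \<longlonglongrightarrow> (\<integral>\<^sup>+z. f z \<partial>M)"
    if M: "prob_space M" and s: "sets M = sets borel" for M :: "'a measure"
  proof -
    interpret M: prob_space M by fact
    interpret G: prob_space "std_gauss :: 'a measure" by (rule prob_space_std_gauss)
    interpret pair_prob_space M "std_gauss :: 'a measure" ..
    note [measurable_cong] = s
    have "(\<lambda>k. \<integral>\<^sup>+y. f (fst y + (1 / real (Suc k)) *\<^sub>R snd y) \<partial>(M \<Otimes>\<^sub>M std_gauss))
      \<longlonglongrightarrow> (\<integral>\<^sup>+y. f (fst y) \<partial>(M \<Otimes>\<^sub>M (std_gauss :: 'a measure)))"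
    proof (rule nn_integral_dominated_convergence[where w="\<lambda>_. 1"])
      show "AE y in M \<Otimes>\<^sub>M (std_gauss :: 'a measure). (\<lambda>k. ennreal (f (fst y + (1 / real (Suc k)) *\<^sub>R snd y))) \<longlonglongrightarrow> ennreal (f (fst y))"
      proof (intro AE_I2 tendsto_ennrealI)
        fix y :: "'a \<times> 'a"
        have "(\<lambda>k. fst y + (1 / real (Suc k)) *\<^sub>R snd y) \<longlonglongrightarrow> fst y + 0 *\<^sub>R snd y"
          by (intro tendsto_intros LIMSEQ_Suc[OF lim_1_over_n])
        then show "(\<lambda>k. f (fst y + (1 / real (Suc k)) *\<^sub>R snd y)) \<longlonglongrightarrow> f (fst y)"
          using continuous_on_tendsto_compose[OF cont] by simp
      qed
    qed (use bd P.emeasure_space_1 in auto)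
    moreover have "(\<integral>\<^sup>+y. f (fst y + (1 / real (Suc k)) *\<^sub>R snd y) \<partial>(M \<Otimes>\<^sub>M std_gauss))
      = (\<integral>\<^sup>+z. \<integral>\<^sup>+w. f (z + (1 / real (Suc k)) *\<^sub>R w) \<partial>std_gauss \<partial>M)" for k
      by (subst G.nn_integral_fst[symmetric]) auto
    moreover have "(\<integral>\<^sup>+y. f (fst y) \<partial>(M \<Otimes>\<^sub>M (std_gauss :: 'a measure))) = (\<integral>\<^sup>+z. f z \<partial>M)"
      using G.emeasure_space_1 by (subst G.nn_integral_fst[symmetric]) auto
    ultimately show ?thesis by simp
  qed
  have "(\<lambda>k. \<integral>\<^sup>+z. \<integral>\<^sup>+w. f (z + (1 / real (Suc k)) *\<^sub>R w) \<partial>std_gauss \<partial>\<mu>)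
    = (\<lambda>k. \<integral>\<^sup>+z. \<integral>\<^sup>+w. f (z + (1 / real (Suc k)) *\<^sub>R w) \<partial>std_gauss \<partial>\<nu>)"
    by (intro ext nn_integral_gaussian_smoothing_eq[OF assms(1,2) sets eq]) auto
  with *[OF assms(1) sets(1)] *[OF assms(2) sets(2)] show ?thesis
    by (metis LIMSEQ_unique)
qed

text \<open>The Fourier transforms of the measures agree, so by Fubini their convolutions with
  \<open>N(0, \<epsilon>)\<close> agree as well; then \<open>\<epsilon> \<rightarrow> 0\<close>.\<close>

theorem Cramer_Wold:
  fixes \<mu> \<nu> :: "'a::euclidean_space measure"
  assumes "prob_space \<mu>" "prob_space \<nu>" and sets: "sets \<mu> = sets borel" "sets \<nu> = sets borel"
    and eq: "\<And>h. distr \<mu> borel (\<lambda>z. h \<bullet> z) = distr \<nu> borel (\<lambda>z. h \<bullet> z)"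
  shows "\<mu> = \<nu>"
proof (rule measure_eqI_generator_eq[where E="{S. open S}" and \<Omega>=UNIV and A="\<lambda>_. UNIV"])
  have opens: "sets borel = sigma_sets UNIV {S::'a set. open S}"
    by (simp add: borel_def)
  show "sets \<mu> = sigma_sets UNIV {S. open S}" "sets \<nu> = sigma_sets UNIV {S. open S}"
    using sets opens by auto
  fix U :: "'a set" assume "U \<in> {S. open S}"
  then have U: "open U" by simp
  have top: "space \<mu> = UNIV" "space \<nu> = UNIV"
    using sets[THEN sets_eq_imp_space_eq] by auto
  show "emeasure \<mu> U = emeasure \<nu> U"
  proof (cases "U = UNIV")
    case True
    then show ?thesis
      using prob_space.emeasure_space_1[OF assms(1)] prob_space.emeasure_space_1[OF assms(2)] top by simp
  next
    case False
    \<comment> \<open>Continuous functions converging pointwise to the indicator of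
      \<open>U\<close>. The case \<open>U = UNIV\<close> is treated apart because
      \<open>infdist\<close> to the empty set is 0 by convention.\<close>
    define f where "f k z = min 1 (real k * infdist z (- U))" for k :: nat and z
    have cont: "continuous_on UNIV (f k)" for k
      unfolding f_def by (intro continuous_intros)
    then have [measurable]: "f k \<in> borel_measurable borel" for k
      by (rule borel_measurable_continuous_onI)
    have bd: "0 \<le> f k z" "f k z \<le> 1" for k z
      by (auto simp: f_def infdist_nonneg)
    have lim: "(\<lambda>k. ennreal (f k z)) \<longlonglongrightarrow> indicator U z" for z
    proof (cases "z \<in> U")
      case True
      then have "infdist z (- U) > 0"
        using U False by (subst infdist_pos_not_in_closed) (auto simp: closed_Compl)
      then obtain n :: nat where n: "real n * infdist z (- U) > 1"
        using reals_Archimedean3 by blast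
      have "f k z = 1" if "k \<ge> n" for k
      proof -
        have "real n * infdist z (- U) \<le> real k * infdist z (- U)"
          using that by (intro mult_right_mono infdist_nonneg) auto
        with n show ?thesis by (simp add: f_def)
      qed
      then have "(\<lambda>k. ennreal (f k z)) \<longlonglongrightarrow> 1"
        by (intro tendsto_eventually eventually_sequentiallyI[of n]) auto
      with True show ?thesis by simp
    next
      case False
      then show ?thesis by (simp add: f_def)
    qed
    have conv: "(\<lambda>k. \<integral>\<^sup>+z. f k z \<partial>M) \<longlonglongrightarrow> emeasure M U"
      if M: "prob_space M" and s: "sets M = sets borel" for M :: "'a measure"
    proof -
      interpret M: prob_space M by fact
      note [measurable_cong] = s
      have [measurable]: "U \<in> sets borel" using U by simp
      have "(\<lambda>k. \<integral>\<^sup>+z. f k z \<partial>M) \<longlonglongrightarrow> (\<integral>\<^sup>+z. indicator U z \<partial>M)"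
        using U lim bd
        by (intro nn_integral_dominated_convergence[where w="\<lambda>_. 1"]) (auto simp: M.emeasure_space_1)
      then show ?thesis using U s by simp
    qed
    have "(\<lambda>k. \<integral>\<^sup>+z. f k z \<partial>\<mu>) = (\<lambda>k. \<integral>\<^sup>+z. f k z \<partial>\<nu>)"
      by (intro ext nn_integral_continuous_eq[OF assms(1,2) sets eq] cont bd)
    with conv[OF assms(1) sets(1)] conv[OF assms(2) sets(2)] show ?thesis
      by (metis LIMSEQ_unique)
  qed
qed (use prob_space.emeasure_space_1[OF assms(1)] sets_eq_imp_space_eq[OF sets(1)] in
    \<open>auto simp: Int_stable_def open_Int\<close>)

section \<open>Matrix exponential and square root\<close>

lemma transpose_add: "transpose (A + B) = transpose A + transpose B"
  for A :: "'a::plus^'n^'m"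
  by (simp add: transpose_def vec_eq_iff)

lemma transpose_diff: "transpose (A - B) = transpose A - transpose B"
  for A :: "'a::minus^'n^'m"
  by (simp add: transpose_def vec_eq_iff)

lemma bounded_linear_transpose: "bounded_linear (transpose :: real^'n^'m \<Rightarrow> real^'m^'n)"
  by (intro linear_conv_bounded_linear[THEN iffD1] linearI transpose_add transpose_scalar)

lemma matrix_mult_scaleR: "(c *\<^sub>R A) ** B = c *\<^sub>R (A ** B)" "A ** (c *\<^sub>R B) = c *\<^sub>R (A ** B)"
  for A :: "real^'n^'m" and B :: "real^'k^'n"
  by (simp_all add: matrix_matrix_mult_def vec_eq_iff sum_distrib_left mult_ac)

lemma matrix_diff_ldistrib: "A ** (B - C) = A ** B - A ** C"
  and matrix_diff_rdistrib: "(B - C) ** D = B ** D - C ** D"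
  for A :: "real^'n^'m" and B C :: "real^'k^'n" and D :: "real^'l^'k"
  by (simp_all add: matrix_matrix_mult_def vec_eq_iff algebra_simps sum_subtractf)

lemma matrix_vector_mult_scaleR_left: "(c *\<^sub>R A) *v x = c *\<^sub>R (A *v x)" for A :: "real^'n^'m"
  by (simp add: matrix_vector_mult_def vec_eq_iff sum_distrib_left mult_ac)

lemma matrix_add_rdistrib: "(A + B) ** C = A ** C + B ** C" for A B :: "real^'n^'m"
  by (simp add: matrix_matrix_mult_def vec_eq_iff distrib_right sum.distrib)

lemma bounded_linear_matrix_vector_left: "bounded_linear (\<lambda>A::real^'n^'m. A *v x)"
  by (intro linear_conv_bounded_linear[THEN iffD1] linearI)
    (simp_all add: matrix_vector_mult_add_rdistrib matrix_vector_mult_scaleR_left)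

lemma bounded_linear_matrix_mult_right: "bounded_linear (\<lambda>A::real^'n^'m. A ** (B :: real^'k^'n))"
  by (intro linear_conv_bounded_linear[THEN iffD1] linearI)
    (simp_all add: matrix_add_rdistrib matrix_mult_scaleR)

lemma bounded_linear_matrix_mult_left: "bounded_linear (\<lambda>A::real^'n^'m. (B :: real^'m^'k) ** A)"
  by (intro linear_conv_bounded_linear[THEN iffD1] linearI)
    (simp_all add: matrix_add_ldistrib matrix_mult_scaleR)

lemma inner_matrix_vector: "x \<bullet> (A *v y) = (transpose A *v x) \<bullet> y" for A :: "real^'n^'m"
  by (simp add: dot_lmul_matrix flip: vector_transpose_matrix)

lemma inner_vector_matrix: "(A *v y) \<bullet> x = y \<bullet> (transpose A *v x)" for A :: "real^'n^'m"
  by (metis inner_commute inner_matrix_vector)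

text \<open>Together with \<open>onorm_le_norm_matrix\<close> this is the equivalence of the
  Euclidean and the operator norm; it makes \<open>mat_of\<close> and \<open>of_mat\<close> bounded,
  whatever the constants.\<close>

lemma norm_matrix_le_onorm: "norm A \<le> real (CARD('n) * CARD('n)) * onorm ((*v) A)"
  for A :: "real^'n^'n"
proof -
  have "norm A \<le> (\<Sum>i\<in>UNIV. norm (A $ i))" by (simp add: norm_vec_def L2_set_le_sum)
  also have "\<dots> \<le> (\<Sum>i\<in>(UNIV :: 'n set). \<Sum>j\<in>(UNIV :: 'n set). onorm ((*v) A))"
    by (intro sum_mono order_trans[OF norm_le_l1_cart] matrix_component_le_onorm)
  finally show ?thesis by simp
qed

lemma onorm_le_norm_matrix: "onorm ((*v) A) \<le> real (CARD('n) * CARD('n)) * norm A"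
  for A :: "real^'n^'n"
proof -
  have "onorm ((*v) A) \<le> (\<Sum>i\<in>UNIV. \<Sum>j\<in>UNIV. \<bar>A $ i $ j\<bar>)"
    by (rule onorm_le_matrix_component_sum)
  also have "\<dots> \<le> (\<Sum>i\<in>(UNIV :: 'n set). \<Sum>j\<in>(UNIV :: 'n set). norm A)"
    by (intro sum_mono) (metis Finite_Cartesian_Product.norm_nth_le order_trans real_norm_def)
  finally show ?thesis by simp
qed

section \<open>The Banach algebra of square matrices and the matrix exponential\<close>

typedef 'n sqmat = "UNIV :: (real^'n::finite^'n) set" morphisms mat_of of_mat ..

setup_lifting type_definition_sqmat

instantiation sqmat :: (finite) real_algebra_1
begin
lift_definition zero_sqmat :: "'a sqmat" is 0 .
lift_definition one_sqmat :: "'a sqmat" is "mat 1" .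
lift_definition plus_sqmat :: "'a sqmat \<Rightarrow> 'a sqmat \<Rightarrow> 'a sqmat" is "(+)" .
lift_definition minus_sqmat :: "'a sqmat \<Rightarrow> 'a sqmat \<Rightarrow> 'a sqmat" is "(-)" .
lift_definition uminus_sqmat :: "'a sqmat \<Rightarrow> 'a sqmat" is "uminus" .
lift_definition times_sqmat :: "'a sqmat \<Rightarrow> 'a sqmat \<Rightarrow> 'a sqmat" is "(**)" .
lift_definition scaleR_sqmat :: "real \<Rightarrow> 'a sqmat \<Rightarrow> 'a sqmat" is "(*\<^sub>R)" .
instance
proof
  show "(0 :: 'a sqmat) \<noteq> 1"
    by transfer (auto simp: vec_eq_iff mat_def)
qed (transfer; simp add: algebra_simps matrix_mul_assoc matrix_add_rdistrib matrix_add_ldistrib matrix_mult_scaleR)+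
end

text \<open>The operator norm gives the identity norm 1, as this class demands; its Euclidean norm
  is the square root of the dimension. With completeness, the general theory of \<open>exp\<close>
  becomes available for \<open>mexp\<close>.\<close>

instantiation sqmat :: (finite) real_normed_algebra_1
begin
lift_definition norm_sqmat :: "'a sqmat \<Rightarrow> real" is "\<lambda>A. onorm ((*v) A)" .
definition sgn_sqmat :: "'a sqmat \<Rightarrow> 'a sqmat" where "sgn_sqmat f = f /\<^sub>R norm f"
definition dist_sqmat :: "'a sqmat \<Rightarrow> 'a sqmat \<Rightarrow> real" where "dist_sqmat f g = norm (f - g)"
definition uniformity_sqmat :: "('a sqmat \<times> 'a sqmat) filter" where
  "uniformity_sqmat = (INF e\<in>{0<..}. principal {(x, y). dist x y < e})"
definition open_sqmat :: "'a sqmat set \<Rightarrow> bool" where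
  "open_sqmat U \<longleftrightarrow> (\<forall>x\<in>U. \<forall>\<^sub>F (x', y) in uniformity. x' = x \<longrightarrow> y \<in> U)"
instance
proof
  fix x y :: "'a sqmat" and c :: real
  show "sgn x = x /\<^sub>R norm x" by (rule sgn_sqmat_def)
  show "dist x y = norm (x - y)" by (rule dist_sqmat_def)
  show "(uniformity :: ('a sqmat \<times> 'a sqmat) filter) = (INF e\<in>{0<..}. principal {(x, y). dist x y < e})"
    by (rule uniformity_sqmat_def)
  show "open U \<longleftrightarrow> (\<forall>x\<in>U. \<forall>\<^sub>F (x', y) in uniformity. x' = x \<longrightarrow> y \<in> U)" for U :: "'a sqmat set"
    by (rule open_sqmat_def)
  show "norm x = 0 \<longleftrightarrow> x = 0"
    by transfer (auto simp: onorm_eq_0 matrix_vector_mul_bounded_linear matrix_eq[of _ 0, simplified])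
  show "norm (x + y) \<le> norm x + norm y"
    using onorm_triangle[of "(*v) A" "(*v) B" for A B :: "real^'a^'a"]
    by transfer (simp add: matrix_vector_mult_add_rdistrib[abs_def] matrix_vector_mul_bounded_linear)
  show "norm (c *\<^sub>R x) = \<bar>c\<bar> * norm x"
    using onorm_scaleR[of "(*v) A" c for A :: "real^'a^'a"]
    by transfer (simp add: matrix_vector_mult_scaleR_left[abs_def] matrix_vector_mul_bounded_linear)
  show "norm (x * y) \<le> norm x * norm y"
    using onorm_compose[of "(*v) A" "(*v) B" for A B :: "real^'a^'a"]
    by transfer (simp add: o_def matrix_vector_mul_assoc matrix_vector_mul_bounded_linear)
  show "norm (1 :: 'a sqmat) = 1"
    by transfer (simp add: onorm_id[unfolded id_def] matrix_vector_mul_lid[abs_def])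
qed
end

lemma norm_mat_of_le: "norm (mat_of A) \<le> norm A * real (CARD('n) * CARD('n))"
  for A :: "'n::finite sqmat"
  using norm_matrix_le_onorm[of "mat_of A"] by (simp add: norm_sqmat.rep_eq mult_ac)

lemma norm_of_mat_le: "norm (of_mat A) \<le> norm A * real (CARD('n) * CARD('n))"
  for A :: "real^'n::finite^'n"
  using onorm_le_norm_matrix[of A] by (simp add: norm_sqmat.rep_eq of_mat_inverse mult_ac)

lemma bounded_linear_mat_of: "bounded_linear mat_of"
  by (rule bounded_linear_intro[OF _ _ norm_mat_of_le]) (auto simp: plus_sqmat.rep_eq scaleR_sqmat.rep_eq)

lemma bounded_linear_of_mat: "bounded_linear (of_mat :: real^'n::finite^'n \<Rightarrow> _)"
  by (rule bounded_linear_intro[OF _ _ norm_of_mat_le]) (auto simp: plus_sqmat.abs_eq scaleR_sqmat.abs_eq)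

instance sqmat :: (finite) banach
proof
  fix X :: "nat \<Rightarrow> 'a sqmat" assume "Cauchy X"
  then have "Cauchy (\<lambda>k. mat_of (X k))"
    by (rule bounded_linear.Cauchy[OF bounded_linear_mat_of])
  then obtain L where "(\<lambda>k. mat_of (X k)) \<longlonglongrightarrow> L"
    by (auto simp: Cauchy_convergent_iff convergent_def)
  from bounded_linear.tendsto[OF bounded_linear_of_mat this]
  show "convergent X" by (auto simp: mat_of_inverse convergent_def)
qed

lemma norm_mat_of_mult_vec_le: "norm (mat_of A *v x) \<le> norm A * norm x"
  by transfer (rule onorm[OF matrix_vector_mul_bounded_linear])

lemma mat_of_power: "mat_of (A ^ k) = ((\<lambda>m. mat_of A ** m) ^^ k) (mat 1)"
  by (induction k) (simp_all add: one_sqmat.rep_eq times_sqmat.rep_eq)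

lemma mat_of_power_vec: "mat_of (A ^ k) *v x = ((\<lambda>y. mat_of A *v y) ^^ k) x"
  by (induction k) (simp_all add: one_sqmat.rep_eq times_sqmat.rep_eq flip: matrix_vector_mul_assoc)

text \<open>The bounded linear map \<open>mat_of\<close> may be applied to the exponential series of
  the Banach algebra term by term, which yields the series defining \<open>mexp\<close>.\<close>

lemma mexp_sums: "(\<lambda>k. (1 / fact k) *\<^sub>R ((\<lambda>m. a ** m) ^^ k) (mat 1)) sums mexp a"
  and mexp_eq_exp: "mexp a = mat_of (exp (of_mat a))"
proof -
  have *: "(\<lambda>k. mat_of ((of_mat a) ^ k /\<^sub>R fact k)) sums mat_of (exp (of_mat a))"
    by (rule bounded_linear.sums[OF bounded_linear_mat_of exp_converges])
  have "mat_of ((of_mat a) ^ k /\<^sub>R fact k) = (1 / fact k) *\<^sub>R ((\<lambda>m. a ** m) ^^ k) (mat 1)" for k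
    by (simp add: scaleR_sqmat.rep_eq mat_of_power of_mat_inverse inverse_eq_divide)
  with * have s: "(\<lambda>k. (1 / fact k) *\<^sub>R ((\<lambda>m. a ** m) ^^ k) (mat 1)) sums mat_of (exp (of_mat a))"
    by simp
  then show "mexp a = mat_of (exp (of_mat a))"
    unfolding mexp_def by (rule sums_unique[symmetric])
  with s show "(\<lambda>k. (1 / fact k) *\<^sub>R ((\<lambda>m. a ** m) ^^ k) (mat 1)) sums mexp a" by simp
qed

lemma mexp_zero: "mexp 0 = mat 1"
  by (simp add: mexp_eq_exp one_sqmat.rep_eq flip: zero_sqmat.abs_eq)

lemma of_mat_scaleR: "of_mat (c *\<^sub>R a) = c *\<^sub>R of_mat a"
  by (simp add: scaleR_sqmat.abs_eq)

lemma mexp_add: "mexp ((s + t) *\<^sub>R a) = mexp (s *\<^sub>R a) ** mexp (t *\<^sub>R a)"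
proof -
  have "exp ((s + t) *\<^sub>R of_mat a) = exp (s *\<^sub>R of_mat a) * exp (t *\<^sub>R of_mat a)"
    by (subst exp_add_commuting[symmetric]) (simp_all add: scaleR_add_left)
  then show ?thesis
    by (simp add: mexp_eq_exp of_mat_scaleR times_sqmat.rep_eq)
qed

lemma transpose_mexp: "transpose (mexp a) = mexp (transpose a)"
proof -
  have "transpose (((\<lambda>m. a ** m) ^^ k) (mat 1)) = ((\<lambda>m. transpose a ** m) ^^ k) (mat 1)" for k
  proof -
    \<comment> \<open>Transposition reverses products. With the last factor split off on the right,
      it reproduces the recursion for the powers of \<open>transpose a\<close>.\<close>
    have "((\<lambda>m. a ** m) ^^ k) (mat 1) ** a = ((\<lambda>m. a ** m) ^^ Suc k) (mat 1)" for k
      by (induction k) (simp_all flip: matrix_mul_assoc)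
    then have "((\<lambda>m. a ** m) ^^ Suc k) (mat 1) = ((\<lambda>m. a ** m) ^^ k) (mat 1) ** a" for k by simp
    then show ?thesis
      by (induction k) (simp_all add: transpose_mat matrix_transpose_mul del: funpow.simps(2), simp)
  qed
  then show ?thesis
    using bounded_linear.sums[OF bounded_linear_transpose mexp_sums[of a]]
      mexp_sums[of "transpose a"] by (simp add: transpose_scalar sums_unique2)
qed

lemma continuous_on_mexp: "continuous_on S (\<lambda>t. mexp (t *\<^sub>R a))"
  unfolding mexp_eq_exp of_mat_scaleR
  by (intro bounded_linear.continuous_on[OF bounded_linear_mat_of])
    (rule continuous_on_vector_derivative, rule exp_scaleR_has_vector_derivative_right)

lemma norm_mexp_mult_vec_le: "norm (mexp (t *\<^sub>R a) *v x) \<le> exp (\<bar>t\<bar> * norm (of_mat a)) * norm x"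
  unfolding mexp_eq_exp of_mat_scaleR
  by (rule order_trans[OF norm_mat_of_mult_vec_le mult_right_mono])
    (use norm_exp[of "t *\<^sub>R of_mat a"] in simp_all)

text \<open>Since \<open>fact (k + N)\<close> is at least \<open>fact k\<close>, the tail is
  dominated by \<open>norm x ^ N\<close> times the full exponential series of
  \<open>norm x\<close>.\<close>

lemma exp_Taylor_bound:
  fixes x :: "'a::{real_normed_algebra_1, banach}"
  shows "norm (exp x - (\<Sum>i<N. x ^ i /\<^sub>R fact i)) \<le> norm x ^ N * exp (norm x)"
proof -
  have sm: "summable (\<lambda>k. norm x ^ N * (norm x ^ k /\<^sub>R fact k))"
    by (intro summable_mult summable_exp_generic)
  have le: "norm (x ^ (k + N) /\<^sub>R fact (k + N)) \<le> norm x ^ N * (norm x ^ k /\<^sub>R fact k)" for k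
  proof -
    have "norm (x ^ (k + N)) / fact (k + N) \<le> norm x ^ (k + N) / fact k"
      by (intro frac_le norm_power_ineq fact_mono) auto
    then show ?thesis by (simp add: power_add field_simps)
  qed
  have "exp x - (\<Sum>i<N. x ^ i /\<^sub>R fact i) = (\<Sum>k. x ^ (k + N) /\<^sub>R fact (k + N))"
    unfolding exp_def using suminf_split_initial_segment[OF summable_exp_generic[of x], of N] by simp
  also have "norm \<dots> \<le> (\<Sum>k. norm x ^ N * (norm x ^ k /\<^sub>R fact k))"
    by (rule norm_suminf_le[OF le sm]) 
  also have "\<dots> = norm x ^ N * exp (norm x)"
    unfolding exp_def by (rule suminf_mult[OF summable_exp_generic])
  finally show ?thesis .
qed

text \<open>\<open>exp_Taylor_bound\<close> applied to a vector. The sum includes the index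
  \<open>r\<close>, so the remainder has order \<open>Suc r\<close>.\<close>

lemma mexp_Taylor_bound:
  "norm (mexp (s *\<^sub>R a) *v x - (\<Sum>i\<le>r. (s ^ i / fact i) *\<^sub>R ((\<lambda>y. a *v y) ^^ i) x))
    \<le> (\<bar>s\<bar> * norm (of_mat a)) ^ Suc r * exp (\<bar>s\<bar> * norm (of_mat a)) * norm x"
proof -
  let ?A = "s *\<^sub>R of_mat a" and ?L = "\<lambda>A. mat_of A *v x"
  have lin: "bounded_linear ?L"
    by (rule bounded_linear_compose[OF bounded_linear_matrix_vector_left bounded_linear_mat_of])
  have "?L (?A ^ i /\<^sub>R fact i) = (s ^ i / fact i) *\<^sub>R ((\<lambda>y. a *v y) ^^ i) x" for i
    by (simp add: linear_cmul[OF bounded_linear.linear[OF lin]] mat_of_power_vec of_mat_inverse divide_inverse)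
  then have "mexp (s *\<^sub>R a) *v x - (\<Sum>i\<le>r. (s ^ i / fact i) *\<^sub>R ((\<lambda>y. a *v y) ^^ i) x)
     = ?L (exp ?A - (\<Sum>i<Suc r. ?A ^ i /\<^sub>R fact i))"
    by (simp add: mexp_eq_exp of_mat_scaleR linear_diff[OF bounded_linear.linear[OF lin]]
      linear_sum[OF bounded_linear.linear[OF lin]] lessThan_Suc_atMost del: scaleR_power sum.lessThan_Suc)
  also have "norm \<dots> \<le> (norm ?A ^ Suc r * exp (norm ?A)) * norm x"
    by (rule order_trans[OF norm_mat_of_mult_vec_le mult_right_mono[OF exp_Taylor_bound]]) simp
  finally show ?thesis by simp
qed

section \<open>Square roots of positive definite matrices\<close>

definition pos_def :: "real^'n^'n \<Rightarrow> bool" where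
  "pos_def Q \<longleftrightarrow> transpose Q = Q \<and> (\<exists>c>0. \<forall>x. c * (norm x)\<^sup>2 \<le> x \<bullet> (Q *v x))"

text \<open>If \<open>Q = C (1 - B)\<close> with \<open>\<parallel>B\<parallel> < 1\<close>, then \<open>Y \<mapsto> (B + Y\<^sup>2) / 2\<close> is a contraction, and its fixed
  point \<open>Y\<close> satisfies \<open>(1 - Y)\<^sup>2 = 1 - B\<close>.\<close>

lemma sqrt_fixpoint:
  fixes B :: "'n::finite sqmat"
  assumes B: "norm B < 1" "transpose (mat_of B) = mat_of B"
  obtains Y where "(1 / 2) *\<^sub>R (B + Y * Y) = Y" "norm Y \<le> norm B" "transpose (mat_of Y) = mat_of Y"
proof -
  let ?S = "{Y :: 'n sqmat. norm Y \<le> norm B \<and> transpose (mat_of Y) = mat_of Y}"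
  let ?f = "\<lambda>Y. (1 / 2) *\<^sub>R (B + Y * Y)"
  have "\<exists>!Y\<in>?S. ?f Y = Y"
  proof (rule Banach_fix[where c="norm B"])
    have "closed ?S"
      by (intro closed_Collect_conj closed_Collect_le closed_Collect_eq continuous_intros
          bounded_linear.continuous_on[OF bounded_linear_mat_of]
          bounded_linear.continuous_on[OF bounded_linear_transpose])
    then show "uniform_space_class.complete ?S" by (simp add: complete_eq_closed)
    show "?S \<noteq> {}" using B by auto
    show "?f ` ?S \<subseteq> ?S"
    proof clarify
      fix Y :: "'n sqmat" assume Y: "norm Y \<le> norm B" "transpose (mat_of Y) = mat_of Y"
      have "norm (Y * Y) \<le> norm B * norm B"
        by (rule order_trans[OF norm_mult_ineq mult_mono]) (use Y in auto)
      also have "\<dots> \<le> norm B" using B by (simp add: mult_left_le)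
      finally have "norm (?f Y) \<le> norm B"
        using norm_triangle_ineq[of B "Y * Y"] by simp
      moreover have "transpose (mat_of (?f Y)) = mat_of (?f Y)"
        using Y B by (simp add: scaleR_sqmat.rep_eq plus_sqmat.rep_eq times_sqmat.rep_eq transpose_add
            transpose_scalar matrix_transpose_mul)
      ultimately show "norm (?f Y) \<le> norm B \<and> transpose (mat_of (?f Y)) = mat_of (?f Y)" ..
    qed
    fix Y Z assume Y: "Y \<in> ?S" and Z: "Z \<in> ?S"
    \<comment> \<open>The noncommutative difference of squares; together with the factor 1/2 and the
      bound on both norms it gives the contraction constant \<open>norm B\<close>.\<close>
    have "?f Y - ?f Z = (1 / 2) *\<^sub>R (Y * (Y - Z) + (Y - Z) * Z)"
      by (simp add: algebra_simps)
    then have "norm (?f Y - ?f Z) \<le> (1 / 2) * (norm Y * norm (Y - Z) + norm (Y - Z) * norm Z)"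
      using norm_triangle_ineq[of "Y * (Y - Z)" "(Y - Z) * Z"] norm_mult_ineq[of Y "Y - Z"]
        norm_mult_ineq[of "Y - Z" Z] by simp
    also have "\<dots> \<le> (1 / 2) * (norm B * norm (Y - Z) + norm (Y - Z) * norm B)"
      using Y Z by (intro mult_left_mono add_mono mult_right_mono) auto
    finally show "dist (?f Y) (?f Z) \<le> norm B * dist Y Z"
      by (simp add: dist_norm)
  qed (use B in auto)
  then show ?thesis using that by blast
qed

text \<open>A suitable multiple of \<open>Q\<close> lies within distance less than 1 of the
  identity, so \<open>sqrt_fixpoint\<close> provides its root \<open>1 - Y\<close>. This is positive
  semidefinite because \<open>norm Y < 1\<close>, and it is scaled back by
  \<open>sqrt C\<close>.\<close>

lemma pos_def_sqrt_exists:
  fixes Q :: "real^'n^'n"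
  assumes "pos_def Q"
  obtains S where "transpose S = S" "\<And>x. 0 \<le> x \<bullet> (S *v x)" "S ** S = Q"
proof -
  obtain c where sym: "transpose Q = Q" and c: "c > 0" "\<And>x. c * (norm x)\<^sup>2 \<le> x \<bullet> (Q *v x)"
    using assms by (auto simp: pos_def_def)
  define q where "q = onorm ((*v) Q)"
  have q: "norm (Q *v x) \<le> q * norm x" for x
    unfolding q_def by (rule onorm) simp
  obtain e :: "real^'n" where e: "norm e = 1" by (rule vector_choose_size[of 1]) auto
  have "c * (norm e)\<^sup>2 \<le> e \<bullet> (Q *v e)" by (rule c)
  also have "\<dots> \<le> norm e * norm (Q *v e)" by (rule norm_cauchy_schwarz)
  finally have cq: "c \<le> q" using q[of e] e by simp
  then have q0: "q > 0" using c by simp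
  \<comment> \<open>This choice minimises the bound
    \<open>1 - 2 * c / C + q\<^sup>2 / C\<^sup>2\<close> for the squared norm of \<open>B\<close>;
    the minimum is \<open>1 - c\<^sup>2 / q\<^sup>2\<close>.\<close>
  define C where "C = q\<^sup>2 / c"
  have C: "C > 0" using q0 c by (simp add: C_def)
  define B where "B = of_mat (mat 1 - (1 / C) *\<^sub>R Q)"
  have Bv: "mat_of B *v x = x - (1 / C) *\<^sub>R (Q *v x)" for x
    by (simp add: B_def of_mat_inverse matrix_vector_mult_diff_rdistrib matrix_vector_mult_scaleR_left)
  define b where "b = sqrt (1 - c\<^sup>2 / q\<^sup>2)"
  have cq2: "c\<^sup>2 / q\<^sup>2 \<le> 1" using cq c q0 by (simp add: power_mono)
  have "norm (mat_of B *v x) \<le> b * norm x" for x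
  proof -
    have "(norm (mat_of B *v x))\<^sup>2 = (norm x)\<^sup>2 - (2 / C) * (x \<bullet> (Q *v x)) + (1 / C\<^sup>2) * (norm (Q *v x))\<^sup>2"
      unfolding Bv power2_norm_eq_inner
      by (simp add: inner_diff inner_commute power2_eq_square algebra_simps)
    also have "\<dots> \<le> (norm x)\<^sup>2 - (2 / C) * (c * (norm x)\<^sup>2) + (1 / C\<^sup>2) * (q * norm x)\<^sup>2"
      using c(2)[of x] q[of x] C
      by (intro add_mono diff_mono mult_left_mono power_mono order_refl) auto
    also have "\<dots> = (1 - c\<^sup>2 / q\<^sup>2) * (norm x)\<^sup>2"
      using q0 c by (simp add: C_def field_simps power2_eq_square)
    also have "\<dots> = (b * norm x)\<^sup>2"
      using cq2 by (simp add: b_def power_mult_distrib)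
    finally show ?thesis
      by (rule power2_le_imp_le) (simp add: b_def cq2)
  qed
  then have "norm B \<le> b"
    by (simp add: norm_sqmat.rep_eq onorm_bound b_def cq2)
  moreover have "b < 1" using c q0 by (simp add: b_def)
  ultimately have nB: "norm B < 1" by simp
  have "transpose (mat_of B) = mat_of B"
    using sym by (simp add: B_def of_mat_inverse transpose_diff transpose_scalar transpose_mat)
  from sqrt_fixpoint[OF nB this]
  obtain Y where Y: "(1 / 2) *\<^sub>R (B + Y * Y) = Y" "norm Y \<le> norm B" "transpose (mat_of Y) = mat_of Y" .
  define X where "X = 1 - Y"
  have "X * X = 1 - B"
  proof -
    have "B + Y * Y = 2 *\<^sub>R Y" using arg_cong[OF Y(1), of "\<lambda>Z. 2 *\<^sub>R Z"] by simp
    then show ?thesis by (simp add: X_def algebra_simps scaleR_2)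
  qed
  then have XX: "mat_of X ** mat_of X = (1 / C) *\<^sub>R Q"
    by (simp add: times_sqmat.rep_eq[symmetric] minus_sqmat.rep_eq one_sqmat.rep_eq B_def of_mat_inverse)
  have symX: "transpose (mat_of X) = mat_of X"
    using Y(3) by (simp add: X_def minus_sqmat.rep_eq one_sqmat.rep_eq transpose_diff transpose_mat)
  have posX: "0 \<le> x \<bullet> (mat_of X *v x)" for x
  proof -
    have "x \<bullet> (mat_of Y *v x) \<le> norm x * (norm Y * norm x)"
      by (rule order_trans[OF norm_cauchy_schwarz mult_left_mono[OF norm_mat_of_mult_vec_le]]) simp
    also have "\<dots> \<le> norm x * (1 * norm x)"
      using Y(2) nB by (intro mult_left_mono mult_right_mono) auto
    finally show ?thesis
      by (simp add: X_def minus_sqmat.rep_eq one_sqmat.rep_eq matrix_vector_mult_diff_rdistrib inner_diff_right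
          dot_square_norm power2_eq_square)
  qed
  show ?thesis
  proof (rule that[of "sqrt C *\<^sub>R mat_of X"])
    show "(sqrt C *\<^sub>R mat_of X) ** (sqrt C *\<^sub>R mat_of X) = Q"
      using C XX by (simp add: matrix_mult_scaleR)
  qed (use C symX posX in \<open>auto simp: transpose_scalar matrix_vector_mult_scaleR_left\<close>)
qed

text \<open>Along the line \<open>w + s *\<^sub>R (S *v w)\<close> the form is a quadratic
  polynomial in \<open>s\<close> without constant term. If \<open>S *v w\<close> were nonzero, its
  linear term would make it negative for small negative \<open>s\<close>.\<close>

lemma psd_form_zero:
  fixes S :: "real^'n^'n"
  assumes sym: "transpose S = S" and pos: "\<And>x. 0 \<le> x \<bullet> (S *v x)" and z: "w \<bullet> (S *v w) = 0"
  shows "S *v w = 0"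
proof (rule ccontr)
  assume nz: "S *v w \<noteq> 0"
  define v where "v = S *v w"
  define a where "a = v \<bullet> (S *v v)"
  have v: "v \<bullet> v > 0" using nz by (simp add: v_def)
  have "0 \<le> a" unfolding a_def by (rule pos)
  have wv: "w \<bullet> (S *v v) = v \<bullet> v"
    using inner_matrix_vector[of w S v] sym by (simp add: v_def)
  have *: "0 \<le> 2 * s * (v \<bullet> v) + s\<^sup>2 * a" for s
  proof -
    have "0 \<le> (w + s *\<^sub>R v) \<bullet> (S *v (w + s *\<^sub>R v))" by (rule pos)
    also have "\<dots> = 2 * s * (v \<bullet> v) + s\<^sup>2 * a"
      using z wv by (simp add: matrix_vector_right_distrib matrix_vector_mult_scaleR inner_add a_def
          power2_eq_square algebra_simps flip: v_def)
    finally show ?thesis .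
  qed
  \<comment> \<open>Small enough that \<open>s * a\<close> stays above
    \<open>- (v \<bullet> v)\<close>; the summand 1 keeps the denominator positive when
    \<open>a = 0\<close>.\<close>
  define s where "s = - (v \<bullet> v) / (a + 1)"
  have "s < 0" using v \<open>0 \<le> a\<close> by (simp add: s_def divide_neg_pos)
  have "0 \<le> s * (2 * (v \<bullet> v) + s * a)" using *[of s] by (simp add: power2_eq_square algebra_simps)
  then have "2 * (v \<bullet> v) + s * a \<le> 0" using \<open>s < 0\<close> by (simp add: zero_le_mult_iff)
  moreover have "s * a \<ge> - (v \<bullet> v)"
    using v \<open>0 \<le> a\<close> by (simp add: s_def field_simps)
  ultimately show False using v by simp
qed

text \<open>For \<open>D = S - T\<close> the assumption gives \<open>S ** D + D ** T = 0\<close>.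
  Multiplying by \<open>D\<close> and taking traces leaves a sum of the forms of \<open>S\<close>
  and \<open>T\<close> at the columns of \<open>D\<close>, so each of them vanishes. By
  \<open>psd_form_zero\<close> both matrices kill these columns, hence \<open>D ** D = 0\<close>,
  and the symmetric matrix \<open>D\<close> is zero.\<close>

lemma psd_sqrt_unique:
  fixes S T :: "real^'n^'n"
  assumes S: "transpose S = S" "\<And>x. 0 \<le> x \<bullet> (S *v x)" and T: "transpose T = T" "\<And>x. 0 \<le> x \<bullet> (T *v x)"
    and eq: "S ** S = T ** T"
  shows "S = T"
proof -
  define D where "D = S - T"
  have symD: "transpose D = D"
    using S T by (simp add: D_def transpose_diff)
  have "S ** D + D ** T = 0"
    using eq by (simp add: D_def matrix_diff_ldistrib matrix_diff_rdistrib)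
  then have "trace (D ** (S ** D + D ** T)) = 0"
    by (simp add: trace_def)
  then have "trace (D ** (S ** D)) + trace (D ** (D ** T)) = 0"
    by (simp only: matrix_add_ldistrib trace_add)
  also have "trace (D ** (D ** T)) = trace (D ** (T ** D))"
    unfolding trace_mul_sym[of D "D ** T"] by (simp add: matrix_mul_assoc)
  finally have tr: "trace (D ** (S ** D)) + trace (D ** (T ** D)) = 0" .
  have entry: "(D ** (R ** D)) $ i $ i = (D *v axis i 1) \<bullet> (R *v (D *v axis i 1))" for R i
  proof -
    have "(D *v axis i 1) \<bullet> (R *v (D *v axis i 1)) = axis i 1 \<bullet> ((D ** (R ** D)) *v axis i 1)"
      by (simp add: inner_vector_matrix[of D] symD matrix_vector_mul_assoc)
    then show ?thesis
      by (simp add: matrix_vector_mult_basis column_def inner_axis')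
  qed
  have "(\<Sum>i\<in>UNIV. (D *v axis i 1) \<bullet> (S *v (D *v axis i 1)) + (D *v axis i 1) \<bullet> (T *v (D *v axis i 1))) = 0"
    using tr by (simp add: trace_def entry sum.distrib)
  then have zero: "(D *v axis i 1) \<bullet> (S *v (D *v axis i 1)) + (D *v axis i 1) \<bullet> (T *v (D *v axis i 1)) = 0" for i
    using S(2) T(2) by (subst (asm) sum_nonneg_eq_0_iff) (auto intro: add_nonneg_nonneg)
  have "D *v axis i 1 = 0" for i
  proof -
    let ?w = "D *v axis i 1"
    have "?w \<bullet> (S *v ?w) = 0" "?w \<bullet> (T *v ?w) = 0"
      using zero[of i] S(2)[of ?w] T(2)[of ?w] by auto
    then have "S *v ?w = 0" "T *v ?w = 0"
      using S T psd_form_zero by blast+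
    then have "D *v ?w = 0" by (simp add: D_def matrix_vector_mult_diff_rdistrib)
    then have "?w \<bullet> ?w = 0" by (simp add: inner_vector_matrix[of D] symD)
    then show ?thesis by simp
  qed
  then have "D = 0"
    by (simp add: vec_eq_iff matrix_vector_mult_basis column_def)
  then show ?thesis by (simp add: D_def)
qed

lemma msqrt_pos_def:
  fixes Q :: "real^'n^'n"
  assumes "pos_def Q"
  shows transpose_msqrt: "transpose (msqrt Q) = msqrt Q"
    and msqrt_square: "msqrt Q ** msqrt Q = Q"
    and invertible_msqrt: "invertible (msqrt Q)"
proof -
  let ?P = "\<lambda>S. transpose S = S \<and> (\<forall>x. 0 \<le> x \<bullet> (S *v x)) \<and> S ** S = Q"
  obtain S where S: "?P S" using pos_def_sqrt_exists[OF assms] by metis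
  have "?P (msqrt Q)"
    unfolding msqrt_def by (rule theI[of ?P, OF S]) (use S psd_sqrt_unique in blast)
  then show "transpose (msqrt Q) = msqrt Q" and sq: "msqrt Q ** msqrt Q = Q" by auto
  have "x = 0" if "msqrt Q *v x = 0" for x
  proof -
    obtain c where "c > 0" "c * (norm x)\<^sup>2 \<le> x \<bullet> (Q *v x)" using assms by (auto simp: pos_def_def)
    moreover have "Q *v x = 0" by (metis sq that matrix_vector_mul_assoc matrix_vector_mult_0_right)
    ultimately show ?thesis by (simp add: mult_le_0_iff)
  qed
  then show "invertible (msqrt Q)"
    by (simp add: invertible_left_inverse matrix_left_invertible_ker)
qed

section \<open>The covariance of the finite-dimensional part\<close>

declare transpose_matrix_vector [simp del]

section \<open>Coefficients of a polynomial are controlled by its mean square\<close>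

lemma norm_add_sq_le: "(norm (x + y))\<^sup>2 \<le> 2 * (norm x)\<^sup>2 + 2 * (norm y)\<^sup>2"
  for x y :: "'a::real_normed_vector"
proof -
  have "(norm (x + y))\<^sup>2 \<le> (norm x + norm y)\<^sup>2"
    by (intro power_mono norm_triangle_ineq) simp
  also have "\<dots> \<le> 2 * (norm x)\<^sup>2 + 2 * (norm y)\<^sup>2"
    using zero_le_power2[of "norm x - norm y"] by (simp add: power2_eq_square algebra_simps)
  finally show ?thesis .
qed

lemma norm_sum_sq_le: "(norm (\<Sum>i<n. f i))\<^sup>2 \<le> real n * (\<Sum>i<n. (norm (f i))\<^sup>2)"
  for f :: "nat \<Rightarrow> 'a::real_normed_vector"
proof -
  have "(norm (\<Sum>i<n. f i))\<^sup>2 \<le> (\<Sum>i<n. norm (f i))\<^sup>2"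
    by (intro power_mono norm_sum) simp
  also have "\<dots> \<le> real n * (\<Sum>i<n. (norm (f i))\<^sup>2)"
    using sum_squared_le_sum_of_squares[of "\<lambda>i. norm (f i)" "{..<n}"] by (simp add: mult.commute)
  finally show ?thesis .
qed

lemma integral_dilate:
  fixes f :: "real \<Rightarrow> real"
  assumes "continuous_on UNIV f" "m > 0"
  shows "integral {0..b / m} (\<lambda>x. f (m * x)) = integral {0..b} f / m"
proof -
  have "(f has_integral integral {0..b} f) (cbox 0 b)"
    using assms(1) by (simp add: integrable_integral integrable_continuous_interval continuous_on_subset[of UNIV])
  from has_integral_affinity'[OF this assms(2), of 0]
  show ?thesis by (simp add: divide_inverse mult.commute integral_unique)
qed

text \<open>The dilation \<open>p(u) - 2\<^sup>n p(u/2)\<close> kills the leading coefficient and is bounded in \<open>L\<^sup>2(0,1)\<close>.\<close>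

lemma polynomial_L2_lower_bound:
  "\<exists>\<kappa>>0. \<forall>c :: nat \<Rightarrow> 'a::euclidean_space.
     \<kappa> * (\<Sum>i\<le>n. (norm (c i))\<^sup>2) \<le> integral {0..1} (\<lambda>u. (norm (\<Sum>i\<le>n. u ^ i *\<^sub>R c i))\<^sup>2)"
proof (induction n)
  case 0
  show ?case by (rule exI[of _ 1]) simp
next
  case (Suc r)
  define n where "n = Suc r"
  obtain \<kappa> where \<kappa>: "\<kappa> > 0" and IH: "\<And>c :: nat \<Rightarrow> 'a. \<kappa> * (\<Sum>i\<le>r. (norm (c i))\<^sup>2)
      \<le> integral {0..1} (\<lambda>u. (norm (\<Sum>i\<le>r. u ^ i *\<^sub>R c i))\<^sup>2)"
    using Suc by blast
  \<comment> \<open>\<open>A\<close> is the sum \<open>2 + 2 * 4 ^ n * 2\<close> from the dilation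
    estimate. \<open>E\<close> will bound the leading coefficient; its factor
    \<open>2 * n + 1\<close> is the inverse of the integral of \<open>u ^ (2 * n)\<close>.
    \<open>F\<close> collects the bounds for the lower and the leading coefficients.\<close>
  define A where "A = 2 + (4::real) ^ (n + 1)"
  define E where "E = real (2 * n + 1) * (2 + 2 * real n * (A / \<kappa>))"
  define F where "F = A / \<kappa> + E"
  have A: "A > 0" by (simp add: A_def add_pos_pos)
  have F: "F > 0" using A \<kappa> by (simp add: F_def E_def add_pos_nonneg)
  have main: "(\<Sum>i\<le>n. (norm (c i))\<^sup>2) \<le> F * integral {0..1} (\<lambda>u. (norm (\<Sum>i\<le>n. u ^ i *\<^sub>R c i))\<^sup>2)"
    for c :: "nat \<Rightarrow> 'a"
  proof -
    define p where "p u = (\<Sum>i\<le>n. u ^ i *\<^sub>R c i)" for u :: real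
    define q where "q u = (\<Sum>i\<le>r. u ^ i *\<^sub>R ((1 - 2 ^ (n - i)) *\<^sub>R c i))" for u :: real
    define I where "I = integral {0..1} (\<lambda>u. (norm (p u))\<^sup>2)"
    have cp: "continuous_on S p" and cq: "continuous_on S q" for S
      unfolding p_def q_def by (intro continuous_intros)+
    have cph: "continuous_on S (\<lambda>u. p (u / 2))" for S
      by (intro continuous_on_compose2[OF cp[of UNIV]] continuous_intros) auto
    note int = integrable_continuous_interval[OF continuous_on_power[OF continuous_on_norm]]
    have q_eq: "q u = p u - (2 ^ n) *\<^sub>R p (u / 2)" for u
    proof -
      have "p u - (2 ^ n) *\<^sub>R p (u / 2) = (\<Sum>i\<le>n. u ^ i *\<^sub>R ((1 - 2 ^ n / 2 ^ i) *\<^sub>R c i))"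
        by (simp add: p_def scaleR_sum_right power_divide algebra_simps flip: sum_subtractf)
      also have "\<dots> = (\<Sum>i\<le>r. u ^ i *\<^sub>R ((1 - 2 ^ n / 2 ^ i) *\<^sub>R c i))"
        by (simp add: n_def)
      also have "\<dots> = q u"
        unfolding q_def by (intro sum.cong) (auto simp: n_def power_diff)
      finally show ?thesis ..
    qed
    have "integral {0..1 / (1/2)} (\<lambda>u. (norm (p (1/2 * u)))\<^sup>2) = I / (1/2)"
      unfolding I_def by (rule integral_dilate) (auto intro!: continuous_intros cp)
    then have half: "integral {0..2} (\<lambda>u. (norm (p (u / 2)))\<^sup>2) = 2 * I" by simp
    have "integral {0..1} (\<lambda>u. (norm (p (u / 2)))\<^sup>2) \<le> integral {0..2} (\<lambda>u. (norm (p (u / 2)))\<^sup>2)"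
      by (rule integral_subset_le) (auto intro!: int cph)
    with half have half': "integral {0..1} (\<lambda>u. (norm (p (u / 2)))\<^sup>2) \<le> 2 * I" by simp
    have "integral {0..1} (\<lambda>u. (norm (q u))\<^sup>2)
       \<le> integral {0..1} (\<lambda>u. 2 * (norm (p u))\<^sup>2 + 2 * 4 ^ n * (norm (p (u / 2)))\<^sup>2)"
    proof (rule integral_le)
      fix u :: real
      have "(norm (q u))\<^sup>2 \<le> 2 * (norm (p u))\<^sup>2 + 2 * (norm (- (2 ^ n *\<^sub>R p (u / 2))))\<^sup>2"
        unfolding q_eq using norm_add_sq_le[of "p u" "- (2 ^ n *\<^sub>R p (u / 2))"] by simp
      also have "\<dots> = 2 * (norm (p u))\<^sup>2 + 2 * 4 ^ n * (norm (p (u / 2)))\<^sup>2"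
        by (simp add: power_mult_distrib power2_eq_square flip: power_mult_distrib)
      finally show "(norm (q u))\<^sup>2 \<le> 2 * (norm (p u))\<^sup>2 + 2 * 4 ^ n * (norm (p (u / 2)))\<^sup>2" .
    qed (auto intro!: int cq integrable_continuous_interval continuous_intros cp cph)
    also have "\<dots> = 2 * I + 2 * 4 ^ n * integral {0..1} (\<lambda>u. (norm (p (u / 2)))\<^sup>2)"
      unfolding I_def by (subst integral_add) (auto intro!: integrable_continuous_interval continuous_intros cp cph)
    also have "\<dots> \<le> 2 * I + 2 * 4 ^ n * (2 * I)"
      by (intro add_left_mono mult_left_mono half') auto
    also have "\<dots> = A * I" by (simp add: A_def algebra_simps)
    finally have q_le: "integral {0..1} (\<lambda>u. (norm (q u))\<^sup>2) \<le> A * I" .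
    \<comment> \<open>For \<open>i \<le> r\<close> the exponent \<open>n - i\<close> is at least 1,
      so the factor \<open>1 - 2 ^ (n - i)\<close> has modulus at least 1: passing from the
      polynomial to \<open>q\<close> does not shrink the lower coefficients, and the induction
      hypothesis for \<open>q\<close> controls them.\<close>
    have "\<kappa> * (\<Sum>i\<le>r. (norm (c i))\<^sup>2) \<le> \<kappa> * (\<Sum>i\<le>r. (norm ((1 - 2 ^ (n - i)) *\<^sub>R c i))\<^sup>2)"
    proof (intro mult_left_mono sum_mono power_mono)
      fix i assume "i \<in> {..r}"
      then have "n - i = Suc (r - i)" by (simp add: n_def Suc_diff_le)
      then have "(2 :: real) ^ (n - i) \<ge> 2"
        by (simp add: one_le_power)
      then have "\<bar>1 - 2 ^ (n - i)\<bar> \<ge> (1 :: real)" by linarith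
      then show "norm (c i) \<le> norm ((1 - 2 ^ (n - i)) *\<^sub>R c i)"
        using mult_right_mono[of 1 "\<bar>1 - 2 ^ (n - i)\<bar> :: real" "norm (c i)"] by simp
    qed (use \<kappa> in auto)
    also have "\<dots> \<le> A * I"
      using IH[of "\<lambda>i. (1 - 2 ^ (n - i)) *\<^sub>R c i"] q_le unfolding q_def by linarith
    finally have low: "(\<Sum>i\<le>r. (norm (c i))\<^sup>2) \<le> A / \<kappa> * I"
      using \<kappa> by (simp add: field_simps)
    \<comment> \<open>The leading term is the polynomial minus its lower terms, which are already
      controlled.\<close>
    have "(norm (c n))\<^sup>2 / real (2 * n + 1) = integral {0..1} (\<lambda>u. (norm (u ^ n *\<^sub>R c n))\<^sup>2)"
    proof -
      have "((\<lambda>u::real. u ^ (2 * n + 1) / real (2 * n + 1)) has_vector_derivative u ^ (2 * n)) (at u within {0..1})" for u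
        using DERIV_cdivide[OF DERIV_pow[of "2 * n + 1" u], of "real (2 * n + 1)"]
        by (simp add: has_real_derivative_iff_has_vector_derivative[symmetric]
            has_field_derivative_at_within del: of_nat_add of_nat_mult)
      from fundamental_theorem_of_calculus[of 0 1, OF _ this]
      have "((\<lambda>u::real. u ^ (2 * n)) has_integral 1 / real (2 * n + 1)) {0..1}" by simp
      from has_integral_mult_left[OF this, of "(norm (c n))\<^sup>2"]
      have "((\<lambda>u::real. (norm (u ^ n *\<^sub>R c n))\<^sup>2) has_integral (norm (c n))\<^sup>2 / real (2 * n + 1)) {0..1}"
        by (simp add: power_mult_distrib mult.commute[of 2] power_mult)
      then show ?thesis by (simp add: integral_unique)
    qed
    also have "\<dots> \<le> integral {0..1} (\<lambda>u. 2 * (norm (p u))\<^sup>2 + 2 * real n * (\<Sum>i\<le>r. (norm (c i))\<^sup>2))"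
    proof (rule integral_le)
      fix u :: real assume u: "u \<in> {0..1}"
      have "u ^ n *\<^sub>R c n = p u + - (\<Sum>i<n. u ^ i *\<^sub>R c i)"
        by (simp add: p_def n_def lessThan_Suc_atMost)
      then have "(norm (u ^ n *\<^sub>R c n))\<^sup>2 \<le> 2 * (norm (p u))\<^sup>2 + 2 * (norm (\<Sum>i<n. u ^ i *\<^sub>R c i))\<^sup>2"
        using norm_add_sq_le[of "p u" "- (\<Sum>i<n. u ^ i *\<^sub>R c i)"] by simp
      also have "(norm (\<Sum>i<n. u ^ i *\<^sub>R c i))\<^sup>2 \<le> real n * (\<Sum>i<n. (norm (u ^ i *\<^sub>R c i))\<^sup>2)"
        by (rule norm_sum_sq_le)
      also have "\<dots> \<le> real n * (\<Sum>i<n. (norm (c i))\<^sup>2)"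
        using u by (intro mult_left_mono sum_mono power_mono) (auto simp: power_le_one mult_left_le_one_le)
      finally show "(norm (u ^ n *\<^sub>R c n))\<^sup>2 \<le> 2 * (norm (p u))\<^sup>2 + 2 * real n * (\<Sum>i\<le>r. (norm (c i))\<^sup>2)"
        by (simp add: n_def lessThan_Suc_atMost algebra_simps)
    qed (auto intro!: integrable_continuous_interval continuous_intros cp)
    also have "\<dots> = 2 * I + 2 * real n * (\<Sum>i\<le>r. (norm (c i))\<^sup>2)"
      unfolding I_def by (subst integral_add) (auto intro!: integrable_continuous_interval continuous_intros cp)
    also have "\<dots> \<le> 2 * I + 2 * real n * (A / \<kappa> * I)"
      by (intro add_left_mono mult_left_mono low) auto
    finally have "(norm (c n))\<^sup>2 \<le> E * I"
      by (simp add: E_def field_simps)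
    moreover have "(\<Sum>i\<le>n. (norm (c i))\<^sup>2) = (\<Sum>i\<le>r. (norm (c i))\<^sup>2) + (norm (c n))\<^sup>2"
      by (simp add: n_def)
    ultimately show ?thesis
      using low by (simp add: F_def I_def p_def algebra_simps)
  qed
  show ?case
  proof (intro exI[of _ "1 / F"] conjI allI)
    show "1 / F > 0" using F by simp
    show "1 / F * (\<Sum>i\<le>Suc r. (norm (c i))\<^sup>2) \<le> integral {0..1} (\<lambda>u. (norm (\<Sum>i\<le>Suc r. u ^ i *\<^sub>R c i))\<^sup>2)"
      for c :: "nat \<Rightarrow> 'a"
      using main[of c] F unfolding n_def by (simp add: field_simps)
  qed
qed

lemma continuous_on_matrix_mult [continuous_intros]:
  fixes A :: "'a::topological_space \<Rightarrow> real^'n^'m" and B :: "'a \<Rightarrow> real^'k^'n"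
  assumes "continuous_on S A" "continuous_on S B"
  shows "continuous_on S (\<lambda>x. A x ** B x)"
  unfolding matrix_matrix_mult_def
  by (intro continuous_on_vec_lambda continuous_intros assms)

lemma continuous_on_matrix_vector_mult [continuous_intros]:
  fixes A :: "'a::topological_space \<Rightarrow> real^'n^'m" and x :: "'a \<Rightarrow> real^'n"
  assumes "continuous_on S A" "continuous_on S x"
  shows "continuous_on S (\<lambda>s. A s *v x s)"
  unfolding matrix_vector_mult_def
  by (intro continuous_on_vec_lambda continuous_intros assms)

text \<open>The form attains its minimum on the compact unit sphere. A minimum of 0 would put the
  minimiser into the kernel of \<open>Q\<close>, by \<open>psd_form_zero\<close>; homogeneity
  extends the bound to all vectors.\<close>

lemma pos_def_if_invertible:
  fixes Q :: "real^'n^'n"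
  assumes sym: "transpose Q = Q" and pos: "\<And>x. 0 \<le> x \<bullet> (Q *v x)" and inv: "invertible Q"
  shows "pos_def Q"
proof -
  obtain e :: "real^'n" where e: "norm e = 1" by (rule vector_choose_size[of 1]) auto
  have "\<exists>x\<in>sphere 0 1. \<forall>y\<in>sphere 0 1. x \<bullet> (Q *v x) \<le> y \<bullet> (Q *v y)"
    by (rule continuous_attains_inf) (use e in \<open>auto intro!: continuous_intros exI[of _ e]\<close>)
  then obtain x where x: "norm x = 1" "\<And>y. norm y = 1 \<Longrightarrow> x \<bullet> (Q *v x) \<le> y \<bullet> (Q *v y)"
    by auto
  have "x \<bullet> (Q *v x) \<noteq> 0"
  proof
    assume "x \<bullet> (Q *v x) = 0"
    then have "Q *v x = 0" by (rule psd_form_zero[OF sym pos])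
    then have "x = 0" using inv by (metis invertible_def matrix_left_invertible_ker)
    then show False using x by simp
  qed
  then have "0 < x \<bullet> (Q *v x)" using pos[of x] by simp
  moreover have "(x \<bullet> (Q *v x)) * (norm y)\<^sup>2 \<le> y \<bullet> (Q *v y)" for y
  proof (cases "y = 0")
    case False
    then have "x \<bullet> (Q *v x) \<le> (y /\<^sub>R norm y) \<bullet> (Q *v (y /\<^sub>R norm y))" by (intro x) simp
    then show ?thesis
      using False by (simp add: matrix_vector_mult_scaleR field_simps power2_eq_square)
  qed simp
  ultimately show ?thesis using sym by (auto simp: pos_def_def)
qed

section \<open>Quadratic form, increments and continuity of \<open>Qt0\<close>\<close>

context
  fixes a0 :: "real^'n^'n" and \<sigma> :: "real^'q^'n"
begin

lemma continuous_on_Qt0_integrand: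
  "continuous_on S (\<lambda>s. mexp (s *\<^sub>R a0) ** \<sigma> ** transpose \<sigma> ** mexp (s *\<^sub>R transpose a0))"
  by (intro continuous_intros continuous_on_mexp)

lemma Qt0_has_integral:
  "((\<lambda>s. mexp (s *\<^sub>R a0) ** \<sigma> ** transpose \<sigma> ** mexp (s *\<^sub>R transpose a0)) has_integral Qt0 a0 \<sigma> t) {0..t}"
  unfolding Qt0_def
  by (intro integrable_integral integrable_continuous_interval continuous_on_Qt0_integrand)

lemma transpose_mexp_scaleR: "transpose (mexp (s *\<^sub>R a0)) = mexp (s *\<^sub>R transpose a0)"
  by (simp add: transpose_mexp transpose_scalar)

lemma transpose_Qt0: "transpose (Qt0 a0 \<sigma> t) = Qt0 a0 \<sigma> t"
proof -
  have "transpose (mexp (s *\<^sub>R a0) ** \<sigma> ** transpose \<sigma> ** mexp (s *\<^sub>R transpose a0))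
    = mexp (s *\<^sub>R a0) ** \<sigma> ** transpose \<sigma> ** mexp (s *\<^sub>R transpose a0)" for s
    by (simp add: matrix_transpose_mul matrix_mul_assoc flip: transpose_mexp_scaleR)
  then show ?thesis
    using has_integral_linear[OF Qt0_has_integral[of t] bounded_linear_transpose] Qt0_has_integral[of t]
    by (simp add: o_def has_integral_unique)
qed

lemma Qt0_vec_has_integral:
  "((\<lambda>s. mexp (s *\<^sub>R a0) *v (\<sigma> *v (transpose \<sigma> *v (mexp (s *\<^sub>R transpose a0) *v y))))
    has_integral (Qt0 a0 \<sigma> t *v y)) {0..t}"
  using has_integral_linear[OF Qt0_has_integral[of t] bounded_linear_matrix_vector_left[of y]]
  by (simp add: o_def flip: matrix_vector_mul_assoc)

text \<open>Moving \<open>mexp (s *\<^sub>R a0)\<close> and \<open>\<sigma>\<close> across the inner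
  product turns the integrand into a square; nonnegativity, monotonicity in time and the Kalman
  estimate are all read off from this form.\<close>

lemma Qt0_form_has_integral:
  "((\<lambda>s. (norm (transpose \<sigma> *v (mexp (s *\<^sub>R transpose a0) *v y)))\<^sup>2) has_integral (y \<bullet> (Qt0 a0 \<sigma> t *v y))) {0..t}"
proof -
  have "y \<bullet> (mexp (s *\<^sub>R a0) *v (\<sigma> *v (transpose \<sigma> *v (mexp (s *\<^sub>R transpose a0) *v y))))
    = (norm (transpose \<sigma> *v (mexp (s *\<^sub>R transpose a0) *v y)))\<^sup>2" for s
    by (simp add: inner_matrix_vector[of _ "mexp (s *\<^sub>R a0)"] inner_matrix_vector[of _ \<sigma>]
        transpose_mexp_scaleR power2_norm_eq_inner)
  then show ?thesis
    using has_integral_linear[OF Qt0_vec_has_integral[of y t] bounded_linear_inner_right[of y]]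
    by (simp add: o_def)
qed

lemma Qt0_form_nonneg: "0 \<le> y \<bullet> (Qt0 a0 \<sigma> t *v y)"
  by (rule has_integral_nonneg[OF Qt0_form_has_integral]) simp

lemma Qt0_form_mono: "s \<le> t \<Longrightarrow> y \<bullet> (Qt0 a0 \<sigma> s *v y) \<le> y \<bullet> (Qt0 a0 \<sigma> t *v y)"
  by (rule has_integral_subset_le[OF _ Qt0_form_has_integral Qt0_form_has_integral]) auto

text \<open>A time shift by \<open>s\<close> conjugates the integrand with
  \<open>mexp (s *\<^sub>R a0)\<close>. The increment is therefore congruent to \<open>Qt0\<close>
  at \<open>t\<close>, hence again a covariance; this is the input for the convolution argument in
  time.\<close>

lemma Qt0_add:
  assumes "0 \<le> s" "0 \<le> t"
  shows "Qt0 a0 \<sigma> (s + t) = Qt0 a0 \<sigma> s + mexp (s *\<^sub>R a0) ** Qt0 a0 \<sigma> t ** mexp (s *\<^sub>R transpose a0)"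
proof -
  let ?F = "\<lambda>s. mexp (s *\<^sub>R a0) ** \<sigma> ** transpose \<sigma> ** mexp (s *\<^sub>R transpose a0)"
  have shift: "?F (r + s) = mexp (s *\<^sub>R a0) ** ?F r ** mexp (s *\<^sub>R transpose a0)" for r
    by (subst (1) add.commute, subst (1) mexp_add, subst mexp_add) (simp add: matrix_mul_assoc)
  have "((\<lambda>r. mexp (s *\<^sub>R a0) ** ?F r ** mexp (s *\<^sub>R transpose a0)) has_integral
     mexp (s *\<^sub>R a0) ** Qt0 a0 \<sigma> t ** mexp (s *\<^sub>R transpose a0)) {0..t}"
    using has_integral_linear[OF Qt0_has_integral[of t] bounded_linear_compose[OF
        bounded_linear_matrix_mult_right[of "mexp (s *\<^sub>R transpose a0)"]
        bounded_linear_matrix_mult_left[of "mexp (s *\<^sub>R a0)"]]]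
    by (simp add: o_def)
  then have 1: "((\<lambda>r. ?F (r + s)) has_integral
     mexp (s *\<^sub>R a0) ** Qt0 a0 \<sigma> t ** mexp (s *\<^sub>R transpose a0)) {0..t}"
    by (simp only: shift)
  have "(?F has_integral integral {s..s+t} ?F) {s..s+t}"
    by (intro integrable_integral integrable_continuous_interval continuous_on_Qt0_integrand)
  then have "((\<lambda>r. ?F (r + s)) has_integral integral {s..s+t} ?F) {0..t}"
    using has_integral_affinity'[of ?F "integral {s..s+t} ?F" s "s + t" 1 s] by simp
  with 1 have "mexp (s *\<^sub>R a0) ** Qt0 a0 \<sigma> t ** mexp (s *\<^sub>R transpose a0) = integral {s..s+t} ?F"
    by (rule has_integral_unique)
  moreover have "integral {0..s} ?F + integral {s..s+t} ?F = integral {0..s+t} ?F"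
    using assms by (intro Henstock_Kurzweil_Integration.integral_combine integrable_continuous_interval
      continuous_on_Qt0_integrand) auto
  ultimately show ?thesis by (simp add: Qt0_def)
qed

lemma continuous_on_Qt0: "continuous_on {0..T} (Qt0 a0 \<sigma>)"
  unfolding Qt0_def
  by (intro indefinite_integral_continuous_1 integrable_continuous_interval continuous_on_Qt0_integrand)

lemma pos_def_Qt0: "invertible (Qt0 a0 \<sigma> t) \<Longrightarrow> pos_def (Qt0 a0 \<sigma> t)"
  by (rule pos_def_if_invertible[OF transpose_Qt0 Qt0_form_nonneg])

section \<open>The Kalman condition and the lower bound in powers of time\<close>

definition kalman_range :: "nat \<Rightarrow> (real^'n) set" where
  "kalman_range r = range (\<lambda>u::nat \<Rightarrow> real^'q. \<Sum>i\<le>r. ((\<lambda>y. a0 *v y) ^^ i) (\<sigma> *v u i))"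

lemma linear_funpow_matrix: "linear (((*v) (A :: real^'k^'k)) ^^ i)"
proof (induction i)
  case (Suc i)
  then show ?case using linear_compose[OF Suc matrix_vector_mul_linear[of A]] by (simp add: o_def)
qed (simp add: linear_ident id_def)

lemma funpow_matrix_inner: "x \<bullet> (((*v) (A :: real^'k^'k)) ^^ i) y = (((*v) (transpose A)) ^^ i) x \<bullet> y"
proof (induction i arbitrary: y)
  case (Suc i)
  have "x \<bullet> (((*v) A) ^^ Suc i) y = x \<bullet> (((*v) A) ^^ i) (A *v y)"
    by (simp only: funpow_Suc_right o_apply)
  also have "\<dots> = (((*v) (transpose A)) ^^ i) x \<bullet> (A *v y)" by (rule Suc)
  finally show ?case by (simp add: inner_matrix_vector)
qed simp

text \<open>Identifies the range with its span, so that a proper range has a nonzero orthogonal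
  vector.\<close>

lemma subspace_kalman_range: "subspace (kalman_range r)"
proof -
  let ?f = "\<lambda>u::nat \<Rightarrow> real^'q. \<Sum>i\<le>r. ((*v) a0 ^^ i) (\<sigma> *v u i)"
  note lin = linear_add[OF linear_funpow_matrix] linear_cmul[OF linear_funpow_matrix]
    linear_0[OF linear_funpow_matrix]
  have z: "?f (\<lambda>_. 0) = 0" by (simp add: lin)
  have add: "?f u + ?f v = ?f (\<lambda>i. u i + v i)" for u v
    by (simp add: matrix_vector_right_distrib lin sum.distrib)
  have scale: "c *\<^sub>R ?f u = ?f (\<lambda>i. c *\<^sub>R u i)" for c u
    by (simp add: matrix_vector_mult_scaleR lin scaleR_sum_right)
  show ?thesis
  proof (rule subspaceI)
    show "0 \<in> kalman_range r"
      unfolding kalman_range_def by (rule range_eqI[where x="\<lambda>_. 0"]) (rule z[symmetric])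
    show "x + y \<in> kalman_range r" if xy: "x \<in> kalman_range r" "y \<in> kalman_range r" for x y
    proof -
      obtain u v where "x = ?f u" "y = ?f v" using xy unfolding kalman_range_def by blast
      then have "x + y = ?f (\<lambda>i. u i + v i)" by (simp only: add)
      then show ?thesis unfolding kalman_range_def by (rule range_eqI[where x="\<lambda>i. u i + v i"])
    qed
    show "c *\<^sub>R x \<in> kalman_range r" if x: "x \<in> kalman_range r" for c x
    proof -
      obtain u where "x = ?f u" using x unfolding kalman_range_def by blast
      then have "c *\<^sub>R x = ?f (\<lambda>i. c *\<^sub>R u i)" by (simp only: scale)
      then show ?thesis unfolding kalman_range_def by (rule range_eqI[where x="\<lambda>i. c *\<^sub>R u i"])
    qed
  qed
qed

text \<open>Let \<open>w\<close> be the vector claimed to vanish. The element of the range whose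
  only nonzero block is the \<open>i\<close>-th one, filled with \<open>w\<close>, pairs with
  \<open>y\<close> to the squared norm of \<open>w\<close>.\<close>

lemma kalman_orthogonal:
  assumes "\<And>z. z \<in> kalman_range r \<Longrightarrow> y \<bullet> z = 0" and "i \<le> r"
  shows "transpose \<sigma> *v ((*v) (transpose a0) ^^ i) y = 0"
proof -
  let ?w = "transpose \<sigma> *v ((*v) (transpose a0) ^^ i) y"
  have "(\<Sum>j\<le>r. (((*v) a0) ^^ j) (\<sigma> *v (if j = i then ?w else 0))) = (\<Sum>j\<le>r. if j = i then ((*v) a0 ^^ i) (\<sigma> *v ?w) else 0)"
    by (intro sum.cong) (auto simp: linear_0[OF linear_funpow_matrix])
  also have "\<dots> = ((*v) a0 ^^ i) (\<sigma> *v ?w)" using assms(2) by simp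
  finally have "((*v) a0 ^^ i) (\<sigma> *v ?w) \<in> kalman_range r"
    unfolding kalman_range_def by (intro range_eqI[where x="\<lambda>j. if j = i then ?w else 0"]) (rule sym)
  then have "y \<bullet> ((*v) a0 ^^ i) (\<sigma> *v ?w) = 0" by (rule assms)
  then have "?w \<bullet> ?w = 0" by (simp add: funpow_matrix_inner inner_matrix_vector[of _ \<sigma>])
  then show ?thesis by simp
qed

text \<open>Ensures that the minimum in \<open>kalman_exponent\<close> exists. If every range were
  proper, the unit vectors \<open>y\<close> annihilating the blocks up to \<open>r\<close> would
  form a decreasing sequence of nonempty compact sets. A common point kills every Taylor coefficient
  of the integrand of the quadratic form, so the form of \<open>Qt0\<close> at time 1 vanishes
  there, against positive definiteness.\<close>

lemma kalman_range_eventually_UNIV: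
  assumes inv: "invertible (Qt0 a0 \<sigma> 1)"
  shows "\<exists>r. kalman_range r = UNIV"
proof (rule ccontr)
  assume "\<nexists>r. kalman_range r = UNIV"
  then have nU: "kalman_range r \<noteq> UNIV" for r by blast
  let ?c = "\<lambda>i y. transpose \<sigma> *v ((*v) (transpose a0) ^^ i) y"
  define F where "F r = {y. norm y = 1 \<and> (\<forall>i\<in>{..r}. ?c i y = 0)}" for r :: nat
  have cont: "continuous_on UNIV (?c i)" for i
    by (intro linear_continuous_on continuous_intros linear_conv_bounded_linear[THEN iffD1] linear_funpow_matrix)
  have "F r \<noteq> {}" for r
  proof -
    obtain y where y: "y \<noteq> 0" "\<And>z. z \<in> kalman_range r \<Longrightarrow> y \<bullet> z = 0"
      using span_not_UNIV_orthogonal[of "kalman_range r"] nU[of r]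
      by (auto simp: span_eq_iff[THEN iffD2, OF subspace_kalman_range])
    then have "?c i y = 0" if "i \<le> r" for i using kalman_orthogonal[OF _ that] by blast
    then have "y /\<^sub>R norm y \<in> F r"
      using y by (simp add: F_def linear_cmul[OF linear_funpow_matrix] matrix_vector_mult_scaleR)
    then show ?thesis by blast
  qed
  moreover have "compact (F r)" for r
  proof -
    have "F r = sphere 0 1 \<inter> (\<Inter>i\<in>{..r}. {y. ?c i y = 0})" by (auto simp: F_def)
    then show ?thesis
      by (simp add: compact_Int_closed closed_INT closed_Collect_eq cont)
  qed
  moreover have "F r \<subseteq> F q" if "q \<le> r" for q r using that by (auto simp: F_def)
  ultimately have "\<Inter>(range F) \<noteq> {}" by (intro compact_nest) auto
  then obtain y where y: "norm y = 1" "\<And>i. ?c i y = 0"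
    by (auto simp: F_def)
  have "transpose \<sigma> *v (mexp (s *\<^sub>R transpose a0) *v y) = 0" for s
  proof -
    have "(\<lambda>k. transpose \<sigma> *v (((1 / fact k) *\<^sub>R ((\<lambda>m. (s *\<^sub>R transpose a0) ** m) ^^ k) (mat 1)) *v y))
      sums (transpose \<sigma> *v (mexp (s *\<^sub>R transpose a0) *v y))"
      by (intro bounded_linear.sums[OF matrix_vector_mul_bounded_linear]
          bounded_linear.sums[OF bounded_linear_matrix_vector_left] mexp_sums)
    moreover have "((\<lambda>m. (s *\<^sub>R transpose a0) ** m) ^^ k) (mat 1) *v y = s ^ k *\<^sub>R (((*v) (transpose a0)) ^^ k) y" for k
      by (induction k) (simp_all add: matrix_vector_mult_scaleR matrix_vector_mult_scaleR_left flip: matrix_vector_mul_assoc)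
    ultimately have "(\<lambda>k. 0) sums (transpose \<sigma> *v (mexp (s *\<^sub>R transpose a0) *v y))"
      using y by (simp add: matrix_vector_mult_scaleR matrix_vector_mult_scaleR_left)
    then show ?thesis by (simp add: sums_iff)
  qed
  then have "((\<lambda>s. 0) has_integral (y \<bullet> (Qt0 a0 \<sigma> 1 *v y))) {0..1}"
    using Qt0_form_has_integral[of y 1] by simp
  then have "y \<bullet> (Qt0 a0 \<sigma> 1 *v y) = 0" by (simp add: has_integral_0_eq)
  then have "c * (norm y)\<^sup>2 \<le> y \<bullet> (Qt0 a0 \<sigma> 1 *v y) \<Longrightarrow> \<not> c > 0" for c using y by simp
  then show False using pos_def_Qt0[OF inv] unfolding pos_def_def by blast
qed

text \<open>The right-hand side attains its minimum on the unit sphere. If it vanished at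
  \<open>x\<close>, then \<open>x\<close> would be orthogonal to the whole range, which contains
  \<open>x\<close>.\<close>

lemma kalman_range_bound:
  assumes "kalman_range r = UNIV"
  obtains c where "c > 0" "\<And>y. c * (norm y)\<^sup>2 \<le> (\<Sum>i\<le>r. (norm (transpose \<sigma> *v ((*v) (transpose a0) ^^ i) y))\<^sup>2)"
proof -
  let ?c = "\<lambda>i y. transpose \<sigma> *v ((*v) (transpose a0) ^^ i) y"
  let ?f = "\<lambda>y. \<Sum>i\<le>r. (norm (?c i y))\<^sup>2"
  obtain e :: "real^'n" where e: "norm e = 1" by (rule vector_choose_size[of 1]) auto
  have cont: "continuous_on S (?c i)" for i S
    by (intro linear_continuous_on continuous_intros linear_conv_bounded_linear[THEN iffD1] linear_funpow_matrix)
  have "\<exists>x\<in>sphere 0 1. \<forall>y\<in>sphere 0 1. ?f x \<le> ?f y"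
    by (rule continuous_attains_inf) (use e in \<open>auto intro!: continuous_intros cont exI[of _ e]\<close>)
  then obtain x where x: "norm x = 1" "\<And>y. norm y = 1 \<Longrightarrow> ?f x \<le> ?f y" by auto
  have "?f x \<noteq> 0"
  proof
    assume "?f x = 0"
    then have z: "?c i x = 0" if "i \<le> r" for i
      using that by (subst (asm) sum_nonneg_eq_0_iff) auto
    have "x \<in> kalman_range r" using assms by simp
    then obtain u where u: "x = (\<Sum>i\<le>r. ((*v) a0 ^^ i) (\<sigma> *v u i))" unfolding kalman_range_def by blast
    have "x \<bullet> x = (\<Sum>i\<le>r. ?c i x \<bullet> u i)"
      by (subst (2) u) (simp add: inner_sum_right funpow_matrix_inner inner_matrix_vector[of _ \<sigma>])
    also have "\<dots> = 0" using z by simp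
    finally show False using x(1) by simp
  qed
  then have "0 < ?f x" using sum_nonneg[of "{..r}" "\<lambda>i. (norm (?c i x))\<^sup>2"] by simp
  moreover have "?f x * (norm y)\<^sup>2 \<le> ?f y" for y
  proof (cases "y = 0")
    case False
    have "?f x \<le> ?f (y /\<^sub>R norm y)" using False by (intro x) simp
    also have "\<dots> = ?f y / (norm y)\<^sup>2"
      by (simp add: linear_cmul[OF linear_funpow_matrix] matrix_vector_mult_scaleR power_mult_distrib
          sum_distrib_left divide_inverse power_inverse mult.commute)
    finally show ?thesis using False by (simp add: field_simps)
  qed (simp add: sum_nonneg)
  ultimately show ?thesis by (rule that)
qed

text \<open>With \<open>s = t * u\<close> the left-hand side is the integral over
  \<open>{0..t}\<close> of the squared Taylor polynomial of
  \<open>transpose \<sigma> *v (mexp (s *\<^sub>R transpose a0) *v y)\<close>. On that interval the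
  remainder is at most \<open>t ^ Suc r * L * norm y\<close>; the restriction
  \<open>t \<le> 1\<close> freezes the exponential in \<open>L\<close>.\<close>

lemma Qt0_Taylor_lower_bound:
  fixes r :: nat and y :: "real^'n"
  assumes t: "0 < t" "t \<le> 1"
  defines "L \<equiv> onorm ((*v) (transpose \<sigma>)) * (norm (of_mat (transpose a0)) ^ Suc r * exp (norm (of_mat (transpose a0))))"
  shows "t * integral {0..1} (\<lambda>u. (norm (\<Sum>i\<le>r. u ^ i *\<^sub>R ((t ^ i / fact i) *\<^sub>R (transpose \<sigma> *v ((*v) (transpose a0) ^^ i) y))))\<^sup>2)
    \<le> 2 * (y \<bullet> (Qt0 a0 \<sigma> t *v y)) + 2 * t * (t ^ Suc r * L * norm y)\<^sup>2"
proof -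
  define K where "K = norm (of_mat (transpose a0))"
  define c where "c i = (1 / fact i) *\<^sub>R (transpose \<sigma> *v ((*v) (transpose a0) ^^ i) y)" for i
  define p where "p s = (\<Sum>i\<le>r. s ^ i *\<^sub>R c i)" for s :: real
  define g where "g s = transpose \<sigma> *v (mexp (s *\<^sub>R transpose a0) *v y)" for s
  have cp: "continuous_on S p" for S unfolding p_def by (intro continuous_intros)
  have L: "0 \<le> L" unfolding L_def by (simp add: onorm_pos_le)
  have gp: "norm (p s - g s) \<le> t ^ Suc r * L * norm y" if s: "s \<in> {0..t}" for s
  proof -
    have "p s = transpose \<sigma> *v (\<Sum>i\<le>r. (s ^ i / fact i) *\<^sub>R ((*v) (transpose a0) ^^ i) y)"
      by (simp add: p_def c_def linear_sum[OF matrix_vector_mul_linear] matrix_vector_mult_scaleR)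
    then have "norm (p s - g s) = norm (transpose \<sigma> *v (mexp (s *\<^sub>R transpose a0) *v y -
        (\<Sum>i\<le>r. (s ^ i / fact i) *\<^sub>R ((*v) (transpose a0) ^^ i) y)))"
      by (simp add: g_def matrix_vector_mult_diff_distrib norm_minus_commute)
    also have "\<dots> \<le> onorm ((*v) (transpose \<sigma>)) * norm (mexp (s *\<^sub>R transpose a0) *v y -
        (\<Sum>i\<le>r. (s ^ i / fact i) *\<^sub>R ((*v) (transpose a0) ^^ i) y))"
      by (rule onorm) simp
    also have "\<dots> \<le> onorm ((*v) (transpose \<sigma>)) * ((\<bar>s\<bar> * K) ^ Suc r * exp (\<bar>s\<bar> * K) * norm y)"
      unfolding K_def by (intro mult_left_mono mexp_Taylor_bound onorm_pos_le) simp
    also have "\<dots> \<le> onorm ((*v) (transpose \<sigma>)) * ((t * K) ^ Suc r * exp (1 * K) * norm y)"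
      using s t by (intro mult_left_mono mult_right_mono mult_mono power_mono onorm_pos_le)
        (auto simp: K_def mult_left_le_one_le intro!: mult_right_mono)
    also have "\<dots> = t ^ Suc r * L * norm y"
      by (simp add: L_def K_def power_mult_distrib)
    finally show ?thesis .
  qed
  have "integral {0..t / t} (\<lambda>u. (norm (p (t * u)))\<^sup>2) = integral {0..t} (\<lambda>s. (norm (p s))\<^sup>2) / t"
    by (rule integral_dilate) (use t in \<open>auto intro!: continuous_intros cp\<close>)
  then have "t * integral {0..1} (\<lambda>u. (norm (p (t * u)))\<^sup>2) = integral {0..t} (\<lambda>s. (norm (p s))\<^sup>2)"
    using t by simp
  also have "\<dots> \<le> 2 * (y \<bullet> (Qt0 a0 \<sigma> t *v y)) + (t ^ Suc r * L * norm y)\<^sup>2 * 2 * t"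
  proof (rule has_integral_le)
    show "((\<lambda>s. (norm (p s))\<^sup>2) has_integral integral {0..t} (\<lambda>s. (norm (p s))\<^sup>2)) {0..t}"
      by (intro integrable_integral integrable_continuous_interval continuous_intros cp)
    have "((\<lambda>s. (t ^ Suc r * L * norm y)\<^sup>2 * 2) has_integral (t ^ Suc r * L * norm y)\<^sup>2 * 2 * t) {0..t}"
      using has_integral_const_real[of "(t ^ Suc r * L * norm y)\<^sup>2 * 2" 0 t] t by (simp add: mult.commute)
    from has_integral_add[OF has_integral_mult_right[OF Qt0_form_has_integral[of y t], of 2] this]
    show "((\<lambda>s. 2 * (norm (g s))\<^sup>2 + (t ^ Suc r * L * norm y)\<^sup>2 * 2) has_integral
       2 * (y \<bullet> (Qt0 a0 \<sigma> t *v y)) + (t ^ Suc r * L * norm y)\<^sup>2 * 2 * t) {0..t}"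
      unfolding g_def .
    show "(norm (p s))\<^sup>2 \<le> 2 * (norm (g s))\<^sup>2 + (t ^ Suc r * L * norm y)\<^sup>2 * 2" if "s \<in> {0..t}" for s
    proof -
      have "(norm (p s))\<^sup>2 \<le> 2 * (norm (g s))\<^sup>2 + 2 * (norm (p s - g s))\<^sup>2"
        using norm_add_sq_le[of "g s" "p s - g s"] by simp
      also have "\<dots> \<le> 2 * (norm (g s))\<^sup>2 + 2 * (t ^ Suc r * L * norm y)\<^sup>2"
        using gp[OF that] by (intro add_left_mono mult_left_mono power_mono) auto
      finally show ?thesis by simp
    qed
  qed
  finally show ?thesis
    by (simp add: p_def c_def power_mult_distrib mult_ac)
qed

text \<open>The polynomial part contributes at least a multiple of \<open>t ^ (2 * r + 1)\<close>,
  while the remainder carries two further powers of \<open>t\<close> and is absorbed once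
  \<open>t\<close> is small.\<close>

lemma Qt0_kalman_lower_bound_near_0:
  assumes "kalman_range r = UNIV"
  obtains c t0 where "c > 0" "0 < t0"
    "\<And>t y. 0 < t \<Longrightarrow> t \<le> t0 \<Longrightarrow> c * t ^ (2 * r + 1) * (norm y)\<^sup>2 \<le> y \<bullet> (Qt0 a0 \<sigma> t *v y)"
proof -
  let ?c = "\<lambda>i y. transpose \<sigma> *v ((*v) (transpose a0) ^^ i) y"
  obtain m where m: "m > 0" "\<And>y. m * (norm y)\<^sup>2 \<le> (\<Sum>i\<le>r. (norm (?c i y))\<^sup>2)"
    using kalman_range_bound[OF assms] by blast
  obtain \<kappa> where \<kappa>: "\<kappa> > 0" "\<And>c :: nat \<Rightarrow> real^'q. \<kappa> * (\<Sum>i\<le>r. (norm (c i))\<^sup>2)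
      \<le> integral {0..1} (\<lambda>u. (norm (\<Sum>i\<le>r. u ^ i *\<^sub>R c i))\<^sup>2)"
    using polynomial_L2_lower_bound by blast
  define L where "L = onorm ((*v) (transpose \<sigma>)) * (norm (of_mat (transpose a0)) ^ Suc r * exp (norm (of_mat (transpose a0))))"
  \<comment> \<open>\<open>m\<close> comes from the Kalman condition and \<open>\<kappa>\<close>
    from the polynomial estimate; for \<open>t \<le> 1\<close> the smallest weight
    \<open>t ^ i / fact i\<close> is the one with \<open>i = r\<close>, whence
    \<open>(fact r)\<^sup>2\<close>.\<close>
  define a where "a = \<kappa> * m / (fact r)\<^sup>2"
  have a: "a > 0" using \<kappa> m by (simp add: a_def)
  \<comment> \<open>Below this time \<open>t * t * L\<^sup>2\<close> is at most
    \<open>a / 4\<close>, so the remainder consumes at most half of the main term; the factor 2 in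
    front of the form then leaves \<open>a / 4\<close>. The summand 1 covers
    \<open>L = 0\<close>.\<close>
  define t0 where "t0 = min 1 (a / (4 * (L\<^sup>2 + 1)))"
  have t0: "0 < t0" using a by (simp add: t0_def add_nonneg_pos)
  have "a / 4 * t ^ (2 * r + 1) * (norm y)\<^sup>2 \<le> y \<bullet> (Qt0 a0 \<sigma> t *v y)" if t: "0 < t" "t \<le> t0" for t y
  proof -
    have t1: "t \<le> 1" "t \<le> a / (4 * (L\<^sup>2 + 1))" using t by (auto simp: t0_def)
    have "a * t ^ (2 * r) * (norm y)\<^sup>2 = \<kappa> * ((t ^ r / fact r)\<^sup>2 * (m * (norm y)\<^sup>2))"
      by (simp add: a_def power_divide power_mult mult.commute[of 2] mult_ac)
    also have "\<dots> \<le> \<kappa> * ((t ^ r / fact r)\<^sup>2 * (\<Sum>i\<le>r. (norm (?c i y))\<^sup>2))"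
      using \<kappa> m by (intro mult_left_mono) auto
    also have "\<dots> \<le> \<kappa> * (\<Sum>i\<le>r. (norm ((t ^ i / fact i) *\<^sub>R ?c i y))\<^sup>2)"
      unfolding sum_distrib_left
    proof (intro sum_mono mult_left_mono)
      fix i assume "i \<in> {..r}"
      then have "t ^ r / fact r \<le> t ^ i / fact i"
        using t t1 by (intro frac_le power_decreasing fact_mono) auto
      then have "(t ^ r / fact r)\<^sup>2 * (norm (?c i y))\<^sup>2 \<le> (t ^ i / fact i)\<^sup>2 * (norm (?c i y))\<^sup>2"
        using t by (intro mult_right_mono power_mono) auto
      then show "(t ^ r / fact r)\<^sup>2 * (norm (?c i y))\<^sup>2 \<le> (norm ((t ^ i / fact i) *\<^sub>R ?c i y))\<^sup>2"
        by (simp add: power_mult_distrib power_divide)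
    qed (use \<kappa> in auto)
    also have "\<dots> \<le> integral {0..1} (\<lambda>u. (norm (\<Sum>i\<le>r. u ^ i *\<^sub>R ((t ^ i / fact i) *\<^sub>R ?c i y)))\<^sup>2)"
      by (rule \<kappa>)
    finally have "t * (a * t ^ (2 * r) * (norm y)\<^sup>2) \<le> 2 * (y \<bullet> (Qt0 a0 \<sigma> t *v y)) + 2 * t * (t ^ Suc r * L * norm y)\<^sup>2"
      using Qt0_Taylor_lower_bound[OF t(1) t1(1), where r=r and y=y] t(1) unfolding L_def
      by (meson less_imp_le mult_left_mono order_trans)
    moreover have "2 * t * (t ^ Suc r * L * norm y)\<^sup>2 \<le> a / 2 * t ^ (2 * r + 1) * (norm y)\<^sup>2"
    proof -
      have "t * t * L\<^sup>2 \<le> a / 4"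
      proof -
        have "t * t * L\<^sup>2 \<le> t * 1 * (L\<^sup>2 + 1)"
          using t t1 by (intro mult_mono) auto
        also have "\<dots> \<le> a / 4"
        proof -
          have p: "0 < 4 * (L\<^sup>2 + 1)" by (intro mult_pos_pos add_nonneg_pos) auto
          show ?thesis using t1(2) unfolding pos_le_divide_eq[OF p] by (simp add: algebra_simps)
        qed
        finally show ?thesis .
      qed
      then have "2 * t ^ (2 * r + 1) * (norm y)\<^sup>2 * (t * t * L\<^sup>2) \<le> 2 * t ^ (2 * r + 1) * (norm y)\<^sup>2 * (a / 4)"
        using t by (intro mult_left_mono) auto
      also have "2 * t ^ (2 * r + 1) * (norm y)\<^sup>2 * (a / 4) = a / 2 * t ^ (2 * r + 1) * (norm y)\<^sup>2"
        by simp
      finally have *: "2 * t ^ (2 * r + 1) * (norm y)\<^sup>2 * (t * t * L\<^sup>2) \<le> a / 2 * t ^ (2 * r + 1) * (norm y)\<^sup>2" .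
      have "2 * t * (t ^ Suc r * L * norm y)\<^sup>2 = 2 * t ^ (2 * r + 1) * (norm y)\<^sup>2 * (t * t * L\<^sup>2)"
        using power_add[of t r r] unfolding mult_2[of r, symmetric] by (simp add: power2_eq_square mult_ac)
      with * show ?thesis by (simp only:)
    qed
    ultimately show ?thesis by (simp add: mult_ac)
  qed
  then show ?thesis using that[of "a / 4" t0] a t0 by simp
qed

text \<open>The bound near 0 is used at the earlier time \<open>q * t\<close>, and monotonicity of
  the form in time carries it to \<open>t\<close>; the price is the factor
  \<open>q ^ (2 * r + 1)\<close>.\<close>

lemma Qt0_kalman_lower_bound:
  assumes "kalman_range r = UNIV" and T: "T > 0"
  obtains c where "c > 0"
    "\<And>t y. 0 < t \<Longrightarrow> t \<le> T \<Longrightarrow> c * t ^ (2 * r + 1) * (norm y)\<^sup>2 \<le> y \<bullet> (Qt0 a0 \<sigma> t *v y)"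
proof -
  obtain c t0 where c: "c > 0" "0 < t0"
    "\<And>t y. 0 < t \<Longrightarrow> t \<le> t0 \<Longrightarrow> c * t ^ (2 * r + 1) * (norm y)\<^sup>2 \<le> y \<bullet> (Qt0 a0 \<sigma> t *v y)"
    using Qt0_kalman_lower_bound_near_0[OF assms(1)] by blast
  define q where "q = min 1 (t0 / T)"
  have q: "0 < q" "q \<le> 1" "q * T \<le> t0" using c T by (auto simp: q_def min_def field_simps)
  have "c * q ^ (2 * r + 1) * t ^ (2 * r + 1) * (norm y)\<^sup>2 \<le> y \<bullet> (Qt0 a0 \<sigma> t *v y)"
    if t: "0 < t" "t \<le> T" for t y
  proof -
    have "q * t \<le> q * T" using q t by (intro mult_left_mono) auto
    then have "q * t \<le> t0" using q by linarith
    then have "c * (q * t) ^ (2 * r + 1) * (norm y)\<^sup>2 \<le> y \<bullet> (Qt0 a0 \<sigma> (q * t) *v y)"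
      using q t by (intro c) auto
    also have "\<dots> \<le> y \<bullet> (Qt0 a0 \<sigma> t *v y)"
      using q t by (intro Qt0_form_mono) (simp add: mult_left_le_one_le)
    finally show ?thesis by (simp add: power_mult_distrib mult_ac)
  qed
  then show ?thesis using that[of "c * q ^ (2 * r + 1)"] c q by simp
qed

end

section \<open>Gaussian averages\<close>

text \<open>All three are moments of the normal law of \<open>h \<bullet> w\<close>, whose standard
  deviation is \<open>norm h\<close>; the absolute moment equals
  \<open>norm h * sqrt (2 / pi)\<close>.\<close>

lemma std_gauss_inner_moments:
  fixes h :: "'a::euclidean_space"
  shows integrable_std_gauss_inner: "integrable std_gauss (\<lambda>w. h \<bullet> w)"
    and integral_std_gauss_inner: "(LINT w|std_gauss. h \<bullet> w) = 0"
    and integral_std_gauss_abs_inner_le: "(LINT w|std_gauss. \<bar>h \<bullet> w\<bar>) \<le> norm h"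
proof -
  have "integrable std_gauss (\<lambda>w. h \<bullet> w) \<and> (LINT w|std_gauss. h \<bullet> w) = 0 \<and> (LINT w|std_gauss. \<bar>h \<bullet> w\<bar>) \<le> norm h"
  proof (cases "h = 0")
    case False
    define v where "v = norm h"
    have v: "v > 0" using False by (simp add: v_def)
    have d: "distr std_gauss borel (\<lambda>w. h \<bullet> w) = density lborel (normal_density 0 v)"
      using False by (simp add: distr_std_gauss_inner normal_law_def v_def)
    have 1: "integrable (density lborel (normal_density 0 v)) (\<lambda>x. x)"
      using integrable_normal_moment[of v 0 1] v by (simp add: integrable_real_density)
    have 2: "(LINT x|density lborel (normal_density 0 v). x) = 0"
      using integral_normal_moment_odd[of v 0 0] v by (simp add: integral_real_density)
    have "(LINT x|density lborel (normal_density 0 v). \<bar>x\<bar>) = v * sqrt (2 / pi)"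
      using integral_normal_moment_abs_odd[of v 0 0] v by (simp add: integral_real_density)
    also have "\<dots> \<le> v * 1"
      using v pi_gt3 by (intro mult_left_mono) auto
    finally have 3: "(LINT x|density lborel (normal_density 0 v). \<bar>x\<bar>) \<le> v" by simp
    from 1 have "integrable std_gauss (\<lambda>w. h \<bullet> w)"
      unfolding d[symmetric] by (simp add: integrable_distr_eq)
    moreover from 2 have "(LINT w|std_gauss. h \<bullet> w) = 0"
      unfolding d[symmetric] by (simp add: integral_distr)
    moreover from 3 have "(LINT w|std_gauss. \<bar>h \<bullet> w\<bar>) \<le> v"
      unfolding d[symmetric] by (simp add: integral_distr)
    ultimately show ?thesis by (simp add: v_def)
  qed simp
  then show "integrable std_gauss (\<lambda>w. h \<bullet> w)" "(LINT w|std_gauss. h \<bullet> w) = 0"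
    "(LINT w|std_gauss. \<bar>h \<bullet> w\<bar>) \<le> norm h" by auto
qed

text \<open>By \<open>std_gauss_shift\<close> the exponential is the density of a translate of
  \<open>std_gauss\<close>, whose total mass is 1.\<close>

lemma std_gauss_exp_moment:
  fixes h :: "'a::euclidean_space"
  shows integrable_std_gauss_exp: "integrable std_gauss (\<lambda>w. exp (h \<bullet> w - (norm h)\<^sup>2 / 2))"
    and integral_std_gauss_exp: "(LINT w|std_gauss. exp (h \<bullet> w - (norm h)\<^sup>2 / 2)) = 1"
proof -
  have "(\<integral>\<^sup>+w. ennreal (exp (h \<bullet> w - (norm h)\<^sup>2 / 2)) \<partial>std_gauss)
    = emeasure (density std_gauss (\<lambda>x. ennreal (exp (h \<bullet> x - (norm h)\<^sup>2 / 2)))) UNIV"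
    by (simp add: emeasure_density)
  also have "\<dots> = emeasure std_gauss (UNIV :: 'a set)"
    unfolding std_gauss_shift[symmetric] by (simp add: emeasure_distr)
  also have "\<dots> = 1"
    using prob_space.emeasure_space_1[OF prob_space_std_gauss] by simp
  finally have nn: "(\<integral>\<^sup>+w. ennreal (exp (h \<bullet> w - (norm h)\<^sup>2 / 2)) \<partial>std_gauss) = ennreal 1" by simp
  show "integrable std_gauss (\<lambda>w. exp (h \<bullet> w - (norm h)\<^sup>2 / 2))"
    by (rule integrableI_nn_integral_finite[OF _ _ nn]) auto
  show "(LINT w|std_gauss. exp (h \<bullet> w - (norm h)\<^sup>2 / 2)) = 1"
    by (subst integral_eq_nn_integral) (auto simp: nn)
qed

definition gauss_avg :: "('a::euclidean_space \<Rightarrow> real) \<Rightarrow> 'a \<Rightarrow> real" where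
  "gauss_avg \<psi> u = (LINT w|std_gauss. \<psi> (w + u))"

text \<open>The derivative of \<open>gauss_avg\<close> at \<open>u\<close> in direction
  \<open>h\<close>, with the derivative falling on the Gaussian density, so that it makes sense for
  merely bounded measurable functions.\<close>

definition gauss_avg_deriv :: "('a::euclidean_space \<Rightarrow> real) \<Rightarrow> 'a \<Rightarrow> 'a \<Rightarrow> real" where
  "gauss_avg_deriv \<psi> u h = (LINT w|std_gauss. \<psi> (w + u) * (h \<bullet> w))"

context
  fixes \<psi> :: "'a::euclidean_space \<Rightarrow> real" and M :: real
  assumes meas [measurable]: "\<psi> \<in> borel_measurable borel" and bd: "\<And>z. \<bar>\<psi> z\<bar> \<le> M"
begin

lemma integrable_gauss_avg: "integrable std_gauss (\<lambda>w. \<psi> (w + u))"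
proof -
  interpret prob_space "std_gauss :: 'a measure" by (rule prob_space_std_gauss)
  show ?thesis by (rule integrable_const_bound[where B=M]) (auto simp: bd)
qed

lemma bound_nonneg: "0 \<le> M"
  using bd[of 0] by linarith

lemma gauss_avg_le: "\<bar>gauss_avg \<psi> u\<bar> \<le> M"
proof -
  interpret prob_space "std_gauss :: 'a measure" by (rule prob_space_std_gauss)
  have "norm (LINT w|std_gauss. \<psi> (w + u)) \<le> (LINT w|(std_gauss :: 'a measure). M)"
    by (rule Bochner_Integration.integral_norm_bound_integral[OF integrable_gauss_avg]) (auto simp: bd)
  then show ?thesis by (simp add: gauss_avg_def prob_space[simplified])
qed

lemma integrable_bounded_mult:
  assumes "integrable std_gauss f"
  shows "integrable std_gauss (\<lambda>w. \<psi> (w + u) * f w)"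
proof (rule Bochner_Integration.integrable_bound)
  show "integrable std_gauss (\<lambda>w. M * f w)" using assms by simp
  have [measurable]: "f \<in> borel_measurable std_gauss" using assms by simp
  show "(\<lambda>w. \<psi> (w + u) * f w) \<in> borel_measurable std_gauss" by measurable
  show "AE w in std_gauss. norm (\<psi> (w + u) * f w) \<le> norm (M * f w)"
    using bd bound_nonneg by (auto simp: abs_mult intro!: mult_right_mono)
qed

lemma integral_bounded_mult_le:
  assumes "integrable std_gauss f"
  shows "\<bar>LINT w|std_gauss. \<psi> (w + u) * f w\<bar> \<le> M * (LINT w|std_gauss. \<bar>f w\<bar>)"
proof -
  have "norm (LINT w|std_gauss. \<psi> (w + u) * f w) \<le> (LINT w|std_gauss. M * \<bar>f w\<bar>)"
    by (rule Bochner_Integration.integral_norm_bound_integral[OF integrable_bounded_mult[OF assms]])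
      (use assms bd in \<open>auto simp: abs_mult intro!: mult_right_mono\<close>)
  then show ?thesis by simp
qed

lemma gauss_avg_deriv_le: "\<bar>gauss_avg_deriv \<psi> u h\<bar> \<le> M * norm h"
  unfolding gauss_avg_deriv_def
  by (rule order_trans[OF integral_bounded_mult_le[OF integrable_std_gauss_inner]])
    (intro mult_left_mono integral_std_gauss_abs_inner_le bound_nonneg)

lemma linear_gauss_avg_deriv: "linear (gauss_avg_deriv \<psi> u)"
proof (rule linearI)
  show "gauss_avg_deriv \<psi> u (h + k) = gauss_avg_deriv \<psi> u h + gauss_avg_deriv \<psi> u k" for h k
    unfolding gauss_avg_deriv_def inner_add_left distrib_left
    by (intro Bochner_Integration.integral_add integrable_bounded_mult integrable_std_gauss_inner)
  show "gauss_avg_deriv \<psi> u (c *\<^sub>R h) = c *\<^sub>R gauss_avg_deriv \<psi> u h" for c h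
    unfolding gauss_avg_deriv_def by (simp add: mult.left_commute)
qed

text \<open>By the shift formula the left-hand side is an integral against \<open>e\<^sup>y - 1 - h \<bullet> w\<close>, where
  \<open>y = h \<bullet> w - |h|\<^sup>2/2\<close>; since \<open>e\<^sup>y - 1 - y \<ge> 0\<close>, its \<open>L\<^sup>1\<close>-norm is computed from the means of \<open>e\<^sup>y\<close>
  and \<open>y\<close>.\<close>

lemma gauss_avg_Taylor:
  "\<bar>gauss_avg \<psi> (u + h) - gauss_avg \<psi> u - gauss_avg_deriv \<psi> u h\<bar> \<le> M * (norm h)\<^sup>2"
proof -
  interpret prob_space "std_gauss :: 'a measure" by (rule prob_space_std_gauss)
  let ?e = "\<lambda>w. exp (h \<bullet> w - (norm h)\<^sup>2 / 2)"
  have "gauss_avg \<psi> (u + h) = (LINT w|std_gauss. \<psi> ((w + h) + u))"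
    by (simp add: gauss_avg_def add_ac)
  also have "\<dots> = (LINT w|distr std_gauss borel (\<lambda>w. w + h). \<psi> (w + u))"
    by (subst integral_distr) auto
  also have "\<dots> = (LINT w|std_gauss. ?e w * \<psi> (w + u))"
    unfolding std_gauss_shift by (subst integral_density) auto
  finally have shift: "gauss_avg \<psi> (u + h) = (LINT w|std_gauss. \<psi> (w + u) * ?e w)"
    by (simp add: mult.commute)
  have int: "integrable std_gauss (\<lambda>w. ?e w - 1 - h \<bullet> w)"
    by (intro Bochner_Integration.integrable_diff integrable_std_gauss_exp integrable_std_gauss_inner) simp
  have "gauss_avg \<psi> (u + h) - gauss_avg \<psi> u - gauss_avg_deriv \<psi> u h
    = (LINT w|std_gauss. \<psi> (w + u) * (?e w - 1 - h \<bullet> w))"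
    unfolding shift unfolding gauss_avg_def gauss_avg_deriv_def
    using integrable_bounded_mult[OF integrable_std_gauss_exp] integrable_bounded_mult[OF integrable_std_gauss_inner]
      integrable_gauss_avg
    by (simp add: right_diff_distrib)
  then have "\<bar>gauss_avg \<psi> (u + h) - gauss_avg \<psi> u - gauss_avg_deriv \<psi> u h\<bar>
    \<le> M * (LINT w|std_gauss. \<bar>?e w - 1 - h \<bullet> w\<bar>)"
    using integral_bounded_mult_le[OF int] by simp
  \<comment> \<open>The expression is at least \<open>- (norm h)\<^sup>2 / 2\<close>, so adding
    \<open>(norm h)\<^sup>2\<close> dominates its absolute value; apart from this constant the new
    integrand has mean 0.\<close>
  also have "(LINT w|std_gauss. \<bar>?e w - 1 - h \<bullet> w\<bar>) \<le> (LINT w|std_gauss. ?e w - 1 - h \<bullet> w + (norm h)\<^sup>2)"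
  proof (rule integral_mono)
    fix w :: 'a
    show "\<bar>?e w - 1 - h \<bullet> w\<bar> \<le> ?e w - 1 - h \<bullet> w + (norm h)\<^sup>2"
      using exp_ge_add_one_self[of "h \<bullet> w - (norm h)\<^sup>2 / 2"] zero_le_power2[of "norm h"] by linarith
  qed (use int in auto)
  also have "\<dots> = (norm h)\<^sup>2"
    using integrable_std_gauss_exp[of h] integrable_std_gauss_inner[of h]
    by (simp add: integral_std_gauss_exp integral_std_gauss_inner prob_space[simplified])
  finally show ?thesis using bound_nonneg by (simp add: mult_left_mono)
qed

text \<open>For \<open>norm h \<le> 1\<close> the quadratic remainder is at most
  \<open>M * norm h\<close> and adds to the bound for the derivative; for larger \<open>h\<close>
  the trivial bound \<open>2 * M\<close> is already sufficient.\<close>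

lemma gauss_avg_Lipschitz: "\<bar>gauss_avg \<psi> (u + h) - gauss_avg \<psi> u\<bar> \<le> 2 * M * norm h"
proof (cases "norm h \<le> 1")
  case True
  have "M * (norm h)\<^sup>2 \<le> M * norm h"
    using True bound_nonneg by (intro mult_left_mono) (auto simp: power2_eq_square mult_left_le)
  then show ?thesis
    using gauss_avg_Taylor[of u h] gauss_avg_deriv_le[of u h] by linarith
next
  case False
  then have "2 * M * 1 \<le> 2 * M * norm h" using bound_nonneg by (intro mult_left_mono) auto
  then show ?thesis using gauss_avg_le[of "u + h"] gauss_avg_le[of u] by linarith
qed

end

section \<open>Finite signed measures\<close>

context
  fixes S :: "real set" and \<nu> :: "real set \<Rightarrow> real"
  assumes \<nu>: "finite_signed_measure_on S \<nu>"
begin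

lemma signed_sums:
  assumes "range E \<subseteq> sets (restrict_space borel S)" "disjoint_family E"
  shows "(\<lambda>i::nat. \<nu> (E i)) sums \<nu> (\<Union>i. E i)"
  using \<nu> assms unfolding finite_signed_measure_on_def by blast

text \<open>Countable additivity for the constant sequence of empty sets makes a constant series
  converge, which forces its term to be 0.\<close>

lemma signed_empty: "\<nu> {} = 0"
proof -
  have "(\<lambda>i::nat. \<nu> {}) sums \<nu> {}"
    using signed_sums[of "\<lambda>_. {}"] by (simp add: disjoint_family_on_def)
  then show ?thesis using summable_const_iff[of "\<nu> {}"] by (simp add: sums_iff)
qed

lemma signed_Diff:
  assumes "A \<in> sets (restrict_space borel S)" "B \<in> sets (restrict_space borel S)" "A \<subseteq> B"
  shows "\<nu> (B - A) = \<nu> B - \<nu> A"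
proof -
  let ?E = "binaryset A (B - A)"
  have "(\<lambda>i::nat. \<nu> (?E i)) sums \<nu> (\<Union>i. ?E i)"
    by (rule signed_sums) (use assms in \<open>auto simp: range_binaryset_eq disjoint_family_on_def binaryset_def\<close>)
  then have "(\<lambda>i::nat. \<nu> (?E i)) sums \<nu> B"
    using assms(3) by (simp add: UN_binaryset_eq Un_absorb1)
  moreover have "(\<lambda>i::nat. \<nu> (?E i)) sums (\<Sum>i\<in>{0, 1}. \<nu> (?E i))"
    by (rule sums_finite) (auto simp: binaryset_def signed_empty)
  ultimately have "\<nu> B = (\<Sum>i\<in>{0, 1}. \<nu> (?E i))" by (rule sums_unique2)
  then show ?thesis by (simp add: binaryset_def)
qed

text \<open>If \<open>\<nu>\<close> were unbounded on the subsets of \<open>S\<close>, one could repeatedly split off pieces with \<open>|\<nu>| \<ge> 1\<close>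
  such that \<open>\<nu>\<close> stays unbounded on the rest.\<close>

lemma signed_bounded:
  "\<exists>K. \<forall>A\<in>sets (restrict_space borel S). \<bar>\<nu> A\<bar> \<le> K"
proof (rule ccontr)
  let ?\<A> = "sets (restrict_space borel S)"
  define bad where "bad E \<longleftrightarrow> E \<in> ?\<A> \<and> (\<forall>K. \<exists>A\<in>?\<A>. A \<subseteq> E \<and> \<bar>\<nu> A\<bar> > K)" for E
  assume unbd: "\<nexists>K. \<forall>A\<in>?\<A>. \<bar>\<nu> A\<bar> \<le> K"
  have S: "S \<in> ?\<A>"
    using sets.top[of "restrict_space borel S"] by (simp add: space_restrict_space)
  have sub: "A \<subseteq> S" if "A \<in> ?\<A>" for A
    using sets.sets_into_space[OF that] by (simp add: space_restrict_space)
  have "bad S"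
    unfolding bad_def
  proof (intro conjI S allI)
    fix K
    obtain A where "A \<in> ?\<A>" "\<not> \<bar>\<nu> A\<bar> \<le> K" using unbd by blast
    then show "\<exists>A\<in>?\<A>. A \<subseteq> S \<and> \<bar>\<nu> A\<bar> > K" using sub by (intro bexI[of _ A]) auto
  qed
  have badD: "\<exists>A\<in>?\<A>. A \<subseteq> E \<and> \<bar>\<nu> A\<bar> > K" if "bad E" for E K
    using that unfolding bad_def by (elim conjE) (rule spec)
  \<comment> \<open>A subset \<open>A\<close> whose value exceeds that of \<open>E\<close> by more
    than 1 in modulus has a complement in \<open>E\<close> with value at least 1 in modulus too. One
    of the two pieces is again bad, since otherwise the values on subsets of \<open>E\<close> would
    be bounded; the other piece is split off.\<close>
  have split: "\<exists>E'. bad E' \<and> E' \<subseteq> E \<and> \<bar>\<nu> (E - E')\<bar> \<ge> 1" if bE: "bad E" for E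
  proof -
    have E: "E \<in> ?\<A>" using bE by (simp add: bad_def)
    obtain A where A: "A \<in> ?\<A>" "A \<subseteq> E" "\<bar>\<nu> A\<bar> > 1 + \<bar>\<nu> E\<bar>"
      using badD[OF bE, of "1 + \<bar>\<nu> E\<bar>"] by blast
    have EA: "E - A \<in> ?\<A>" using A E by auto
    have diff: "\<nu> (E - A) = \<nu> E - \<nu> A" by (rule signed_Diff[OF A(1) E A(2)])
    have dd: "E - (E - A) = A" using A by auto
    show ?thesis
    proof (cases "bad A")
      case True
      then show ?thesis using A diff by (intro exI[of _ A]) auto
    next
      case False
      then obtain K1 where K1: "\<And>B. B \<in> ?\<A> \<Longrightarrow> B \<subseteq> A \<Longrightarrow> \<bar>\<nu> B\<bar> \<le> K1"
        using A unfolding bad_def by (meson not_le)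
      have "bad (E - A)"
        unfolding bad_def
      proof (intro conjI EA allI)
        fix K
        obtain B where B: "B \<in> ?\<A>" "B \<subseteq> E" "\<bar>\<nu> B\<bar> > K + K1"
          using badD[OF bE, of "K + K1"] by blast
        have "B - B \<inter> A = B - A" by auto
        then have "\<nu> (B - A) = \<nu> B - \<nu> (B \<inter> A)"
          using signed_Diff[of "B \<inter> A" B] A B by auto
        moreover have "\<bar>\<nu> (B \<inter> A)\<bar> \<le> K1" using A B by (intro K1) auto
        ultimately have "\<bar>\<nu> (B - A)\<bar> > K" using B by linarith
        then show "\<exists>C\<in>?\<A>. C \<subseteq> E - A \<and> K < \<bar>\<nu> C\<bar>"
          using A B by (intro bexI[of _ "B - A"]) auto
      qed
      then show ?thesis using A dd by (intro exI[of _ "E - A"]) auto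
    qed
  qed
  then obtain g where g: "\<And>E. bad E \<Longrightarrow> bad (g E) \<and> g E \<subseteq> E \<and> \<bar>\<nu> (E - g E)\<bar> \<ge> 1"
    by metis
  define E where "E n = (g ^^ n) S" for n
  have E1: "bad (E n)" for n
    by (induction n) (use \<open>bad S\<close> g in \<open>auto simp: E_def\<close>)
  have E2: "E (Suc n) \<subseteq> E n \<and> \<bar>\<nu> (E n - E (Suc n))\<bar> \<ge> 1" for n
    using g[OF E1[of n]] by (simp add: E_def)
  have mono: "E n \<subseteq> E m" if "m \<le> n" for m n
    using lift_Suc_antimono_le[of E, OF _ that] E2 by blast
  \<comment> \<open>The pieces split off are disjoint and have values of modulus at least 1, so
    their series cannot converge.\<close>
  define D where "D n = E n - E (Suc n)" for n
  have "disjoint_family D"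
    unfolding disjoint_family_on_def
  proof (intro ballI impI)
    fix m n :: nat assume "m \<noteq> n"
    then have "Suc m \<le> n \<or> Suc n \<le> m" by linarith
    then show "D m \<inter> D n = {}" using mono[of "Suc m" n] mono[of "Suc n" m] by (auto simp: D_def)
  qed
  moreover have "range D \<subseteq> ?\<A>" using E1 by (auto simp: D_def bad_def)
  ultimately have "(\<lambda>i. \<nu> (D i)) sums \<nu> (\<Union>i. D i)" by (intro signed_sums)
  then have "(\<lambda>i. \<nu> (D i)) \<longlonglongrightarrow> 0" by (simp add: sums_iff summable_LIMSEQ_zero)
  then obtain N where "\<bar>\<nu> (D N)\<bar> < 1"
    using LIMSEQ_D[of "\<lambda>i. \<nu> (D i)" 0 1] by auto
  then show False using E2[of N] by (simp add: D_def)
qed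

text \<open>\<open>measure_of\<close> yields either the prescribed supremum or the value 0, and both
  obey the bound from \<open>signed_bounded\<close>.\<close>

lemma emeasure_pos_variation_bounded:
  "\<exists>K. \<forall>X. emeasure (pos_variation S \<nu>) X \<le> ennreal K"
proof -
  obtain K where K: "\<And>A. A \<in> sets (restrict_space borel S) \<Longrightarrow> \<bar>\<nu> A\<bar> \<le> K"
    using signed_bounded by blast
  have "emeasure (pos_variation S \<nu>) X \<le> ennreal K" for X
    unfolding pos_variation_def emeasure_measure_of_conv
    by (auto intro!: SUP_least ennreal_leI dest: K)
  then show ?thesis by blast
qed

lemma integral_pos_variation_bounded:
  obtains K where "K \<ge> 0" "\<And>(f :: real \<Rightarrow> real) c. (\<And>r. \<bar>f r\<bar> \<le> c) \<Longrightarrow> \<bar>LINT r|pos_variation S \<nu>. f r\<bar> \<le> c * K"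
proof -
  obtain K where K: "\<And>X. emeasure (pos_variation S \<nu>) X \<le> ennreal K"
    using emeasure_pos_variation_bounded by blast
  let ?P = "pos_variation S \<nu>"
  interpret finite_measure ?P
    using K[of "space ?P"] by (intro finite_measureI) (auto simp: top_unique)
  have "measure ?P (space ?P) \<le> max 0 K"
    using K[of "space ?P"] by (auto simp: measure_def intro!: enn2real_leI elim: order_trans intro: ennreal_leI)
  moreover have "\<bar>LINT r|?P. f r\<bar> \<le> c * measure ?P (space ?P)" if f: "\<And>r. \<bar>f r\<bar> \<le> c" for f :: "real \<Rightarrow> real" and c
  proof (cases "integrable ?P f")
    case True
    have "norm (LINT r|?P. f r) \<le> (LINT r|?P. c)"
      by (rule Bochner_Integration.integral_norm_bound_integral[OF True]) (auto simp: f)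
    then show ?thesis by (simp add: mult.commute)
  next
    \<comment> \<open>A function that is not integrable has integral 0 by convention, and
      \<open>c\<close> is nonnegative because it bounds \<open>\<bar>f 0\<bar>\<close>.\<close>
    case False
    then show ?thesis using f[of 0] by (simp add: not_integrable_integral_eq)
  qed
  ultimately show ?thesis
  proof (intro that[of "max 0 K"])
    fix f :: "real \<Rightarrow> real" and c assume f: "\<And>r. \<bar>f r\<bar> \<le> c"
    assume *: "measure ?P (space ?P) \<le> max 0 K"
      "\<And>(f :: real \<Rightarrow> real) c. (\<And>r. \<bar>f r\<bar> \<le> c) \<Longrightarrow> \<bar>LINT r|?P. f r\<bar> \<le> c * measure ?P (space ?P)"
    have "\<bar>LINT r|?P. f r\<bar> \<le> c * measure ?P (space ?P)" by (rule *(2)[OF f])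
    also have "\<dots> \<le> c * max 0 K" using *(1) f[of 0] by (intro mult_left_mono) auto
    finally show "\<bar>LINT r|?P. f r\<bar> \<le> c * max 0 K" .
  qed auto
qed

end

lemma finite_signed_measure_uminus:
  "finite_signed_measure_on S \<nu> \<Longrightarrow> finite_signed_measure_on S (\<lambda>E. - \<nu> E)"
  unfolding finite_signed_measure_on_def by (auto intro: sums_minus)

lemma signed_integral_bounded:
  assumes "finite_signed_measure_on S \<nu>"
  obtains K where "K \<ge> 0" "\<And>(f :: real \<Rightarrow> real) c. (\<And>r. \<bar>f r\<bar> \<le> c) \<Longrightarrow> \<bar>signed_integral S \<nu> f\<bar> \<le> c * K"
proof -
  obtain K1 where K1: "K1 \<ge> 0" "\<And>(f :: real \<Rightarrow> real) c. (\<And>r. \<bar>f r\<bar> \<le> c) \<Longrightarrow> \<bar>LINT r|pos_variation S \<nu>. f r\<bar> \<le> c * K1"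
    by (rule integral_pos_variation_bounded[OF assms]) blast
  obtain K2 where K2: "K2 \<ge> 0" "\<And>(f :: real \<Rightarrow> real) c. (\<And>r. \<bar>f r\<bar> \<le> c) \<Longrightarrow> \<bar>LINT r|pos_variation S (\<lambda>E. - \<nu> E). f r\<bar> \<le> c * K2"
    by (rule integral_pos_variation_bounded[OF finite_signed_measure_uminus[OF assms]]) blast
  show ?thesis
  proof (rule that[of "K1 + K2"])
    fix f :: "real \<Rightarrow> real" and c assume f: "\<And>r. \<bar>f r\<bar> \<le> c"
    show "\<bar>signed_integral S \<nu> f\<bar> \<le> c * (K1 + K2)"
      using K1(2)[of f c, OF f] K2(2)[of f c, OF f] unfolding signed_integral_def by (simp add: distrib_left)
  qed (use K1 K2 in simp)
qed

text \<open>The Hahn decomposition is explicit here: the supremum over subsets of \<open>E\<close>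
  is attained where the density is nonnegative, and equals the mass of its positive part, since
  \<open>ennreal\<close> truncates negative values. Being a measure already, the supremum passes
  unchanged through \<open>measure_of\<close>.\<close>

lemma pos_variation_density:
  assumes S: "S \<in> sets borel" and f: "set_integrable lborel S f"
    and \<nu>: "\<And>E. E \<in> sets (restrict_space borel S) \<Longrightarrow> \<nu> E = (LINT r:E|lborel. f r)"
  shows "pos_variation S \<nu> = density (restrict_space lborel S) (\<lambda>r. ennreal (f r))"
proof -
  let ?M = "density (restrict_space lborel S) (\<lambda>r. ennreal (f r))"
  let ?\<A> = "sets (restrict_space borel S)"
  let ?\<mu> = "\<lambda>E. SUP A\<in>{A \<in> ?\<A>. A \<subseteq> E}. ennreal (\<nu> A)"
  have A_iff: "A \<in> ?\<A> \<longleftrightarrow> A \<in> sets borel \<and> A \<subseteq> S" for A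
    using S by (auto simp: sets_restrict_space_iff)
  have setsM: "sets ?M = ?\<A>"
    by (simp add: sets_restrict_space)
  have [measurable]: "(\<lambda>x. indicator S x * f x) \<in> borel_measurable borel"
    using f by (simp add: set_integrable_def borel_measurable_integrable)
  have emM: "emeasure ?M E = (\<integral>\<^sup>+r. ennreal (indicator E r * f r) \<partial>lborel)" if E: "E \<in> ?\<A>" for E
  proof -
    have [measurable]: "f \<in> borel_measurable (restrict_space lborel S)"
      using f S by (auto simp: set_integrable_def borel_measurable_restrict_space_iff dest!: borel_measurable_integrable)
    have fm: "(\<lambda>r. ennreal (f r)) \<in> borel_measurable (restrict_space lborel S)" by measurable
    have "emeasure ?M E = (\<integral>\<^sup>+r. ennreal (f r) * indicator E r \<partial>restrict_space lborel S)"
      using E setsM by (intro emeasure_density fm) auto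
    also have "\<dots> = (\<integral>\<^sup>+r. ennreal (f r) * indicator E r * indicator S r \<partial>lborel)"
      using S by (subst nn_integral_restrict_space) auto
    also have "\<dots> = (\<integral>\<^sup>+r. ennreal (indicator E r * f r) \<partial>lborel)"
      using E by (intro nn_integral_cong) (auto simp: A_iff indicator_def)
    finally show ?thesis .
  qed
  have int: "integrable lborel (\<lambda>r. indicator E r * f r)" if E: "E \<in> ?\<A>" for E
    using set_integrable_subset[OF f, of E] E by (simp add: set_integrable_def A_iff)
  have eq: "?\<mu> E = emeasure ?M E" if E: "E \<in> ?\<A>" for E
  proof (rule antisym)
    show "?\<mu> E \<le> emeasure ?M E"
    proof (rule SUP_least)
      fix A assume A: "A \<in> {A \<in> ?\<A>. A \<subseteq> E}"
      have "ennreal (\<nu> A) = ennreal (LINT r|lborel. indicator A r * f r)"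
        using A \<nu> by (simp add: set_lebesgue_integral_def)
      also have "\<dots> \<le> ennreal (LINT r|lborel. max 0 (indicator A r * f r))"
        using A int by (intro ennreal_leI integral_mono) auto
      also have "\<dots> = (\<integral>\<^sup>+r. ennreal (max 0 (indicator A r * f r)) \<partial>lborel)"
        using A int by (intro nn_integral_eq_integral[symmetric]) auto
      also have "\<dots> = emeasure ?M A"
        using A by (simp add: emM ennreal_max_0)
      also have "\<dots> \<le> emeasure ?M E"
        using A E setsM by (intro emeasure_mono) auto
      finally show "ennreal (\<nu> A) \<le> emeasure ?M E" .
    qed
    \<comment> \<open>The maximiser of the supremum. The condition is written with
      \<open>indicator S r * f r\<close> because only this product is known to be measurable on the
      whole line.\<close>
    let ?A = "E \<inter> {r \<in> space lborel. 0 \<le> indicator S r * f r}"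
    have "{r \<in> space lborel. 0 \<le> indicator S r * f r} \<in> sets lborel" by measurable
    then have A: "?A \<in> {A \<in> ?\<A>. A \<subseteq> E}" using E by (auto simp: A_iff)
    have "emeasure ?M E = (\<integral>\<^sup>+r. ennreal (indicator ?A r * f r) \<partial>lborel)"
      using E by (subst emM) (auto simp: A_iff indicator_def ennreal_neg intro!: nn_integral_cong)
    also have "\<dots> = ennreal (LINT r|lborel. indicator ?A r * f r)"
    proof (rule nn_integral_eq_integral)
      show "integrable lborel (\<lambda>r. indicator ?A r * f r)" using A by (intro int) blast
    qed (use E in \<open>auto simp: A_iff indicator_def\<close>)
    also have "\<dots> = ennreal (\<nu> ?A)" using A \<nu>[of ?A] by (simp add: set_lebesgue_integral_def)
    also have "\<dots> \<le> ?\<mu> E" by (rule SUP_upper[OF A])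
    finally show "emeasure ?M E \<le> ?\<mu> E" .
  qed
  have ms: "measure_space S ?\<A> ?\<mu>"
    unfolding measure_space_def
  proof (intro conjI)
    show "sigma_algebra S ?\<A>"
      using sets.sigma_algebra_axioms[of "restrict_space borel S"] by (simp add: space_restrict_space)
    show "positive ?\<A> ?\<mu>" unfolding positive_def using eq[OF sets.empty_sets] by simp
    show "countably_additive ?\<A> ?\<mu>"
    proof (rule countably_additiveI)
      fix A :: "nat \<Rightarrow> real set" assume A: "range A \<subseteq> ?\<A>" "disjoint_family A" "(\<Union>i. A i) \<in> ?\<A>"
      then show "(\<Sum>i. ?\<mu> (A i)) = ?\<mu> (\<Union>i. A i)"
        using suminf_emeasure[of A ?M] setsM by (auto simp: eq image_subset_iff)
    qed
  qed
  have sub: "?\<A> \<subseteq> Pow S" by (auto simp: A_iff)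
  have sig: "sigma_sets S ?\<A> = ?\<A>"
      by (rule sigma_algebra.sigma_sets_eq) (use ms in \<open>simp add: measure_space_def\<close>)
  show ?thesis
  proof (rule measure_eqI)
    have sA: "sets (pos_variation S \<nu>) = ?\<A>"
      unfolding pos_variation_def by (simp add: sub sig)
    then show "sets (pos_variation S \<nu>) = sets ?M" using setsM by simp
    fix E assume "E \<in> sets (pos_variation S \<nu>)"
    then have E: "E \<in> ?\<A>" using sA by simp
    have "emeasure (pos_variation S \<nu>) E = ?\<mu> E"
      unfolding pos_variation_def using ms E by (simp add: emeasure_measure_of_conv sig)
    then show "emeasure (pos_variation S \<nu>) E = emeasure ?M E" using eq[OF E] by simp
  qed
qed

text \<open>\<open>pos_variation_density\<close> for \<open>f\<close> and for \<open>- f\<close>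
  identifies both parts of the Jordan decomposition; their difference recombines to
  \<open>f\<close>.\<close>

lemma signed_integral_density:
  assumes S: "S \<in> sets borel" and f: "set_integrable lborel S f"
    and \<nu>: "\<And>E. E \<in> sets (restrict_space borel S) \<Longrightarrow> \<nu> E = (LINT r:E|lborel. f r)"
    and g [measurable]: "g \<in> borel_measurable borel" and bd: "\<And>r. \<bar>g r\<bar> \<le> c"
  shows "signed_integral S \<nu> g = (LINT r:S|lborel. f r * g r)"
proof -
  have fm: "f \<in> borel_measurable (restrict_space lborel S)"
    using f S by (auto simp: set_integrable_def borel_measurable_restrict_space_iff dest!: borel_measurable_integrable)
  have gm: "g \<in> borel_measurable (restrict_space lborel S)"
    by (rule measurable_restrict_space1) simp
  have pos: "(LINT r|density (restrict_space lborel S) (\<lambda>r. ennreal (h r)). g r) = (LINT r:S|lborel. max 0 (h r) * g r)"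
    if h: "h \<in> borel_measurable (restrict_space lborel S)" for h
  proof -
    have "density (restrict_space lborel S) (\<lambda>r. ennreal (h r)) = density (restrict_space lborel S) (\<lambda>r. ennreal (max 0 (h r)))"
      by (simp add: ennreal_max_0)
    then have "(LINT r|density (restrict_space lborel S) (\<lambda>r. ennreal (h r)). g r)
      = (LINT r|restrict_space lborel S. max 0 (h r) * g r)"
      using integral_real_density[of "\<lambda>r. max 0 (h r)" "restrict_space lborel S" g] h gm by (simp only:) simp
    also have "\<dots> = (LINT r:S|lborel. max 0 (h r) * g r)"
      using S by (simp add: integral_restrict_space set_lebesgue_integral_def)
    finally show ?thesis .
  qed
  have neg: "set_integrable lborel S (\<lambda>r. - f r)"
    "\<And>E. E \<in> sets (restrict_space borel S) \<Longrightarrow> - \<nu> E = (LINT r:E|lborel. - f r)"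
    using f \<nu> by (auto simp: set_integrable_def set_lebesgue_integral_def)
  have int: "set_integrable lborel S (\<lambda>r. max 0 (h r) * g r)" if h: "set_integrable lborel S h" for h
    unfolding set_integrable_def
  proof (rule Bochner_Integration.integrable_bound)
    show "integrable lborel (\<lambda>r. c * (indicator S r *\<^sub>R h r))"
      using h by (simp add: set_integrable_def)
    have [measurable]: "(\<lambda>r. indicator S r *\<^sub>R h r) \<in> borel_measurable borel"
      using h by (simp add: set_integrable_def borel_measurable_integrable)
    have "(\<lambda>r. max 0 (indicator S r *\<^sub>R h r) * g r) \<in> borel_measurable lborel" by measurable
    also have "(\<lambda>r. max 0 (indicator S r *\<^sub>R h r) * g r) = (\<lambda>r. indicator S r *\<^sub>R (max 0 (h r) * g r))"
      by (auto simp: indicator_def)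
    finally show "(\<lambda>r. indicator S r *\<^sub>R (max 0 (h r) * g r)) \<in> borel_measurable lborel" .
    show "AE r in lborel. norm (indicator S r *\<^sub>R (max 0 (h r) * g r)) \<le> norm (c * (indicator S r *\<^sub>R h r))"
    proof (rule AE_I2)
      fix r
      have "\<bar>max 0 (h r)\<bar> * \<bar>g r\<bar> \<le> \<bar>h r\<bar> * \<bar>c\<bar>"
        using bd[of r] by (intro mult_mono) auto
      then show "norm (indicator S r *\<^sub>R (max 0 (h r) * g r)) \<le> norm (c * (indicator S r *\<^sub>R h r))"
        by (auto simp: indicator_def abs_mult mult.commute)
    qed
  qed
  have P1: "pos_variation S \<nu> = density (restrict_space lborel S) (\<lambda>r. ennreal (f r))"
    by (rule pos_variation_density[OF S f \<nu>])
  have P2: "pos_variation S (\<lambda>E. - \<nu> E) = density (restrict_space lborel S) (\<lambda>r. ennreal (- f r))"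
    by (rule pos_variation_density[OF S neg])
  have "signed_integral S \<nu> g = (LINT r:S|lborel. max 0 (f r) * g r) - (LINT r:S|lborel. max 0 (- f r) * g r)"
    unfolding signed_integral_def P1 P2 using fm by (simp add: pos)
  also have "\<dots> = (LINT r:S|lborel. max 0 (f r) * g r - max 0 (- f r) * g r)"
    using int[OF f] int[OF neg(1)] by (simp add: set_integral_diff)
  also have "\<dots> = (LINT r:S|lborel. f r * g r)"
    unfolding set_lebesgue_integral_def
    by (intro Bochner_Integration.integral_cong) (auto simp: max_def)
  finally show ?thesis .
qed

section \<open>The semigroup and its adjoint\<close>

lemma L2_fun_measurable [measurable]: "L2_fun u \<in> borel_measurable borel"
  using sq_integrable_L2_fun[of u] by (simp add: sq_integrable_def)

lemma L2_class_inner: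
  assumes "sq_integrable f" "sq_integrable g"
  shows "L2_class f \<bullet> L2_class g = (LINT s|lborel. f s \<bullet> g s)"
  unfolding L2_class_def by (rule inner_L2.abs_eq) (use assms in \<open>simp_all add: ae_eq_def\<close>)

lemma L2_class_inner_left:
  "sq_integrable f \<Longrightarrow> L2_class f \<bullet> v = (LINT s|lborel. f s \<bullet> L2_fun v s)"
  using L2_class_inner[OF _ sq_integrable_L2_fun, of f v] by (simp add: L2_class_fun)

lemma L2_class_eqI:
  "sq_integrable f \<Longrightarrow> sq_integrable g \<Longrightarrow> (AE s in lborel. f s = g s) \<Longrightarrow> L2_class f = L2_class g"
  using Quotient_rel_abs[OF Quotient_L2, of f g] by (simp add: L2_class_def ae_eq_def)

lemma L2_class_add:
  "sq_integrable f \<Longrightarrow> sq_integrable g \<Longrightarrow> L2_class f + L2_class g = L2_class (\<lambda>s. f s + g s)"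
  unfolding L2_class_def by (rule plus_L2.abs_eq) (simp_all add: ae_eq_def)

lemma L2_class_scaleR: "sq_integrable f \<Longrightarrow> c *\<^sub>R L2_class f = L2_class (\<lambda>s. c *\<^sub>R f s)"
  unfolding L2_class_def by (rule scaleR_L2.abs_eq) (simp add: ae_eq_def)

lemma L2_class_zero: "L2_class (\<lambda>_. 0) = 0"
  by (simp add: L2_class_def zero_L2.abs_eq)

lemma L2_fun_zero: "AE s in lborel. L2_fun 0 s = 0"
  using L2_fun_class[OF sq_integrable_0] by (simp add: L2_class_zero)

lemma L2_fun_add: "AE s in lborel. L2_fun (u + v) s = L2_fun u s + L2_fun v s"
  using L2_fun_class[OF sq_integrable_add[OF sq_integrable_L2_fun sq_integrable_L2_fun], of u v]
  by (simp add: L2_class_add[symmetric] sq_integrable_L2_fun L2_class_fun)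

lemma L2_fun_scaleR: "AE s in lborel. L2_fun (c *\<^sub>R u) s = c *\<^sub>R L2_fun u s"
  using L2_fun_class[OF sq_integrable_scaleR[OF sq_integrable_L2_fun], of c u]
  by (simp add: L2_class_scaleR[symmetric] sq_integrable_L2_fun L2_class_fun)

lemma sq_integrable_indicator:
  assumes "sq_integrable f" "A \<in> sets borel"
  shows "sq_integrable (\<lambda>s. indicat_real A s *\<^sub>R f s)"
proof -
  have "integrable lborel (\<lambda>s. indicat_real A s *\<^sub>R (norm (f s))\<^sup>2)"
    by (rule integrable_mult_indicator) (use assms in \<open>auto simp: sq_integrable_def\<close>)
  moreover have "(norm (indicat_real A s *\<^sub>R f s))\<^sup>2 = indicat_real A s *\<^sub>R (norm (f s))\<^sup>2" for s
    by (auto simp: indicator_def)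
  ultimately show ?thesis
    using assms by (auto simp: sq_integrable_def)
qed

lemma sq_integrable_shift:
  assumes "sq_integrable f"
  shows "sq_integrable (\<lambda>s. f (c + s))"
  using assms lborel_integrable_real_affine[of "\<lambda>s. (norm (f s))\<^sup>2" 1 c]
  by (auto simp: sq_integrable_def)

lemma sq_integrable_continuous:
  fixes f :: "real \<Rightarrow> 'a::euclidean_space"
  assumes "continuous_on {a..b} f"
  shows "sq_integrable (\<lambda>s. indicat_real {a..b} s *\<^sub>R f s)"
  unfolding sq_integrable_def
proof
  show "(\<lambda>s. indicat_real {a..b} s *\<^sub>R f s) \<in> borel_measurable lborel"
    using borel_measurable_continuous_on_indicator[OF _ assms] by simp
  have "integrable lborel (\<lambda>s. indicat_real {a..b} s *\<^sub>R (norm (f s))\<^sup>2)"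
    by (rule borel_integrable_compact) (auto intro!: continuous_intros assms)
  moreover have "(norm (indicat_real {a..b} s *\<^sub>R f s))\<^sup>2 = indicat_real {a..b} s *\<^sub>R (norm (f s))\<^sup>2" for s
    by (auto simp: indicator_def)
  ultimately show "integrable lborel (\<lambda>s. (norm (indicat_real {a..b} s *\<^sub>R f s))\<^sup>2)" by simp
qed

lemma subspace_Hsp: "subspace (Hsp d)"
proof (rule subspaceI)
  show "0 \<in> Hsp d" using L2_fun_zero by (auto simp: Hsp_def elim: eventually_mono)
  fix x y :: "(real^'a) \<times> (real^'a) L2" and c :: real
  assume x: "x \<in> Hsp d"
  then have ax: "AE s in lborel. s \<notin> {-d..0} \<longrightarrow> L2_fun (snd x) s = 0" by (simp add: Hsp_def)
  have "AE s in lborel. s \<notin> {-d..0} \<longrightarrow> L2_fun (c *\<^sub>R snd x) s = 0"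
    using ax L2_fun_scaleR[of c "snd x"] by eventually_elim auto
  then show "c *\<^sub>R x \<in> Hsp d" by (simp add: Hsp_def)
  assume "y \<in> Hsp d"
  then have "AE s in lborel. s \<notin> {-d..0} \<longrightarrow> L2_fun (snd y) s = 0" by (simp add: Hsp_def)
  then have "AE s in lborel. s \<notin> {-d..0} \<longrightarrow> L2_fun (snd x + snd y) s = 0"
    using ax L2_fun_add[of "snd x" "snd y"] by eventually_elim auto
  then show "x + y \<in> Hsp d" by (simp add: Hsp_def)
qed

lemma Hsp_first: "(v, 0) \<in> Hsp d"
  using L2_fun_zero by (auto simp: Hsp_def elim: eventually_mono)

lemma Hsp_L2_class:
  assumes "sq_integrable f" "\<And>s. s \<notin> {-d..0} \<Longrightarrow> f s = 0"
  shows "(v, L2_class f) \<in> Hsp d"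
  using L2_fun_class[OF assms(1)] assms(2) by (auto simp: Hsp_def elim: eventually_mono)

context
  fixes d :: real and a0 :: "real^'n^'n"
begin

definition adj_kernel :: "real \<Rightarrow> real^'n \<Rightarrow> real \<Rightarrow> real^'n" where
  "adj_kernel t y s = indicat_real {-d..0} s *\<^sub>R (indicat_real {-t..0} s *\<^sub>R (mexp ((t + s) *\<^sub>R transpose a0) *v y))"

lemma continuous_on_mexp_shift: "continuous_on S (\<lambda>s. mexp ((t + s) *\<^sub>R a))"
  by (rule continuous_on_compose2[OF continuous_on_mexp[of UNIV]]) (auto intro!: continuous_intros)

lemma sq_integrable_adj_kernel: "sq_integrable (adj_kernel t y)"
proof -
  have "adj_kernel t y = (\<lambda>s. indicat_real {max (-d) (-t)..0} s *\<^sub>R (mexp ((t + s) *\<^sub>R transpose a0) *v y))"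
    by (auto simp: adj_kernel_def indicator_def)
  then show ?thesis
    by (simp add: sq_integrable_continuous continuous_on_matrix_vector_mult continuous_on_mexp_shift)
qed

text \<open>The adjoint of \<open>x \<mapsto> fst (sgA d a0 t x)\<close> at \<open>y\<close>, as
  \<open>fst_sgA_inner\<close> confirms; its second component is the kernel of the delay integral
  with the matrix transposed.\<close>

definition adj0 :: "real \<Rightarrow> real^'n \<Rightarrow> (real^'n) \<times> (real^'n) L2" where
  "adj0 t y = (mexp (t *\<^sub>R transpose a0) *v y, L2_class (adj_kernel t y))"

lemma adj0_in_Hsp: "adj0 t y \<in> Hsp d"
  unfolding adj0_def by (rule Hsp_L2_class[OF sq_integrable_adj_kernel]) (simp add: adj_kernel_def)

abbreviation delay_integrand :: "real \<Rightarrow> (real^'n) L2 \<Rightarrow> real \<Rightarrow> real^'n" where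
  "delay_integrand t u s \<equiv> indicat_real {-d..0} s *\<^sub>R (indicat_real {-t..0} s *\<^sub>R (mexp ((t + s) *\<^sub>R a0) *v L2_fun u s))"

lemma delay_integrand_measurable [measurable]: "delay_integrand t u \<in> borel_measurable borel"
proof -
  have [measurable]: "(\<lambda>s. mexp ((t + s) *\<^sub>R a0)) \<in> borel_measurable borel"
    by (rule borel_measurable_continuous_onI) (rule continuous_on_mexp_shift)
  have "(\<lambda>s. mexp ((t + s) *\<^sub>R a0) *v L2_fun u s) \<in> borel_measurable borel"
    by (rule borel_measurable_continuous_Pair) (auto intro!: continuous_intros)
  then show ?thesis by measurable
qed

text \<open>The norm of a square integrable function is replaced by 1 plus its square, which is
  integrable over the bounded interval. The bound increases with \<open>t\<close>, so one integrable
  function dominates on a bounded time interval.\<close>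

lemma norm_delay_integrand_le:
  assumes "0 \<le> t"
  shows "norm (delay_integrand t u s) \<le> exp (t * norm (of_mat a0)) * (indicat_real {-d..0} s + (norm (L2_fun u s))\<^sup>2)"
proof (cases "s \<in> {-d..0} \<and> s \<in> {-t..0}")
  case True
  have "norm (mexp ((t + s) *\<^sub>R a0) *v L2_fun u s) \<le> exp (\<bar>t + s\<bar> * norm (of_mat a0)) * norm (L2_fun u s)"
    by (rule norm_mexp_mult_vec_le)
  also have "\<dots> \<le> exp (t * norm (of_mat a0)) * norm (L2_fun u s)"
    using True by (intro mult_right_mono) (auto intro!: mult_right_mono)
  also have "\<dots> \<le> exp (t * norm (of_mat a0)) * (1 + (norm (L2_fun u s))\<^sup>2)"
  proof (rule mult_left_mono)
    have "2 * norm (L2_fun u s) \<le> 1 + (norm (L2_fun u s))\<^sup>2"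
      using sum_squares_bound[of 1 "norm (L2_fun u s)"] by simp
    then show "norm (L2_fun u s) \<le> 1 + (norm (L2_fun u s))\<^sup>2"
      using norm_ge_zero[of "L2_fun u s"] by linarith
  qed simp
  finally show ?thesis using True by simp
next
  case False
  then show ?thesis by (auto simp: indicator_def)
qed

lemma integrable_delay_bound: "integrable lborel (\<lambda>s. c * (indicat_real {-d..0} s + (norm (L2_fun u s))\<^sup>2))"
  using sq_integrable_L2_fun[of u] by (intro integrable_mult_right Bochner_Integration.integrable_add)
    (auto simp: sq_integrable_def emeasure_lborel_Icc_eq intro!: integrable_real_indicator)

lemma integrable_delay_integrand:
  assumes "0 \<le> t"
  shows "integrable lborel (delay_integrand t u)"
proof (rule Bochner_Integration.integrable_bound[OF integrable_delay_bound[of "exp (t * norm (of_mat a0))" u]])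
  show "delay_integrand t u \<in> borel_measurable lborel"
    by (simp only: measurable_lborel2 delay_integrand_measurable)
  show "AE s in lborel. norm (delay_integrand t u s)
      \<le> norm (exp (t * norm (of_mat a0)) * (indicat_real {- d..0} s + (norm (L2_fun u s))\<^sup>2))"
    by (intro AE_I2 order_trans[OF norm_delay_integrand_le[OF assms]]) simp
qed

lemma fst_sgA: "fst (sgA d a0 t x) = mexp (t *\<^sub>R a0) *v fst x + (LINT s|lborel. delay_integrand t (snd x) s)"
  by (simp add: sgA_def set_lebesgue_integral_def)

lemma mexp_inner: "(mexp (r *\<^sub>R a0) *v u) \<bullet> y = (mexp (r *\<^sub>R transpose a0) *v y) \<bullet> u"
  using inner_vector_matrix[of "mexp (r *\<^sub>R a0)" u y]
  by (simp add: transpose_mexp transpose_scalar inner_commute)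

text \<open>Through this duality, linearity and boundedness of the first component, as well as the
  gradient in \<open>Hsp d\<close>, are obtained from \<open>adj0\<close>.\<close>

lemma fst_sgA_inner:
  assumes "0 \<le> t"
  shows "fst (sgA d a0 t x) \<bullet> y = x \<bullet> adj0 t y"
proof -
  have "(LINT s|lborel. delay_integrand t (snd x) s) \<bullet> y = (LINT s|lborel. delay_integrand t (snd x) s \<bullet> y)"
    by (rule integral_inner_left[symmetric]) (rule integrable_delay_integrand[OF assms])
  also have "\<dots> = (LINT s|lborel. adj_kernel t y s \<bullet> L2_fun (snd x) s)"
    by (intro Bochner_Integration.integral_cong refl)
      (simp add: adj_kernel_def mexp_inner)
  also have "\<dots> = snd x \<bullet> L2_class (adj_kernel t y)"
    by (metis L2_class_inner_left sq_integrable_adj_kernel inner_commute)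
  moreover have "(mexp (t *\<^sub>R a0) *v fst x) \<bullet> y = fst x \<bullet> (mexp (t *\<^sub>R transpose a0) *v y)"
    by (metis mexp_inner inner_commute)
  ultimately show ?thesis
    by (simp add: fst_sgA adj0_def inner_add_left inner_prod_def)
qed

text \<open>The adjoint of the truncated translation in the second component: a translation in the
  opposite direction after cutting off.\<close>

definition shift_adj :: "real \<Rightarrow> (real^'n) L2 \<Rightarrow> real \<Rightarrow> real^'n" where
  "shift_adj t u s = indicat_real {-d+t..0} (s + t) *\<^sub>R L2_fun u (s + t)"

lemma sq_integrable_shift_adj: "sq_integrable (shift_adj t u)"
  using sq_integrable_shift[OF sq_integrable_indicator[OF sq_integrable_L2_fun, of "{-d+t..0}" u], of t]
  by (simp add: shift_adj_def[abs_def] add.commute)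

lemma sq_integrable_snd_sgA: "sq_integrable (\<lambda>s. indicat_real {-d+t..0} s *\<^sub>R L2_fun u (s - t))"
  using sq_integrable_indicator[OF sq_integrable_shift[OF sq_integrable_L2_fun[of u], of "- t"], of "{-d+t..0}"]
  by simp

text \<open>The adjoint is fixed by its defining identity. The second component follows from the
  substitution \<open>s \<mapsto> t + s\<close>, the first from
  \<open>fst_sgA_inner\<close>.\<close>

lemma adjoint_sgA:
  assumes "0 \<le> t"
  shows "adjoint (sgA d a0 t) = (\<lambda>h. adj0 t (fst h) + (0, L2_class (shift_adj t (snd h))))"
proof (rule adjoint_unique, intro allI)
  fix x h :: "(real^'n) \<times> (real^'n) L2"
  have "snd (sgA d a0 t x) \<bullet> snd h = (LINT s|lborel. indicat_real {-d+t..0} s *\<^sub>R L2_fun (snd x) (s - t) \<bullet> L2_fun (snd h) s)"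
    by (simp only: sgA_def snd_conv L2_class_inner_left[OF sq_integrable_snd_sgA])
  also have "\<dots> = (LINT s|lborel. indicat_real {-d+t..0} (t + 1 * s) *\<^sub>R L2_fun (snd x) (t + 1 * s - t) \<bullet> L2_fun (snd h) (t + 1 * s))"
    by (subst lborel_integral_real_affine[of 1 _ t]) simp_all
  also have "\<dots> = (LINT s|lborel. shift_adj t (snd h) s \<bullet> L2_fun (snd x) s)"
    by (intro Bochner_Integration.integral_cong refl) (simp add: shift_adj_def add.commute inner_commute)
  also have "\<dots> = snd x \<bullet> L2_class (shift_adj t (snd h))"
    by (metis L2_class_inner_left sq_integrable_shift_adj inner_commute)
  finally have 2: "snd (sgA d a0 t x) \<bullet> snd h = snd x \<bullet> L2_class (shift_adj t (snd h))" .
  show "sgA d a0 t x \<bullet> h = x \<bullet> (adj0 t (fst h) + (0, L2_class (shift_adj t (snd h))))"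
    using 2 fst_sgA_inner[OF assms, of x "fst h"]
    by (simp add: inner_add_right inner_prod_def[of "sgA d a0 t x"] inner_prod_def[of x "(0, _)"])
qed

text \<open>The representative \<open>L2_fun 0\<close> is known to vanish only almost everywhere, so
  both components are computed up to null sets.\<close>

lemma sgA_first: "sgA d a0 t (v, 0) = (mexp (t *\<^sub>R a0) *v v, 0)"
proof -
  have "AE s in lborel. delay_integrand t 0 s = 0"
    using L2_fun_zero[where 'a="real^'n"] by eventually_elim simp
  then have 1: "(LINT s|lborel. delay_integrand t 0 s) = 0"
    by (rule integral_eq_zero_AE)
  have "AE s in lborel. L2_fun (0 :: (real^'n) L2) (- t + 1 * s) = 0"
    by (rule AE_borel_affine[OF _ _ L2_fun_zero]) auto
  then have "AE s in lborel. indicat_real {-d+t..0} s *\<^sub>R L2_fun (0 :: (real^'n) L2) (s - t) = 0"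
    by (auto elim: eventually_mono)
  from L2_class_eqI[OF sq_integrable_snd_sgA sq_integrable_0 this]
  have 2: "L2_class (\<lambda>s. indicat_real {-d+t..0} s *\<^sub>R L2_fun (0 :: (real^'n) L2) (s - t)) = 0"
    by (simp add: L2_class_zero)
  show ?thesis
    using 1 2 by (simp add: sgA_def set_lebesgue_integral_def)
qed

lemma adjoint_Gop: "adjoint (Gop \<sigma>) = (\<lambda>h. transpose \<sigma> *v fst h)"
  by (rule adjoint_unique) (simp add: Gop_def inner_prod_def inner_vector_matrix)

text \<open>The adjoint of \<open>Gop\<close> sees only the first component, and the semigroup keeps
  vectors \<open>(v, 0)\<close> in that form. The Hilbert space valued integral is thus the image of
  the one for \<open>Qt0\<close> under \<open>v \<mapsto> (v, 0)\<close>.\<close>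

lemma Qt_eq: "Qt d a0 \<sigma> t h = (Qt0 a0 \<sigma> t *v fst h, 0)"
proof -
  have lin: "bounded_linear (\<lambda>v :: real^'n. (v, 0 :: (real^'n) L2))"
    by (rule bounded_linear_Pair[OF bounded_linear_ident bounded_linear_zero])
  have "((\<lambda>s. (mexp (s *\<^sub>R a0) *v (\<sigma> *v (transpose \<sigma> *v (mexp (s *\<^sub>R transpose a0) *v fst h))), 0 :: (real^'n) L2))
    has_integral (Qt0 a0 \<sigma> t *v fst h, 0)) {0..t}"
    using has_integral_linear[OF Qt0_vec_has_integral lin] by (simp add: o_def)
  then have "((\<lambda>s. sgA d a0 s (Gop \<sigma> (adjoint (Gop \<sigma>) (adjoint (sgA d a0 s) h))))
    has_integral (Qt0 a0 \<sigma> t *v fst h, 0)) {0..t}"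
    by (rule has_integral_eq[rotated]) (simp add: adjoint_sgA adjoint_Gop Gop_def adj0_def sgA_first)
  then show ?thesis unfolding Qt_def by (rule integral_unique)
qed

end

section \<open>Gaussian measures on the delay space\<close>

lemma matrix_vector_mult_measurable [measurable]: "(\<lambda>w. A *v w) \<in> borel_measurable borel"
  for A :: "real^'n^'m"
  by (rule borel_measurable_continuous_onI) (intro continuous_intros)

lemma is_centered_gaussian_std_gauss:
  fixes S :: "real^'n^'n"
  assumes "S ** transpose S = Q"
  shows "is_centered_gaussian_on UNIV (\<lambda>y. Q *v y) (distr std_gauss borel (\<lambda>w. S *v w))"
proof -
  have "distr (distr std_gauss borel (\<lambda>w. S *v w)) borel (\<lambda>z. h \<bullet> z) = normal_law ((Q *v h) \<bullet> h)" for h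
  proof -
    have "distr (distr std_gauss borel (\<lambda>w. S *v w)) borel (\<lambda>z. h \<bullet> z)
      = distr std_gauss borel ((\<lambda>z. h \<bullet> z) \<circ> (\<lambda>w. S *v w))"
      by (rule distr_distr) auto
    also have "\<dots> = distr std_gauss borel (\<lambda>w. (transpose S *v h) \<bullet> w)"
      by (simp only: o_def inner_matrix_vector[of h S])
    also have "\<dots> = normal_law ((norm (transpose S *v h))\<^sup>2)"
      by (rule distr_std_gauss_inner)
    also have "(norm (transpose S *v h))\<^sup>2 = (S *v (transpose S *v h)) \<bullet> h"
      by (simp add: power2_norm_eq_inner inner_vector_matrix[of S])
    also have "\<dots> = (Q *v h) \<bullet> h"
      by (simp add: assms matrix_vector_mul_assoc)
    finally show ?thesis .
  qed
  then show ?thesis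
    by (simp add: is_centered_gaussian_on_def prob_space.prob_space_distr[OF prob_space_std_gauss])
qed

lemma is_centered_gaussian_on_UNIV_unique:
  fixes Q :: "'a::euclidean_space \<Rightarrow> 'a"
  assumes "is_centered_gaussian_on UNIV Q \<mu>" "is_centered_gaussian_on UNIV Q \<nu>"
  shows "\<mu> = \<nu>"
proof (rule Cramer_Wold)
  show "distr \<mu> borel (\<lambda>z. h \<bullet> z) = distr \<nu> borel (\<lambda>z. h \<bullet> z)" for h
    using assms unfolding is_centered_gaussian_on_def by (metis UNIV_I)
qed (use assms in \<open>simp_all add: is_centered_gaussian_on_def\<close>)

text \<open>Resolves the definite description: the image of \<open>std_gauss\<close> exists as a
  candidate, and the Cramer-Wold theorem makes it the only one. Any factor \<open>S\<close> of the
  covariance may be used.\<close>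

lemma gaussian_on_UNIV_eq:
  fixes S :: "real^'n^'n"
  assumes "S ** transpose S = Q"
  shows "gaussian_on UNIV (\<lambda>y. Q *v y) = distr std_gauss borel (\<lambda>w. S *v w)"
  unfolding gaussian_on_def
  by (rule the_equality[where P="is_centered_gaussian_on UNIV (\<lambda>y. Q *v y)"])
    (use is_centered_gaussian_std_gauss[OF assms] is_centered_gaussian_on_UNIV_unique in blast)+

text \<open>Countably many of these functions detect whether an element of \<open>L\<^sup>2([-d,0])\<close> vanishes.\<close>

definition test_fun :: "real \<Rightarrow> real \<Rightarrow> 'n \<Rightarrow> real \<Rightarrow> real^'n" where
  "test_fun d q i s = indicat_real {-d..0} s *\<^sub>R (indicat_real {q<..} s *\<^sub>R axis i 1)"

lemma sq_integrable_test_fun: "sq_integrable (test_fun d q (i :: 'n::finite))"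
proof -
  have "sq_integrable (\<lambda>s. indicat_real {q<..} s *\<^sub>R (indicat_real {-d..0} s *\<^sub>R (axis i 1 :: real^'n)))"
    by (intro sq_integrable_indicator sq_integrable_continuous continuous_on_const) auto
  then show ?thesis by (simp add: test_fun_def[abs_def] mult.commute)
qed

lemma test_fun_in_Hsp: "(0, L2_class (test_fun d q i)) \<in> Hsp d"
  by (rule Hsp_L2_class[OF sq_integrable_test_fun]) (simp add: test_fun_def)

text \<open>A limit in the endpoint extends the hypothesis to all real rays. The positive and
  negative parts of \<open>f\<close> are then densities of finite measures agreeing on rays, hence
  equal, so the two densities agree almost everywhere.\<close>

lemma AE_zero_if_rational_rays_zero:
  fixes f :: "real \<Rightarrow> real"
  assumes f: "integrable lborel f" and q: "\<And>q. q \<in> \<rat> \<Longrightarrow> (LINT s|lborel. indicat_real {q<..} s * f s) = 0"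
  shows "AE s in lborel. f s = 0"
proof -
  have [measurable]: "f \<in> borel_measurable borel" using f by simp
  have int: "integrable lborel (\<lambda>s. indicat_real {x<..} s * g s)" if "integrable lborel g" for x and g :: "real \<Rightarrow> real"
    using integrable_mult_indicator[of "{x<..}" lborel g] that by simp
  have zero: "(LINT s|lborel. indicat_real {x<..} s * f s) = 0" for x
  proof -
    \<comment> \<open>Rational endpoints approach \<open>x\<close> from above, since then the open
      rays converge to \<open>{x<..}\<close> at every point, including \<open>x\<close>
      itself.\<close>
    have "\<exists>q\<in>\<rat>. x < q \<and> q < x + 1 / real (Suc k)" for k
      using Rats_dense_in_real[of x "x + 1 / real (Suc k)"] by simp
    then obtain q where q': "\<And>k. q k \<in> \<rat>" "\<And>k. x < q k" "\<And>k. q k < x + 1 / real (Suc k)"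
      by metis
    have "(\<lambda>k. x + 1 / real (Suc k)) \<longlonglongrightarrow> x + 0"
      by (intro tendsto_intros LIMSEQ_Suc[OF lim_1_over_n])
    then have qx: "q \<longlonglongrightarrow> x"
      by (intro tendsto_sandwich[of "\<lambda>_. x" q sequentially "\<lambda>k. x + 1 / real (Suc k)" x])
        (use q' in \<open>auto intro!: always_eventually less_imp_le\<close>)
    have "(\<lambda>k. LINT s|lborel. indicat_real {q k<..} s * f s) \<longlonglongrightarrow> (LINT s|lborel. indicat_real {x<..} s * f s)"
    proof (rule integral_dominated_convergence[where w="\<lambda>s. \<bar>f s\<bar>"])
      show "AE s in lborel. (\<lambda>k. indicat_real {q k<..} s * f s) \<longlonglongrightarrow> indicat_real {x<..} s * f s"
      proof (rule AE_I2)
        fix s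
        have "\<forall>\<^sub>F k in sequentially. indicat_real {q k<..} s * f s = indicat_real {x<..} s * f s"
        proof (cases "x < s")
          case True
          show ?thesis
            by (rule eventually_mono[OF order_tendstoD(2)[OF qx True]]) (use True in auto)
        next
          case False
          then have "s \<le> q k" for k using q'(2)[of k] by linarith
          then show ?thesis using False by (auto simp: not_less)
        qed
        then show "(\<lambda>k. indicat_real {q k<..} s * f s) \<longlonglongrightarrow> indicat_real {x<..} s * f s"
          by (rule tendsto_eventually)
      qed
    qed (use f in \<open>auto simp: indicator_def\<close>)
    moreover have "(\<lambda>k. LINT s|lborel. indicat_real {q k<..} s * f s) = (\<lambda>_. 0)"
      using q q'(1) by auto
    ultimately show ?thesis by (simp add: LIMSEQ_const_iff)
  qed
  let ?p = "\<lambda>s. max 0 (f s)" and ?m = "\<lambda>s. max 0 (- f s)"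
  have pm: "integrable lborel ?p" "integrable lborel ?m" using f by auto
  have em: "emeasure (density lborel (\<lambda>s. ennreal (g s))) {x<..} = ennreal (LINT s|lborel. indicat_real {x<..} s * g s)"
    if g: "integrable lborel g" "\<And>s. 0 \<le> g s" for g :: "real \<Rightarrow> real" and x
  proof -
    have [measurable]: "g \<in> borel_measurable borel" using g by simp
    have "emeasure (density lborel (\<lambda>s. ennreal (g s))) {x<..} = (\<integral>\<^sup>+s. ennreal (indicat_real {x<..} s * g s) \<partial>lborel)"
      by (subst emeasure_density) (auto simp: indicator_def intro!: nn_integral_cong)
    also have "\<dots> = ennreal (LINT s|lborel. indicat_real {x<..} s * g s)"
      by (rule nn_integral_eq_integral) (use g int in auto)
    finally show ?thesis .
  qed
  have "density lborel (\<lambda>s. ennreal (?p s)) = density lborel (\<lambda>s. ennreal (?m s))"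
  proof (rule measure_eqI_lessThan)
    fix x :: real
    have "(LINT s|lborel. indicat_real {x<..} s * ?p s) - (LINT s|lborel. indicat_real {x<..} s * ?m s)
      = (LINT s|lborel. indicat_real {x<..} s * ?p s - indicat_real {x<..} s * ?m s)"
      by (rule Bochner_Integration.integral_diff[symmetric]) (intro int pm)+
    also have "\<dots> = (LINT s|lborel. indicat_real {x<..} s * f s)"
      by (intro Bochner_Integration.integral_cong) (auto simp: max_def)
    also have "\<dots> = 0" by (rule zero)
    finally show "emeasure (density lborel (\<lambda>s. ennreal (?p s))) {x<..} = emeasure (density lborel (\<lambda>s. ennreal (?m s))) {x<..}"
      using em[OF pm(1)] em[OF pm(2)] by simp
    show "emeasure (density lborel (\<lambda>s. ennreal (?p s))) {x<..} < \<infinity>"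
      using em[OF pm(1)] by simp
  qed auto
  then have "AE s in lborel. ennreal (?p s) = ennreal (?m s)"
    by (subst (asm) sigma_finite_measure.density_unique_iff[OF sigma_finite_lborel]) auto
  then show ?thesis
    by eventually_elim (auto simp: max_def split: if_splits)
qed

text \<open>Pairing with \<open>test_fun d q i\<close> integrates the \<open>i\<close>-th coordinate
  over a ray within \<open>{-d..0}\<close>; outside this interval, membership in
  \<open>Hsp d\<close> gives the zero.\<close>

lemma Hsp_snd_zero:
  fixes z :: "(real^'n) \<times> (real^'n) L2"
  assumes z: "z \<in> Hsp d" and t: "\<And>q i. q \<in> \<rat> \<Longrightarrow> (0, L2_class (test_fun d q i)) \<bullet> z = 0"
  shows "snd z = 0"
proof -
  have ax: "AE s in lborel. L2_fun (snd z) s $ i = 0" for i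
  proof -
    define f where "f s = indicat_real {-d..0} s *\<^sub>R axis i 1 \<bullet> L2_fun (snd z) s" for s
    have "sq_integrable (\<lambda>s. indicat_real {-d..0} s *\<^sub>R (axis i 1 :: real^'n))"
      by (intro sq_integrable_continuous continuous_on_const)
    then have f: "integrable lborel f"
      unfolding f_def by (intro sq_integrable_inner sq_integrable_L2_fun)
    have "(LINT s|lborel. indicat_real {q<..} s * f s) = 0" if "q \<in> \<rat>" for q
    proof -
      have "(LINT s|lborel. indicat_real {q<..} s * f s) = L2_class (test_fun d q i) \<bullet> snd z"
        unfolding L2_class_inner_left[OF sq_integrable_test_fun]
        by (intro Bochner_Integration.integral_cong) (auto simp: f_def test_fun_def)
      also have "\<dots> = 0" using t[OF that, of i] by (simp add: inner_prod_def)
      finally show ?thesis .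
    qed
    from AE_zero_if_rational_rays_zero[OF f this]
    have "AE s in lborel. f s = 0" .
    moreover have "AE s in lborel. s \<notin> {-d..0} \<longrightarrow> L2_fun (snd z) s = 0"
      using z by (simp add: Hsp_def)
    ultimately show ?thesis
      by eventually_elim (auto simp: f_def indicator_def inner_axis' split: if_splits)
  qed
  then have "AE s in lborel. \<forall>i\<in>(UNIV :: 'n set). L2_fun (snd z) s $ i = 0"
    by (intro AE_finite_allI) auto
  then have "AE s in lborel. L2_fun (snd z) s = 0"
    by eventually_elim (simp add: vec_eq_iff)
  then have "L2_class (L2_fun (snd z)) = L2_class (\<lambda>_. 0)"
    by (intro L2_class_eqI sq_integrable_L2_fun sq_integrable_0)
  then show ?thesis by (simp add: L2_class_fun L2_class_zero)
qed

lemma is_centered_gaussian_on_Hsp: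
  fixes S :: "real^'n^'n"
  assumes "S ** transpose S = Q"
  shows "is_centered_gaussian_on (Hsp d) (\<lambda>h. (Q *v fst h, 0))
    (distr std_gauss (restrict_space borel (Hsp d)) (\<lambda>w. (S *v w, 0)))"
proof -
  let ?\<mu> = "distr std_gauss (restrict_space borel (Hsp d)) (\<lambda>w. (S *v w, 0 :: (real^'n) L2))"
  have "(\<lambda>w. (S *v w, 0 :: (real^'n) L2)) \<in> borel \<rightarrow>\<^sub>M borel"
    by (intro borel_measurable_continuous_onI continuous_intros)
  then have m: "(\<lambda>w. (S *v w, 0 :: (real^'n) L2)) \<in> std_gauss \<rightarrow>\<^sub>M restrict_space borel (Hsp d)"
    by (intro measurable_restrict_space2) (auto simp: Hsp_first)
  have law: "distr ?\<mu> borel (\<lambda>z. h \<bullet> z) = normal_law ((Q *v fst h, 0) \<bullet> h)" for h :: "(real^'n) \<times> (real^'n) L2"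
  proof -
    have hm: "(\<lambda>z. h \<bullet> z) \<in> restrict_space borel (Hsp d) \<rightarrow>\<^sub>M borel"
      by (intro measurable_restrict_space1 borel_measurable_continuous_onI continuous_intros)
    have "distr ?\<mu> borel (\<lambda>z. h \<bullet> z) = distr (distr std_gauss borel (\<lambda>w. S *v w)) borel (\<lambda>z. fst h \<bullet> z)"
      using hm m by (simp add: distr_distr o_def inner_prod_def)
    also have "\<dots> = normal_law ((Q *v fst h) \<bullet> fst h)"
      using is_centered_gaussian_std_gauss[OF assms] by (simp add: is_centered_gaussian_on_def)
    finally show ?thesis by (simp add: inner_prod_def)
  qed
  show ?thesis
    unfolding is_centered_gaussian_on_def
    using law prob_space.prob_space_distr[OF prob_space_std_gauss m] by simp
qed

text \<open>Each test functional of the second component is almost surely 0. Since they are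
  countably many, almost every \<open>z\<close> equals \<open>(fst z, 0)\<close>. The measure is
  therefore the image of its first marginal, which is Gaussian on R^n and hence unique.\<close>

lemma is_centered_gaussian_on_Hsp_unique:
  fixes S :: "real^'n^'n"
  assumes S: "S ** transpose S = Q" and \<mu>: "is_centered_gaussian_on (Hsp d) (\<lambda>h. (Q *v fst h, 0)) \<mu>"
  shows "\<mu> = distr std_gauss (restrict_space borel (Hsp d)) (\<lambda>w. (S *v w, 0))"
proof -
  interpret prob_space \<mu> using \<mu> by (simp add: is_centered_gaussian_on_def)
  have sets: "sets \<mu> = sets (restrict_space borel (Hsp d))"
    and law: "\<And>h. h \<in> Hsp d \<Longrightarrow> distr \<mu> borel (\<lambda>z. h \<bullet> z) = normal_law ((Q *v fst h, 0) \<bullet> h)"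
    using \<mu> by (auto simp: is_centered_gaussian_on_def)
  note [measurable_cong] = sets
  have space: "space \<mu> = Hsp d" using sets_eq_imp_space_eq[OF sets] by (simp add: space_restrict_space)
  have m: "f \<in> \<mu> \<rightarrow>\<^sub>M borel" if "continuous_on UNIV f"
    for f :: "(real^'n) \<times> (real^'n) L2 \<Rightarrow> 'b::topological_space"
    using that by (subst measurable_cong_sets[OF sets refl])
      (intro measurable_restrict_space1 borel_measurable_continuous_onI)
  have fstm: "fst \<in> \<mu> \<rightarrow>\<^sub>M borel" by (intro m continuous_intros)
  have pairm: "(\<lambda>v. (v, 0 :: (real^'n) L2)) \<in> borel \<rightarrow>\<^sub>M restrict_space borel (Hsp d)"
    by (intro measurable_restrict_space2 borel_measurable_continuous_onI continuous_intros) (auto simp: Hsp_first)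
  have "AE z in \<mu>. (0, L2_class (test_fun d q i)) \<bullet> z = 0" for q and i :: 'n
  proof -
    let ?h = "(0, L2_class (test_fun d q i)) :: (real^'n) \<times> (real^'n) L2"
    have hm: "(\<lambda>z. ?h \<bullet> z) \<in> \<mu> \<rightarrow>\<^sub>M borel" by (intro m continuous_intros)
    \<comment> \<open>The covariance operator has vanishing second component, so the variance is 0
      and \<open>normal_law\<close> is the Dirac mass.\<close>
    have eq: "distr \<mu> borel (\<lambda>z. ?h \<bullet> z) = return borel 0"
      using law[OF test_fun_in_Hsp] by (simp add: inner_prod_def normal_law_def)
    have "AE x in distr \<mu> borel (\<lambda>z. ?h \<bullet> z). x = 0"
      unfolding eq by (subst AE_return) auto
    then show ?thesis by (subst (asm) AE_distr_iff[OF hm]) auto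
  qed
  then have "AE z in \<mu>. \<forall>q\<in>\<rat>. \<forall>i\<in>(UNIV :: 'n set). (0, L2_class (test_fun d q i)) \<bullet> z = 0"
    by (intro AE_ball_countable[THEN iffD2] AE_finite_allI countable_rat ballI) auto
  then have snd0: "AE z in \<mu>. (fst z, 0) = z"
    using AE_space
  proof eventually_elim
    fix z assume "\<forall>q\<in>\<rat>. \<forall>i\<in>(UNIV :: 'n set). (0, L2_class (test_fun d q i)) \<bullet> z = 0" "z \<in> space \<mu>"
    then have "snd z = 0" by (intro Hsp_snd_zero[of z d]) (auto simp: space)
    then show "(fst z, 0) = z" by (simp add: prod_eq_iff)
  qed
  have "is_centered_gaussian_on UNIV (\<lambda>y. Q *v y) (distr \<mu> borel fst)"
  proof -
    have "distr (distr \<mu> borel fst) borel (\<lambda>z. h \<bullet> z) = normal_law ((Q *v h) \<bullet> h)" for h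
    proof -
      have "distr (distr \<mu> borel fst) borel (\<lambda>z. h \<bullet> z) = distr \<mu> borel (\<lambda>z. (h, 0) \<bullet> z)"
        using fstm by (simp add: distr_distr o_def inner_prod_def)
      also have "\<dots> = normal_law ((Q *v h) \<bullet> h)"
        using law[OF Hsp_first, of h] by (simp add: inner_prod_def)
      finally show ?thesis .
    qed
    then show ?thesis
      by (simp add: is_centered_gaussian_on_def prob_space_distr[OF fstm])
  qed
  then have fst_law: "distr \<mu> borel fst = distr std_gauss borel (\<lambda>w. S *v w)"
    using is_centered_gaussian_std_gauss[OF S] is_centered_gaussian_on_UNIV_unique by blast
  have "\<mu> = distr \<mu> (restrict_space borel (Hsp d)) (\<lambda>z. z)"
    by (rule distr_id2[symmetric]) (rule sets[symmetric])
  also have "\<dots> = distr \<mu> (restrict_space borel (Hsp d)) (\<lambda>z. (fst z, 0))"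
  proof (rule distr_cong_AE)
    show "AE z in \<mu>. z = (fst z, 0)" using snd0 by (auto elim: eventually_mono)
    show "(\<lambda>z. z) \<in> \<mu> \<rightarrow>\<^sub>M restrict_space borel (Hsp d)"
      by (rule measurable_ident_sets[OF sets])
    show "(\<lambda>z. (fst z, 0)) \<in> \<mu> \<rightarrow>\<^sub>M restrict_space borel (Hsp d)"
      using measurable_compose[OF fstm pairm] .
  qed simp_all
  also have "\<dots> = distr (distr \<mu> borel fst) (restrict_space borel (Hsp d)) (\<lambda>v. (v, 0))"
    using fstm pairm by (simp add: distr_distr o_def)
  also have "\<dots> = distr std_gauss (restrict_space borel (Hsp d)) (\<lambda>w. (S *v w, 0))"
    unfolding fst_law using pairm by (simp add: distr_distr o_def)
  finally show ?thesis .
qed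

lemma gaussian_on_Hsp_eq:
  fixes S :: "real^'n^'n"
  assumes "S ** transpose S = Q"
  shows "gaussian_on (Hsp d) (\<lambda>h. (Q *v fst h, 0)) = distr std_gauss (restrict_space borel (Hsp d)) (\<lambda>w. (S *v w, 0))"
  unfolding gaussian_on_def
  by (rule the_equality[where P="is_centered_gaussian_on (Hsp d) (\<lambda>h. (Q *v fst h, 0))"])
    (use is_centered_gaussian_on_Hsp[OF assms] is_centered_gaussian_on_Hsp_unique[OF assms] in blast)+

lemma Rt_eq:
  fixes \<phi> :: "real^'n \<Rightarrow> real" and S :: "real^'n^'n"
  assumes [measurable]: "\<phi> \<in> borel_measurable borel" and S: "S ** transpose S = Qt0 a0 \<sigma> t"
  shows "Rt d a0 \<sigma> t (\<lambda>y. \<phi> (fst y)) x = (LINT w|std_gauss. \<phi> (S *v w + fst (sgA d a0 t x)))"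
proof -
  let ?v = "sgA d a0 t x"
  have "(\<lambda>w. (S *v w, 0 :: (real^'n) L2)) \<in> borel \<rightarrow>\<^sub>M borel"
    by (intro borel_measurable_continuous_onI continuous_intros linear_continuous_on) simp
  then have m: "(\<lambda>w. (S *v w, 0 :: (real^'n) L2)) \<in> std_gauss \<rightarrow>\<^sub>M restrict_space borel (Hsp d)"
    by (intro measurable_restrict_space2) (auto simp: Hsp_first)
  have "(\<lambda>z. fst (z + ?v)) \<in> restrict_space borel (Hsp d) \<rightarrow>\<^sub>M borel"
    by (intro measurable_restrict_space1 borel_measurable_continuous_onI continuous_intros)
  then have "(\<lambda>z. \<phi> (fst (z + ?v))) \<in> restrict_space borel (Hsp d) \<rightarrow>\<^sub>M borel"
    by (rule measurable_compose) simp
  then show ?thesis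
    unfolding Rt_def Qt_eq[abs_def] gaussian_on_Hsp_eq[OF S]
    using m by (subst integral_distr) auto
qed

section \<open>Averages with a varying covariance\<close>

lemma inv_msqrt_msqrt:
  assumes "pos_def Q"
  shows "inv_msqrt Q *v (msqrt Q *v x) = x" "msqrt Q *v (inv_msqrt Q *v x) = x"
proof -
  have "msqrt Q ** inv_msqrt Q = mat 1 \<and> inv_msqrt Q ** msqrt Q = mat 1"
    using invertible_msqrt[OF assms] unfolding inv_msqrt_def matrix_inv_def invertible_def by (rule someI_ex)
  then show "inv_msqrt Q *v (msqrt Q *v x) = x" "msqrt Q *v (inv_msqrt Q *v x) = x"
    by (simp_all add: matrix_vector_mul_assoc)
qed

text \<open>At \<open>y = inv_msqrt Q *v k\<close> the form \<open>y \<bullet> (Q *v y)\<close> is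
  the squared norm of \<open>msqrt Q *v y = k\<close>.\<close>

lemma norm_inv_msqrt_le:
  assumes "pos_def Q" and c: "c > 0" "\<And>y. c * (norm y)\<^sup>2 \<le> y \<bullet> (Q *v y)"
  shows "norm (inv_msqrt Q *v k) \<le> norm k / sqrt c"
proof -
  let ?y = "inv_msqrt Q *v k"
  have "c * (norm ?y)\<^sup>2 \<le> ?y \<bullet> (Q *v ?y)" by (rule c)
  also have "\<dots> = ?y \<bullet> (msqrt Q *v (msqrt Q *v ?y))"
    by (metis matrix_vector_mul_assoc msqrt_square[OF assms(1)])
  also have "\<dots> = (msqrt Q *v ?y) \<bullet> (msqrt Q *v ?y)"
    using inner_matrix_vector[of ?y "msqrt Q" "msqrt Q *v ?y"] by (simp add: transpose_msqrt[OF assms(1)])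
  also have "\<dots> = (norm k)\<^sup>2"
    by (simp add: inv_msqrt_msqrt[OF assms(1)] power2_norm_eq_inner)
  finally have "(norm ?y)\<^sup>2 \<le> (norm k / sqrt c)\<^sup>2"
    using c(1) by (simp add: field_simps power_divide)
  then show ?thesis by (rule power2_le_imp_le) (use c in simp)
qed

lemma msqrt_transpose_square: "pos_def Q \<Longrightarrow> msqrt Q ** transpose (msqrt Q) = Q"
  by (simp add: transpose_msqrt msqrt_square)

definition gauss_shift_avg :: "(real^'n \<Rightarrow> real) \<Rightarrow> real^'n^'n \<Rightarrow> real^'n \<Rightarrow> real" where
  "gauss_shift_avg \<phi> Q v = (LINT w|std_gauss. \<phi> (msqrt Q *v w + v))"

text \<open>Has the shape of the integrals in the gradient formulas;
  \<open>gauss_dir_deriv_eq\<close> brings it back to \<open>gauss_avg_deriv\<close>.\<close>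

definition gauss_dir_deriv :: "(real^'n \<Rightarrow> real) \<Rightarrow> real^'n^'n \<Rightarrow> real^'n \<Rightarrow> real^'n \<Rightarrow> real" where
  "gauss_dir_deriv \<phi> Q v k = (LINT z|gaussian_on UNIV (\<lambda>y. Q *v y).
     \<phi> (z + v) * ((inv_msqrt Q *v k) \<bullet> (inv_msqrt Q *v z)))"

context
  fixes \<phi> :: "real^'n \<Rightarrow> real" and M :: real and Q :: "real^'n^'n"
  assumes meas [measurable]: "\<phi> \<in> borel_measurable borel" and bd: "\<And>z. \<bar>\<phi> z\<bar> \<le> M"
    and Q: "pos_def Q"
begin

text \<open>Whitening: \<open>msqrt Q *v w + v\<close> is \<open>msqrt Q\<close> applied to
  \<open>w + inv_msqrt Q *v v\<close>, so the estimates for \<open>std_gauss\<close>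
  transfer.\<close>

lemma gauss_shift_avg_eq: "gauss_shift_avg \<phi> Q v = gauss_avg (\<lambda>w. \<phi> (msqrt Q *v w)) (inv_msqrt Q *v v)"
  by (simp add: gauss_shift_avg_def gauss_avg_def matrix_vector_right_distrib inv_msqrt_msqrt[OF Q])

lemma gauss_dir_deriv_eq:
  "gauss_dir_deriv \<phi> Q v k = gauss_avg_deriv (\<lambda>w. \<phi> (msqrt Q *v w)) (inv_msqrt Q *v v) (inv_msqrt Q *v k)"
  unfolding gauss_dir_deriv_def gauss_avg_deriv_def gaussian_on_UNIV_eq[OF msqrt_transpose_square[OF Q]]
  by (subst integral_distr) (auto simp: matrix_vector_right_distrib inv_msqrt_msqrt[OF Q])

lemma meas_comp: "(\<lambda>w. \<phi> (msqrt Q *v w)) \<in> borel_measurable borel"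
  by measurable

lemma gauss_shift_avg_Taylor:
  "\<bar>gauss_shift_avg \<phi> Q (v + k) - gauss_shift_avg \<phi> Q v - gauss_dir_deriv \<phi> Q v k\<bar> \<le> M * (norm (inv_msqrt Q *v k))\<^sup>2"
  unfolding gauss_shift_avg_eq gauss_dir_deriv_eq matrix_vector_right_distrib
  by (rule gauss_avg_Taylor[OF meas_comp bd])

lemma gauss_shift_avg_Lipschitz:
  "\<bar>gauss_shift_avg \<phi> Q v' - gauss_shift_avg \<phi> Q v\<bar> \<le> 2 * M * norm (inv_msqrt Q *v (v' - v))"
  using gauss_avg_Lipschitz[OF meas_comp bd, of "inv_msqrt Q *v v" "inv_msqrt Q *v (v' - v)"]
  by (simp add: gauss_shift_avg_eq matrix_vector_mult_diff_distrib)

lemma gauss_shift_avg_le: "\<bar>gauss_shift_avg \<phi> Q v\<bar> \<le> M"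
  unfolding gauss_shift_avg_eq by (rule gauss_avg_le[OF meas_comp bd])

lemma gauss_dir_deriv_le: "\<bar>gauss_dir_deriv \<phi> Q v k\<bar> \<le> M * norm (inv_msqrt Q *v k)"
  unfolding gauss_dir_deriv_eq by (rule gauss_avg_deriv_le[OF meas_comp bd])

lemma linear_gauss_dir_deriv: "linear (gauss_dir_deriv \<phi> Q v)"
proof -
  have "gauss_dir_deriv \<phi> Q v = gauss_avg_deriv (\<lambda>w. \<phi> (msqrt Q *v w)) (inv_msqrt Q *v v) \<circ> (*v) (inv_msqrt Q)"
    by (rule ext) (simp add: gauss_dir_deriv_eq)
  then show ?thesis
    using linear_compose[OF matrix_vector_mul_linear linear_gauss_avg_deriv[OF meas_comp bd]] by simp
qed

text \<open>The Riesz vector in R^n from which both the gradient and the \<open>B\<close>-gradient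
  are built.\<close>

lemma gauss_dir_deriv_represent: obtains q where "\<And>k. gauss_dir_deriv \<phi> Q v k = q \<bullet> k"
proof -
  have "gauss_dir_deriv \<phi> Q v k = adjoint (gauss_dir_deriv \<phi> Q v) 1 \<bullet> k" for k
    using adjoint_works[OF linear_gauss_dir_deriv, of k v 1] by (simp add: inner_commute)
  then show ?thesis using that by blast
qed

end

text \<open>Covariances of independent Gaussian vectors add. On each projection the characteristic
  function factorises by Fubini and the exponents combine; the Cramer-Wold theorem then identifies
  the laws.\<close>

lemma distr_std_gauss_sum:
  fixes S S1 S2 :: "real^'n^'n"
  assumes eq: "S1 ** transpose S1 + S2 ** transpose S2 = S ** transpose S"
  shows "distr (std_gauss \<Otimes>\<^sub>M std_gauss) borel (\<lambda>y. S1 *v fst y + S2 *v snd y) = distr std_gauss borel (\<lambda>w. S *v w)"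
proof (rule Cramer_Wold)
  interpret G: prob_space "std_gauss :: (real^'n) measure" by (rule prob_space_std_gauss)
  interpret pair_prob_space "std_gauss :: (real^'n) measure" "std_gauss :: (real^'n) measure" ..
  have m1: "(\<lambda>y. S1 *v fst y + S2 *v snd y) \<in> std_gauss \<Otimes>\<^sub>M std_gauss \<rightarrow>\<^sub>M borel" by measurable
  have m2: "(\<lambda>w. S *v w) \<in> std_gauss \<rightarrow>\<^sub>M borel" by measurable
  show "prob_space (distr (std_gauss \<Otimes>\<^sub>M std_gauss) borel (\<lambda>y. S1 *v fst y + S2 *v snd y))"
    by (rule P.prob_space_distr[OF m1])
  show "prob_space (distr std_gauss borel (\<lambda>w. S *v w))"
    by (rule G.prob_space_distr[OF m2])
  fix h :: "real^'n"
  let ?f = "\<lambda>y. h \<bullet> (S1 *v fst y + S2 *v snd y)" and ?g = "\<lambda>w. h \<bullet> (S *v w)"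
  have char1: "(CLINT w|std_gauss. iexp (t * (h \<bullet> (A *v w)))) = exp (- (h \<bullet> ((A ** transpose A) *v h)) * t\<^sup>2 / 2)"
    for A :: "real^'n^'n" and t
  proof -
    have "(norm (transpose A *v h))\<^sup>2 = h \<bullet> (A *v (transpose A *v h))"
      by (simp add: power2_norm_eq_inner inner_matrix_vector[of h A])
    then show ?thesis
      using char_std_gauss_inner[of "transpose A *v h" t]
      by (simp add: char_def integral_distr inner_matrix_vector[of h A] matrix_vector_mul_assoc)
  qed
  have "distr (std_gauss \<Otimes>\<^sub>M std_gauss) borel ?f = distr std_gauss borel ?g"
  proof (rule Levy_uniqueness)
    show "real_distribution (distr (std_gauss \<Otimes>\<^sub>M std_gauss) borel ?f)" "real_distribution (distr std_gauss borel ?g)"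
      by (auto simp: real_distribution_def real_distribution_axioms_def intro!: P.prob_space_distr G.prob_space_distr)
    show "char (distr (std_gauss \<Otimes>\<^sub>M std_gauss) borel ?f) = char (distr std_gauss borel ?g)"
    proof
      fix t
      have "char (distr (std_gauss \<Otimes>\<^sub>M std_gauss) borel ?f) t
        = (CLINT y|(std_gauss \<Otimes>\<^sub>M std_gauss). iexp (t * ?f y))"
        by (simp add: char_def integral_distr)
      also have "\<dots> = (CLINT w1|std_gauss. CLINT w2|std_gauss. iexp (t * ?f (w1, w2)))"
        by (rule integral_fst'[symmetric]) (auto intro!: P.integrable_const_bound[where B=1])
      also have "\<dots> = (CLINT w1|std_gauss. CLINT w2|std_gauss. iexp (t * (h \<bullet> (S1 *v w1))) * iexp (t * (h \<bullet> (S2 *v w2))))"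
        by (intro Bochner_Integration.integral_cong refl) (simp add: inner_add_right algebra_simps exp_add)
      also have "\<dots> = (CLINT w1|std_gauss. iexp (t * (h \<bullet> (S1 *v w1)))) * (CLINT w2|std_gauss. iexp (t * (h \<bullet> (S2 *v w2))))"
        by simp
      also have "\<dots> = exp (- (h \<bullet> ((S1 ** transpose S1) *v h)) * t\<^sup>2 / 2 + - (h \<bullet> ((S2 ** transpose S2) *v h)) * t\<^sup>2 / 2)"
        unfolding char1 by (simp only: exp_add of_real_mult)
      also have "- (h \<bullet> ((S1 ** transpose S1) *v h)) * t\<^sup>2 / 2 + - (h \<bullet> ((S2 ** transpose S2) *v h)) * t\<^sup>2 / 2
        = - (h \<bullet> ((S ** transpose S) *v h)) * t\<^sup>2 / 2"
        unfolding eq[symmetric] by (simp add: matrix_vector_mult_add_rdistrib inner_add_right field_simps)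
      also have "complex_of_real (exp (- (h \<bullet> ((S ** transpose S) *v h)) * t\<^sup>2 / 2)) = char (distr std_gauss borel ?g) t"
        unfolding char1[symmetric] by (simp add: char_def integral_distr)
      finally show "char (distr (std_gauss \<Otimes>\<^sub>M std_gauss) borel ?f) t = char (distr std_gauss borel ?g) t" .
    qed
  qed
  then show "distr (distr (std_gauss \<Otimes>\<^sub>M std_gauss) borel (\<lambda>y. S1 *v fst y + S2 *v snd y)) borel (\<lambda>z. h \<bullet> z)
    = distr (distr std_gauss borel (\<lambda>w. S *v w)) borel (\<lambda>z. h \<bullet> z)"
    using m1 m2 by (simp add: distr_distr o_def)
qed simp_all

text \<open>The norm is bounded by the sum of the coordinates in modulus, and each coordinate has
  standard deviation equal to the norm of a row. Written with the diagonal of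
  \<open>A ** transpose A\<close>, the bound depends on the covariance alone and not on the factor
  \<open>A\<close>.\<close>

lemma std_gauss_norm_matrix_le:
  fixes A :: "real^'n^'n"
  shows "integrable std_gauss (\<lambda>w. norm (A *v w))"
    "(LINT w|std_gauss. norm (A *v w)) \<le> (\<Sum>i\<in>UNIV. sqrt ((A ** transpose A) $ i $ i))"
proof -
  have le: "norm (A *v w) \<le> (\<Sum>i\<in>UNIV. \<bar>(A $ i) \<bullet> w\<bar>)" for w
    using norm_le_l1_cart[of "A *v w"] by (simp add: matrix_mult_dot)
  have int: "integrable std_gauss (\<lambda>w. \<Sum>i\<in>UNIV. \<bar>(A $ i) \<bullet> w\<bar>)"
    by (intro Bochner_Integration.integrable_sum integrable_abs integrable_std_gauss_inner)
  show i: "integrable std_gauss (\<lambda>w. norm (A *v w))"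
    by (rule Bochner_Integration.integrable_bound[OF int])
      (use le in \<open>auto intro!: AE_I2 order_trans[OF _ abs_ge_self]\<close>)
  have "(LINT w|std_gauss. norm (A *v w)) \<le> (LINT w|std_gauss. (\<Sum>i\<in>UNIV. \<bar>(A $ i) \<bullet> w\<bar>))"
    by (intro integral_mono i int le)
  also have "\<dots> = (\<Sum>i\<in>UNIV. (LINT w|std_gauss. \<bar>(A $ i) \<bullet> w\<bar>))"
    by (intro Bochner_Integration.integral_sum integrable_abs integrable_std_gauss_inner)
  also have "\<dots> \<le> (\<Sum>i\<in>UNIV. norm (A $ i))"
    by (intro sum_mono integral_std_gauss_abs_inner_le)
  also have "\<dots> = (\<Sum>i\<in>UNIV. sqrt ((A ** transpose A) $ i $ i))"
    by (simp add: norm_eq_sqrt_inner inner_vec_def matrix_matrix_mult_def transpose_def)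
  finally show "(LINT w|std_gauss. norm (A *v w)) \<le> (\<Sum>i\<in>UNIV. sqrt ((A ** transpose A) $ i $ i))" by simp
qed

text \<open>\<open>N(0, Q')\<close> is the convolution of \<open>N(0, Q)\<close> and \<open>N(0, A A\<^sup>*)\<close>, so the Lipschitz continuity of the
  smoothed function controls its dependence on the covariance.\<close>

lemma gauss_shift_avg_covariance:
  fixes A :: "real^'n^'n"
  assumes meas [measurable]: "\<phi> \<in> borel_measurable borel" and bd: "\<And>z. \<bar>\<phi> z\<bar> \<le> M"
    and Q: "pos_def Q" and Q': "pos_def Q'" and A: "Q' = Q + A ** transpose A"
    and C: "0 \<le> C" "\<And>k. norm (inv_msqrt Q *v k) \<le> C * norm k"
  shows "\<bar>gauss_shift_avg \<phi> Q' v' - gauss_shift_avg \<phi> Q v\<bar>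
    \<le> 2 * M * C * (norm (v' - v) + (\<Sum>i\<in>UNIV. sqrt ((Q' - Q) $ i $ i)))"
proof -
  interpret G: prob_space "std_gauss :: (real^'n) measure" by (rule prob_space_std_gauss)
  interpret pair_prob_space "std_gauss :: (real^'n) measure" "std_gauss :: (real^'n) measure" ..
  have M: "0 \<le> M" using bd[of 0] by linarith
  let ?P = "gauss_shift_avg \<phi> Q"
  have "msqrt Q ** transpose (msqrt Q) + A ** transpose A = msqrt Q' ** transpose (msqrt Q')"
    by (simp only: msqrt_transpose_square[OF Q] msqrt_transpose_square[OF Q'] A[symmetric])
  note law = distr_std_gauss_sum[OF this]
  have int': "integrable (std_gauss \<Otimes>\<^sub>M std_gauss) (\<lambda>(w1, w2). \<phi> (msqrt Q *v w1 + A *v w2 + v'))"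
    by (rule P.integrable_const_bound[where B=M]) (auto simp: bd split_beta)
  have "gauss_shift_avg \<phi> Q' v' = (LINT z|distr std_gauss borel (\<lambda>w. msqrt Q' *v w). \<phi> (z + v'))"
    unfolding gauss_shift_avg_def by (subst integral_distr) auto
  also have "\<dots> = (LINT y|(std_gauss \<Otimes>\<^sub>M std_gauss). \<phi> (msqrt Q *v fst y + A *v snd y + v'))"
    unfolding law[symmetric] by (subst integral_distr) auto
  \<comment> \<open>With the integral over \<open>w1\<close> inside, it is the average with
    covariance \<open>Q\<close> at the point \<open>A *v w2 + v'\<close>.\<close>
  also have "\<dots> = (LINT w2|std_gauss. LINT w1|std_gauss. \<phi> (msqrt Q *v w1 + A *v w2 + v'))"
    using integral_snd[OF int'] by (simp add: case_prod_beta')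
  also have "\<dots> = (LINT w|std_gauss. ?P (A *v w + v'))"
    by (simp add: gauss_shift_avg_def add.assoc)
  finally have rep: "gauss_shift_avg \<phi> Q' v' = (LINT w|std_gauss. ?P (A *v w + v'))" .
  have Pm: "(\<lambda>w. ?P (A *v w + v')) \<in> borel_measurable std_gauss"
    using G.borel_measurable_lebesgue_integral[of "\<lambda>w2 w1. \<phi> (msqrt Q *v w1 + A *v w2 + v')" std_gauss]
    by (simp add: gauss_shift_avg_def add.assoc split_beta)
  have Pint: "integrable std_gauss (\<lambda>w. ?P (A *v w + v'))"
    by (rule G.integrable_const_bound[where B=M, OF _ Pm]) (simp add: gauss_shift_avg_le[OF meas bd Q])
  have "gauss_shift_avg \<phi> Q' v' - ?P v = (LINT w|std_gauss. ?P (A *v w + v') - ?P v)"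
    using Pint by (simp add: rep G.prob_space[simplified])
  then have "norm (gauss_shift_avg \<phi> Q' v' - ?P v)
    \<le> (LINT w|std_gauss. 2 * M * C * (norm (v' - v) + norm (A *v w)))"
  proof (simp only:, intro Bochner_Integration.integral_norm_bound_integral)
    show "integrable std_gauss (\<lambda>w. ?P (A *v w + v') - ?P v)" using Pint by simp
    show "integrable std_gauss (\<lambda>w. 2 * M * C * (norm (v' - v) + norm (A *v w)))"
      using std_gauss_norm_matrix_le(1)[of A] by simp
    fix w
    have "\<bar>?P (A *v w + v') - ?P v\<bar> \<le> 2 * M * norm (inv_msqrt Q *v (A *v w + v' - v))"
      by (rule gauss_shift_avg_Lipschitz[OF meas bd Q])
    also have "\<dots> \<le> 2 * M * (C * norm (A *v w + v' - v))"
      using M by (intro mult_left_mono C) auto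
    also have "\<dots> \<le> 2 * M * (C * (norm (v' - v) + norm (A *v w)))"
      using M C norm_triangle_ineq[of "v' - v" "A *v w"] by (intro mult_left_mono) (auto simp: algebra_simps)
    finally show "norm (?P (A *v w + v') - ?P v) \<le> 2 * M * C * (norm (v' - v) + norm (A *v w))"
      by (simp add: mult.assoc)
  qed
  also have "\<dots> = 2 * M * C * (norm (v' - v) + (LINT w|std_gauss. norm (A *v w)))"
    using std_gauss_norm_matrix_le(1)[of A] by (simp add: G.prob_space[simplified])
  also have "\<dots> \<le> 2 * M * C * (norm (v' - v) + (\<Sum>i\<in>UNIV. sqrt ((A ** transpose A) $ i $ i)))"
    using M C std_gauss_norm_matrix_le(2)[of A] by (intro mult_left_mono add_left_mono) auto
  finally show ?thesis by (simp add: A)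
qed

section \<open>Continuity of the first component of the semigroup\<close>

lemma norm_L2_le:
  assumes f: "sq_integrable f" and le: "\<And>s. norm (f s) \<le> c * indicat_real {-d..0} s" and d: "0 \<le> d" and c: "0 \<le> c"
  shows "norm (L2_class f) \<le> c * sqrt d"
proof -
  have "(norm (L2_class f))\<^sup>2 = (LINT s|lborel. (norm (f s))\<^sup>2)"
    by (simp add: power2_norm_eq_inner L2_class_inner[OF f f])
  also have "\<dots> \<le> (LINT s|lborel. c\<^sup>2 * indicat_real {-d..0} s)"
  proof (rule integral_mono)
    show "integrable lborel (\<lambda>s. (norm (f s))\<^sup>2)" using f by (simp add: sq_integrable_def)
    show "integrable lborel (\<lambda>s. c\<^sup>2 * indicat_real {-d..0} s)"
      by (intro integrable_mult_right integrable_real_indicator) (auto simp: emeasure_lborel_Icc_eq)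
    fix s
    have "(norm (f s))\<^sup>2 \<le> (c * indicat_real {-d..0} s)\<^sup>2"
      by (intro power_mono le) simp
    then show "(norm (f s))\<^sup>2 \<le> c\<^sup>2 * indicat_real {-d..0} s"
      by (auto simp: indicator_def split: if_splits)
  qed
  also have "\<dots> = (c * sqrt d)\<^sup>2" using d by (simp add: power_mult_distrib)
  finally show ?thesis by (rule power2_le_imp_le) (use c d in simp)
qed

context
  fixes d :: real and a0 :: "real^'n^'n"
  assumes d: "0 \<le> d"
begin

lemma norm_adj0_le:
  assumes "0 \<le> t" "t \<le> T"
  shows "norm (adj0 d a0 t y) \<le> exp (T * norm (of_mat (transpose a0))) * (1 + sqrt d) * norm y"
proof -
  let ?c = "exp (T * norm (of_mat (transpose a0))) * norm y"
  have le: "norm (mexp (r *\<^sub>R transpose a0) *v y) \<le> ?c" if "0 \<le> r" "r \<le> T" for r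
    by (rule order_trans[OF norm_mexp_mult_vec_le]) (use that in \<open>auto intro!: mult_right_mono\<close>)
  have "norm (L2_class (adj_kernel d a0 t y)) \<le> ?c * sqrt d"
  proof (rule norm_L2_le[OF sq_integrable_adj_kernel _ d])
    show "norm (adj_kernel d a0 t y s) \<le> ?c * indicat_real {-d..0} s" for s
    proof (cases "s \<in> {-d..0} \<and> s \<in> {-t..0}")
      case True
      then show ?thesis using le[of "t + s"] assms by (simp add: adj_kernel_def)
    next
      case False
      then show ?thesis by (auto simp: adj_kernel_def indicator_def)
    qed
  qed simp
  moreover have "norm (mexp (t *\<^sub>R transpose a0) *v y) \<le> ?c" using assms by (intro le)
  moreover have "norm (adj0 d a0 t y) \<le> norm (mexp (t *\<^sub>R transpose a0) *v y) + norm (L2_class (adj_kernel d a0 t y))"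
    unfolding adj0_def by (rule norm_Pair_le)
  ultimately show ?thesis by (simp add: algebra_simps)
qed

text \<open>With \<open>v\<close> the first component, duality gives
  \<open>(norm v)\<^sup>2 = x \<bullet> adj0 d a0 t v\<close>, so the uniform bound for
  \<open>adj0\<close> transfers.\<close>

lemma fst_sgA_bound:
  obtains C where "0 < C" "\<And>t x. 0 \<le> t \<Longrightarrow> t \<le> T \<Longrightarrow> norm (fst (sgA d a0 t x)) \<le> C * norm x"
proof -
  let ?C = "exp (T * norm (of_mat (transpose a0))) * (1 + sqrt d)"
  have "norm (fst (sgA d a0 t x)) \<le> ?C * norm x" if t: "0 \<le> t" "t \<le> T" for t x
  proof (cases "fst (sgA d a0 t x) = 0")
    case False
    let ?v = "fst (sgA d a0 t x)"
    have "(norm ?v)\<^sup>2 = x \<bullet> adj0 d a0 t ?v"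
      using fst_sgA_inner[OF t(1), of d a0 x ?v] by (simp add: power2_norm_eq_inner)
    also have "\<dots> \<le> norm x * norm (adj0 d a0 t ?v)" by (rule norm_cauchy_schwarz)
    also have "\<dots> \<le> norm x * (?C * norm ?v)" by (intro mult_left_mono norm_adj0_le t) simp
    finally show ?thesis using False by (simp add: power2_eq_square mult_ac)
  qed (use d in simp)
  moreover have "0 < ?C" using d by (simp add: add_pos_nonneg)
  ultimately show ?thesis using that by blast
qed

lemma fst_sgA_add:
  assumes "0 \<le> t"
  shows "fst (sgA d a0 t (x + y)) = fst (sgA d a0 t x) + fst (sgA d a0 t y)"
  by (rule vector_eq_rdot[THEN iffD1]) (simp add: fst_sgA_inner[OF assms] inner_add_left)

lemma fst_sgA_scaleR:
  assumes "0 \<le> t"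
  shows "fst (sgA d a0 t (c *\<^sub>R x)) = c *\<^sub>R fst (sgA d a0 t x)"
  by (rule vector_eq_rdot[THEN iffD1]) (simp add: fst_sgA_inner[OF assms])

lemma fst_sgA_diff:
  assumes "0 \<le> t"
  shows "fst (sgA d a0 t (x - y)) = fst (sgA d a0 t x) - fst (sgA d a0 t y)"
  by (rule vector_eq_rdot[THEN iffD1]) (simp add: fst_sgA_inner[OF assms] inner_diff_left)

text \<open>Vectors \<open>(v, 0)\<close> already suffice because
  \<open>mexp (t *\<^sub>R a0)\<close> is invertible. This makes the function \<open>g\<close> in
  \<open>has_B_gradient\<close> unique.\<close>

lemma fst_sgA_onto:
  assumes "0 \<le> t"
  obtains y where "y \<in> Hsp d" "fst (sgA d a0 t y) = v"
proof -
  have "mexp (t *\<^sub>R a0) ** mexp ((- t) *\<^sub>R a0) = mat 1"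
    using mexp_add[of t "- t" a0] by (simp add: mexp_zero)
  then have "fst (sgA d a0 t (mexp ((- t) *\<^sub>R a0) *v v, 0)) = v"
    by (simp add: sgA_first matrix_vector_mul_assoc)
  then show ?thesis using that Hsp_first by blast
qed

text \<open>Dominated convergence along sequences of times: the indicator of \<open>{-t..0}\<close>
  changes under a small change of \<open>t\<close> only near \<open>s = -t\<close>, and this single
  point is a null set.\<close>

lemma tendsto_fst_sgA_time:
  assumes t: "0 < t"
  shows "((\<lambda>s. fst (sgA d a0 s x)) \<longlongrightarrow> fst (sgA d a0 t x)) (at t within {0<..})"
  unfolding tendsto_at_iff_sequentially
proof (intro allI impI)
  fix X :: "nat \<Rightarrow> real" assume X: "\<forall>i. X i \<in> {0<..} - {t}" "X \<longlonglongrightarrow> t"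
  then have X0: "0 \<le> X i" for i by (auto intro: less_imp_le)
  obtain B where B: "\<And>i. X i \<le> B"
  proof -
    have "Bseq X" using X(2) by (rule convergent_imp_Bseq[OF convergentI])
    then obtain K where "\<And>i. norm (X i) \<le> K" by (auto simp: Bseq_def)
    then have "X i \<le> K" for i by (metis abs_le_D1 real_norm_def)
    then show ?thesis using that by blast
  qed
  let ?u = "snd x"
  have "(\<lambda>i. LINT s|lborel. delay_integrand d a0 (X i) ?u s) \<longlonglongrightarrow> (LINT s|lborel. delay_integrand d a0 t ?u s)"
  proof (rule integral_dominated_convergence)
    show "(\<lambda>s. delay_integrand d a0 t ?u s) \<in> borel_measurable lborel"
      "\<And>i. (\<lambda>s. delay_integrand d a0 (X i) ?u s) \<in> borel_measurable lborel"
      by (simp_all only: measurable_lborel2 delay_integrand_measurable)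
    show "integrable lborel (\<lambda>s. exp (B * norm (of_mat a0)) * (indicat_real {-d..0} s + (norm (L2_fun ?u s))\<^sup>2))"
      by (rule integrable_delay_bound)
    show "AE s in lborel. norm (delay_integrand d a0 (X i) ?u s)
      \<le> exp (B * norm (of_mat a0)) * (indicat_real {-d..0} s + (norm (L2_fun ?u s))\<^sup>2)" for i
      by (intro AE_I2 order_trans[OF norm_delay_integrand_le[OF X0] mult_right_mono])
        (use B in \<open>auto intro!: mult_right_mono\<close>)
    show "AE s in lborel. (\<lambda>i. delay_integrand d a0 (X i) ?u s) \<longlonglongrightarrow> delay_integrand d a0 t ?u s"
      using AE_lborel_singleton[of "- t"]
    proof eventually_elim
      fix s :: real assume s: "s \<noteq> - t"
      have ind: "\<forall>\<^sub>F i in sequentially. indicat_real {-X i..0} s = indicat_real {-t..0} s"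
      proof (cases "- t < s")
        case True
        then have "\<forall>\<^sub>F i in sequentially. - s < X i" by (intro order_tendstoD(1)[OF X(2)]) simp
        then show ?thesis by (rule eventually_mono) (use True in \<open>auto simp: indicator_def\<close>)
      next
        case False
        then have "\<forall>\<^sub>F i in sequentially. X i < - s" using s by (intro order_tendstoD(2)[OF X(2)]) simp
        then show ?thesis by (rule eventually_mono) (use False s in \<open>auto simp: indicator_def\<close>)
      qed
      have "(\<lambda>i. mexp ((X i + s) *\<^sub>R a0) *v L2_fun ?u s) \<longlonglongrightarrow> mexp ((t + s) *\<^sub>R a0) *v L2_fun ?u s"
        by (rule continuous_on_tendsto_compose[OF _ X(2), where s=UNIV and f="\<lambda>r. mexp ((r + s) *\<^sub>R a0) *v L2_fun ?u s"])
          (use continuous_on_mexp_shift[of UNIV s a0] in \<open>auto intro!: continuous_intros simp: add.commute\<close>)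
      then show "(\<lambda>i. delay_integrand d a0 (X i) ?u s) \<longlonglongrightarrow> delay_integrand d a0 t ?u s"
        by (intro tendsto_scaleR tendsto_const tendsto_eventually[OF ind])
    qed
  qed
  moreover have "(\<lambda>i. mexp (X i *\<^sub>R a0) *v fst x) \<longlonglongrightarrow> mexp (t *\<^sub>R a0) *v fst x"
    by (rule continuous_on_tendsto_compose[OF _ X(2), where s=UNIV and f="\<lambda>r. mexp (r *\<^sub>R a0) *v fst x"])
      (auto intro!: continuous_intros continuous_on_mexp)
  ultimately show "((\<lambda>s. fst (sgA d a0 s x)) \<circ> X) \<longlonglongrightarrow> fst (sgA d a0 t x)"
    unfolding fst_sgA o_def by (intro tendsto_add)
qed

text \<open>Joint continuity follows from continuity in time for fixed \<open>x\<close> and a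
  Lipschitz constant in \<open>x\<close> that is uniform for times below
  \<open>t + 1\<close>.\<close>

lemma continuous_on_fst_sgA: "continuous_on ({0<..} \<times> UNIV) (\<lambda>(t, x). fst (sgA d a0 t x))"
  unfolding continuous_on_def
proof
  fix p :: "real \<times> (real^'n) \<times> (real^'n) L2" assume "p \<in> {0<..} \<times> UNIV"
  then obtain t x where p: "p = (t, x)" and t: "0 < t" by auto
  obtain C where C: "0 < C" "\<And>s y. 0 \<le> s \<Longrightarrow> s \<le> t + 1 \<Longrightarrow> norm (fst (sgA d a0 s y)) \<le> C * norm y"
    using fst_sgA_bound[of "t + 1"] by blast
  let ?S = "{0<..} \<times> (UNIV :: ((real^'n) \<times> (real^'n) L2) set)"
  let ?F = "at p within ?S"
  have f1: "(fst \<longlongrightarrow> t) ?F" and f2: "(snd \<longlongrightarrow> x) ?F"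
    using tendsto_fst[OF tendsto_ident_at, of p ?S] tendsto_snd[OF tendsto_ident_at, of p ?S] by (simp_all add: p)
  have inS: "\<forall>\<^sub>F q in ?F. q \<in> ?S" by (simp add: eventually_at_filter)
  have c: "continuous_on {0<..} (\<lambda>s. fst (sgA d a0 s x))"
    unfolding continuous_on_def using tendsto_fst_sgA_time by auto
  have g1: "((\<lambda>q. fst (sgA d a0 (fst q) x)) \<longlongrightarrow> fst (sgA d a0 t x)) ?F"
    by (rule continuous_on_tendsto_compose[OF c f1]) (use t inS in \<open>auto elim: eventually_mono\<close>)
  have "((\<lambda>q. C * norm (snd q - x) + norm (fst (sgA d a0 (fst q) x) - fst (sgA d a0 t x))) \<longlongrightarrow> C * norm (x - x) + norm (fst (sgA d a0 t x) - fst (sgA d a0 t x))) ?F"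
    by (intro tendsto_intros f2 g1)
  then have lim0: "((\<lambda>q. C * norm (snd q - x) + norm (fst (sgA d a0 (fst q) x) - fst (sgA d a0 t x))) \<longlongrightarrow> 0) ?F"
    by simp
  have "\<forall>\<^sub>F q in ?F. fst q < t + 1" by (rule order_tendstoD(2)[OF f1]) simp
  then have "\<forall>\<^sub>F q in ?F. norm (fst (sgA d a0 (fst q) (snd q)) - fst (sgA d a0 t x))
     \<le> C * norm (snd q - x) + norm (fst (sgA d a0 (fst q) x) - fst (sgA d a0 t x))"
    using inS
  proof eventually_elim
    fix q assume q: "fst q < t + 1" "q \<in> ?S"
    then have q0: "0 \<le> fst q" by auto
    have "fst (sgA d a0 (fst q) (snd q)) - fst (sgA d a0 t x)
      = fst (sgA d a0 (fst q) (snd q - x)) + (fst (sgA d a0 (fst q) x) - fst (sgA d a0 t x))"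
      by (simp add: fst_sgA_diff[OF q0])
    also have "norm \<dots> \<le> norm (fst (sgA d a0 (fst q) (snd q - x))) + norm (fst (sgA d a0 (fst q) x) - fst (sgA d a0 t x))"
      by (rule norm_triangle_ineq)
    also have "norm (fst (sgA d a0 (fst q) (snd q - x))) \<le> C * norm (snd q - x)"
      using q q0 by (intro C) auto
    finally show "norm (fst (sgA d a0 (fst q) (snd q)) - fst (sgA d a0 t x))
     \<le> C * norm (snd q - x) + norm (fst (sgA d a0 (fst q) x) - fst (sgA d a0 t x))" by simp
  qed
  then have "((\<lambda>q. fst (sgA d a0 (fst q) (snd q)) - fst (sgA d a0 t x)) \<longlongrightarrow> 0) ?F"
    by (rule Lim_null_comparison[OF _ lim0])
  then show "((\<lambda>(t, x). fst (sgA d a0 t x)) \<longlongrightarrow> (case p of (t, x) \<Rightarrow> fst (sgA d a0 t x))) ?F"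
    by (simp add: Lim_null[symmetric] p case_prod_beta')
qed

end

section \<open>The control operator\<close>

lemma mexp_entry_le: "\<bar>mexp (r *\<^sub>R a) $ i $ l\<bar> \<le> exp (\<bar>r\<bar> * norm (of_mat a))"
  by (rule order_trans[OF matrix_component_le_onorm onorm_bound]) (simp_all add: norm_mexp_mult_vec_le)

lemma delay_kernel_entry_le:
  assumes "0 \<le> t" "t \<le> T"
  shows "\<bar>indicat_real {-t..0} r * mexp ((t + r) *\<^sub>R a) $ i $ l\<bar> \<le> exp (T * norm (of_mat a))"
proof (cases "r \<in> {-t..0}")
  case True
  have "\<bar>mexp ((t + r) *\<^sub>R a) $ i $ l\<bar> \<le> exp (\<bar>t + r\<bar> * norm (of_mat a))" by (rule mexp_entry_le)
  also have "\<dots> \<le> exp (T * norm (of_mat a))" using True assms by (auto intro!: mult_right_mono)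
  finally show ?thesis using True by simp
qed simp

lemma delay_kernel_entry_measurable:
  "(\<lambda>r. indicat_real {-t..0} r * mexp ((t + r) *\<^sub>R a) $ i $ l) \<in> borel_measurable borel"
proof -
  have [measurable]: "(\<lambda>r. mexp ((t + r) *\<^sub>R a) $ i $ l) \<in> borel_measurable borel"
    by (rule borel_measurable_continuous_onI)
      (intro bounded_linear.continuous_on[OF bounded_linear_vec_nth] continuous_on_mexp_shift)
  show ?thesis by measurable
qed

text \<open>On \<open>{0..T}\<close> all kernel entries are bounded by one constant, and a signed
  integral is bounded by the size of its integrand times a constant of the measure.\<close>

lemma etB0_bound:
  fixes a0 :: "real^'n^'n" and b0 :: "real^'m^'n" and b1 :: "real set \<Rightarrow> real^'m^'n"
  assumes b1: "\<And>i j. finite_signed_measure_on {-d..0} (\<lambda>E. b1 E $ i $ j)"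
  obtains C where "0 < C" "\<And>t k. 0 \<le> t \<Longrightarrow> t \<le> T \<Longrightarrow> norm (etB0 d a0 b0 b1 t *v k) \<le> C * norm k"
proof -
  have "\<exists>K\<ge>0. \<forall>f c. (\<forall>r. \<bar>f r\<bar> \<le> c) \<longrightarrow> \<bar>signed_integral {-d..0} (\<lambda>E. b1 E $ l $ j) f\<bar> \<le> c * K" for l j
    by (rule signed_integral_bounded[OF b1[of l j]]) blast
  then obtain K where K: "\<And>l j. 0 \<le> K l j"
    "\<And>l j f c. (\<And>r. \<bar>f r\<bar> \<le> c) \<Longrightarrow> \<bar>signed_integral {-d..0} (\<lambda>E. b1 E $ l $ j) f\<bar> \<le> c * K l j"
    by metis
  define c where "c = exp (T * norm (of_mat a0))"
  define D where "D = c * onorm ((*v) b0) + (\<Sum>i\<in>(UNIV :: 'n set). \<Sum>j\<in>(UNIV :: 'm set). \<Sum>l\<in>(UNIV :: 'n set). c * K l j)"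
  have c: "0 < c" by (simp add: c_def)
  have D: "0 \<le> D" unfolding D_def using c K by (intro add_nonneg_nonneg sum_nonneg mult_nonneg_nonneg onorm_pos_le) auto
  have "norm (etB0 d a0 b0 b1 t *v k) \<le> (D + 1) * norm k" if t: "0 \<le> t" "t \<le> T" for t k
  proof -
    define N :: "real^'m^'n" where "N = (\<chi> i j. \<Sum>l\<in>UNIV. signed_integral {-d..0} (\<lambda>E. b1 E $ l $ j)
        (\<lambda>r. indicat_real {-t..0} r * mexp ((t + r) *\<^sub>R a0) $ i $ l))"
    have "norm (mexp (t *\<^sub>R a0) *v (b0 *v k)) \<le> exp (\<bar>t\<bar> * norm (of_mat a0)) * norm (b0 *v k)"
      by (rule norm_mexp_mult_vec_le)
    also have "\<dots> \<le> c * (onorm ((*v) b0) * norm k)"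
      unfolding c_def using t by (intro mult_mono onorm) (auto intro!: mult_right_mono)
    finally have 1: "norm (mexp (t *\<^sub>R a0) *v (b0 *v k)) \<le> c * onorm ((*v) b0) * norm k" by (simp add: mult.assoc)
    have "norm (N *v k) \<le> onorm ((*v) N) * norm k" by (rule onorm) simp
    also have "onorm ((*v) N) \<le> (\<Sum>i\<in>UNIV. \<Sum>j\<in>UNIV. \<bar>N $ i $ j\<bar>)"
      by (rule onorm_le_matrix_component_sum)
    also have "\<dots> \<le> (\<Sum>i\<in>(UNIV :: 'n set). \<Sum>j\<in>(UNIV :: 'm set). \<Sum>l\<in>(UNIV :: 'n set). c * K l j)"
      unfolding N_def c_def
      by (intro sum_mono) (simp, rule order_trans[OF sum_abs sum_mono], rule K, rule delay_kernel_entry_le[OF t])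
    finally have 2: "norm (N *v k) \<le> (\<Sum>i\<in>(UNIV :: 'n set). \<Sum>j\<in>(UNIV :: 'm set). \<Sum>l\<in>(UNIV :: 'n set). c * K l j) * norm k"
      by (simp add: mult_right_mono)
    have "etB0 d a0 b0 b1 t *v k = mexp (t *\<^sub>R a0) *v (b0 *v k) + N *v k"
      by (simp add: etB0_def N_def matrix_vector_mult_add_rdistrib matrix_vector_mul_assoc)
    then have "norm (etB0 d a0 b0 b1 t *v k) \<le> D * norm k"
      using norm_triangle_ineq[of "mexp (t *\<^sub>R a0) *v (b0 *v k)" "N *v k"] 1 2
      by (simp add: D_def distrib_right)
    then show ?thesis by (simp add: distrib_right add_increasing2)
  qed
  then show ?thesis using that[of "D + 1"] D by simp
qed

lemma bounded_linear_matrix_entry: "bounded_linear (\<lambda>A::real^'m^'n. A $ l $ j)"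
  by (rule bounded_linear_compose[OF bounded_linear_vec_nth bounded_linear_vec_nth])

text \<open>On a bounded interval square integrability implies integrability, because a norm is at
  most 1 plus its square.\<close>

lemma set_integrable_L2_density:
  fixes \<beta> :: "real \<Rightarrow> real^'m^'n"
  assumes "sq_integrable (\<lambda>r. indicat_real {-d..0} r *\<^sub>R \<beta> r)"
  shows "set_integrable lborel {-d..0} \<beta>"
  unfolding set_integrable_def
proof (rule Bochner_Integration.integrable_bound)
  let ?f = "\<lambda>r. indicat_real {-d..0} r *\<^sub>R \<beta> r"
  show "integrable lborel (\<lambda>r. indicat_real {-d..0} r + (norm (?f r))\<^sup>2)"
    using assms by (intro Bochner_Integration.integrable_add)
      (auto simp: sq_integrable_def emeasure_lborel_Icc_eq intro!: integrable_real_indicator)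
  show "?f \<in> borel_measurable lborel" using assms by (simp add: sq_integrable_def)
  show "AE r in lborel. norm (?f r) \<le> norm (indicat_real {-d..0} r + (norm (?f r))\<^sup>2)"
  proof (rule AE_I2)
    fix r
    have "2 * norm (?f r) \<le> 1 + (norm (?f r))\<^sup>2"
      using sum_squares_bound[of 1 "norm (?f r)"] by simp
    then have "norm (?f r) \<le> 1 + (norm (?f r))\<^sup>2"
      using norm_ge_zero[of "?f r"] by linarith
    then show "norm (?f r) \<le> norm (indicat_real {-d..0} r + (norm (?f r))\<^sup>2)"
      by (cases "r \<in> {-d..0}") auto
  qed
qed

lemma signed_integral_L2_density:
  fixes \<beta> :: "real \<Rightarrow> real^'m^'n"
  assumes \<beta>: "has_L2_density d b1 \<beta>" and t: "0 \<le> t"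
  shows "signed_integral {-d..0} (\<lambda>E. b1 E $ l $ j) (\<lambda>r. indicat_real {-t..0} r * mexp ((t + r) *\<^sub>R a) $ i $ l)
    = (LINT r:{-d..0}|lborel. \<beta> r $ l $ j * (indicat_real {-t..0} r * mexp ((t + r) *\<^sub>R a) $ i $ l))"
proof (rule signed_integral_density)
  have int: "set_integrable lborel {-d..0} \<beta>"
    using \<beta> by (intro set_integrable_L2_density) (simp add: has_L2_density_def)
  show "set_integrable lborel {-d..0} (\<lambda>r. \<beta> r $ l $ j)"
    using integrable_bounded_linear[OF bounded_linear_matrix_entry int[unfolded set_integrable_def], of l j]
    by (simp add: set_integrable_def)
  fix E assume E: "E \<in> sets (restrict_space borel {-d..0})"
  then have "E \<in> sets lborel" "E \<subseteq> {-d..0}" by (auto simp: sets_restrict_space_iff)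
  then have intE: "set_integrable lborel E \<beta>" by (rule set_integrable_subset[OF int])
  have "b1 E = (LINT r:E|lborel. \<beta> r)" using \<beta> E by (simp add: has_L2_density_def)
  then show "b1 E $ l $ j = (LINT r:E|lborel. \<beta> r $ l $ j)"
    using integral_bounded_linear[OF bounded_linear_matrix_entry intE[unfolded set_integrable_def], of l j]
    by (simp add: set_lebesgue_integral_def)
next
  show "\<bar>indicat_real {-t..0} r * mexp ((t + r) *\<^sub>R a) $ i $ l\<bar> \<le> exp (t * norm (of_mat a))" for r
    by (rule delay_kernel_entry_le[OF t order_refl])
qed (simp_all add: delay_kernel_entry_measurable)

lemma Bop_in_Hsp:
  fixes \<beta> :: "real \<Rightarrow> real^'m^'n"
  assumes "has_L2_density d b1 \<beta>"
  shows sq_integrable_Bop: "sq_integrable (\<lambda>r. indicat_real {-d..0} r *\<^sub>R (\<beta> r *v k))"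
    and "Bop d b0 \<beta> k \<in> Hsp d"
proof -
  have f: "sq_integrable (\<lambda>r. indicat_real {-d..0} r *\<^sub>R \<beta> r)" using assms by (simp add: has_L2_density_def)
  have eq: "indicat_real {-d..0} r *\<^sub>R (\<beta> r *v k) = (indicat_real {-d..0} r *\<^sub>R \<beta> r) *v k" for r
    by (simp add: matrix_vector_mult_scaleR_left)
  obtain K where K: "\<And>A :: real^'m^'n. norm (A *v k) \<le> norm A * K"
    using bounded_linear.bounded[OF bounded_linear_matrix_vector_left[of k]] by blast
  show sq: "sq_integrable (\<lambda>r. indicat_real {-d..0} r *\<^sub>R (\<beta> r *v k))"
    unfolding sq_integrable_def eq
  proof
    let ?f = "\<lambda>r. indicat_real {-d..0} r *\<^sub>R \<beta> r"
    have fm: "?f \<in> borel_measurable lborel" using f by (simp add: sq_integrable_def)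
    show m: "(\<lambda>r. ?f r *v k) \<in> borel_measurable lborel"
      by (rule measurable_compose[OF fm borel_measurable_continuous_onI])
        (rule bounded_linear.continuous_on[OF bounded_linear_matrix_vector_left continuous_on_id])
    show "integrable lborel (\<lambda>r. (norm (?f r *v k))\<^sup>2)"
    proof (rule Bochner_Integration.integrable_bound)
      show "integrable lborel (\<lambda>r. K\<^sup>2 * (norm (?f r))\<^sup>2)" using f by (simp add: sq_integrable_def)
      show "(\<lambda>r. (norm (?f r *v k))\<^sup>2) \<in> borel_measurable lborel" using m by simp
      show "AE r in lborel. norm ((norm (?f r *v k))\<^sup>2) \<le> norm (K\<^sup>2 * (norm (?f r))\<^sup>2)"
      proof (rule AE_I2)
        fix r
        have "(norm (?f r *v k))\<^sup>2 \<le> (norm (?f r) * K)\<^sup>2" by (intro power_mono K) simp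
        then show "norm ((norm (?f r *v k))\<^sup>2) \<le> norm (K\<^sup>2 * (norm (?f r))\<^sup>2)"
          by (simp add: power_mult_distrib mult.commute)
      qed
    qed
  qed
  show "Bop d b0 \<beta> k \<in> Hsp d"
    unfolding Bop_def by (rule Hsp_L2_class[OF sq]) simp
qed

text \<open>Consistency of the two readings of the control operator: for an \<open>L\<^sup>2\<close>
  density, applying the semigroup to the point \<open>Bop d b0 \<beta> k\<close> gives the same
  vector as the matrix \<open>etB0\<close> built from signed integrals. Both branches of
  \<open>has_B_gradient\<close> thus lead to the same increments.\<close>

lemma fst_sgA_Bop:
  fixes a0 :: "real^'n^'n" and \<beta> :: "real \<Rightarrow> real^'m^'n"
  assumes \<beta>: "has_L2_density d b1 \<beta>" and t: "0 \<le> t"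
  shows "fst (sgA d a0 t (Bop d b0 \<beta> k)) = etB0 d a0 b0 b1 t *v k"
proof -
  let ?u = "L2_class (\<lambda>r. indicat_real {-d..0} r *\<^sub>R (\<beta> r *v k))"
  let ?g = "\<lambda>i l r. indicat_real {-t..0} r * mexp ((t + r) *\<^sub>R a0) $ i $ l"
  have int: "set_integrable lborel {-d..0} \<beta>"
    using \<beta> by (intro set_integrable_L2_density) (simp add: has_L2_density_def)
  have intg: "integrable lborel (\<lambda>r. indicat_real {-d..0} r * (\<beta> r $ l $ j * ?g i l r))" for i l j
  proof (rule Bochner_Integration.integrable_bound)
    have e: "integrable lborel (\<lambda>r. indicat_real {-d..0} r * \<beta> r $ l $ j)"
      using integrable_bounded_linear[OF bounded_linear_matrix_entry int[unfolded set_integrable_def], of l j] by simp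
    then show "integrable lborel (\<lambda>r. exp (t * norm (of_mat a0)) * (indicat_real {-d..0} r * \<beta> r $ l $ j))" by simp
    have "(\<lambda>r. (indicat_real {-d..0} r * \<beta> r $ l $ j) * ?g i l r) \<in> borel_measurable lborel"
      by (rule borel_measurable_times[OF borel_measurable_integrable[OF e]])
        (simp only: measurable_lborel2 delay_kernel_entry_measurable)
    then show "(\<lambda>r. indicat_real {-d..0} r * (\<beta> r $ l $ j * ?g i l r)) \<in> borel_measurable lborel"
      by (simp add: mult.assoc)
    show "AE r in lborel. norm (indicat_real {-d..0} r * (\<beta> r $ l $ j * ?g i l r))
      \<le> norm (exp (t * norm (of_mat a0)) * (indicat_real {-d..0} r * \<beta> r $ l $ j))"
    proof (rule AE_I2)
      fix r
      have "\<bar>indicat_real {-d..0} r * \<beta> r $ l $ j\<bar> * \<bar>?g i l r\<bar> \<le> \<bar>indicat_real {-d..0} r * \<beta> r $ l $ j\<bar> * exp (t * norm (of_mat a0))"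
        by (intro mult_left_mono delay_kernel_entry_le[OF t order_refl]) simp
      then show "norm (indicat_real {-d..0} r * (\<beta> r $ l $ j * ?g i l r))
        \<le> norm (exp (t * norm (of_mat a0)) * (indicat_real {-d..0} r * \<beta> r $ l $ j))"
        by (simp add: abs_mult mult_ac)
    qed
  qed
  have "(LINT s|lborel. delay_integrand d a0 t ?u s) $ i
    = (\<Sum>j\<in>UNIV. (\<Sum>l\<in>UNIV. LINT r|lborel. indicat_real {-d..0} r * (\<beta> r $ l $ j * ?g i l r)) * k $ j)" for i
  proof -
    have "(LINT s|lborel. delay_integrand d a0 t ?u s) $ i = (LINT s|lborel. delay_integrand d a0 t ?u s $ i)"
      by (rule integral_bounded_linear[OF bounded_linear_vec_nth integrable_delay_integrand[OF t], symmetric])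
    \<comment> \<open>The representative of the class agrees with the density applied to
      \<open>k\<close> only almost everywhere, so the integrands are compared up to a null
      set.\<close>
    also have "\<dots> = (LINT r|lborel. (\<Sum>j\<in>UNIV. (\<Sum>l\<in>UNIV. indicat_real {-d..0} r * (\<beta> r $ l $ j * ?g i l r)) * k $ j))"
    proof (rule integral_cong_AE)
      show "(\<lambda>s. delay_integrand d a0 t ?u s $ i) \<in> borel_measurable lborel"
        by (rule borel_measurable_integrable,
            rule integrable_bounded_linear[OF bounded_linear_vec_nth integrable_delay_integrand[OF t]])
      show "(\<lambda>r. \<Sum>j\<in>UNIV. (\<Sum>l\<in>UNIV. indicat_real {-d..0} r * (\<beta> r $ l $ j * ?g i l r)) * k $ j) \<in> borel_measurable lborel"
        by (intro borel_measurable_sum borel_measurable_times borel_measurable_const borel_measurable_integrable intg)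
      show "AE s in lborel. delay_integrand d a0 t ?u s $ i
         = (\<Sum>j\<in>UNIV. (\<Sum>l\<in>UNIV. indicat_real {-d..0} s * (\<beta> s $ l $ j * ?g i l s)) * k $ j)"
        using L2_fun_class[OF sq_integrable_Bop[OF \<beta>, of k]]
      proof eventually_elim
        fix s
        assume s: "L2_fun ?u s = indicat_real {-d..0} s *\<^sub>R (\<beta> s *v k)"
        show "delay_integrand d a0 t ?u s $ i
         = (\<Sum>j\<in>UNIV. (\<Sum>l\<in>UNIV. indicat_real {-d..0} s * (\<beta> s $ l $ j * ?g i l s)) * k $ j)"
        proof (cases "s \<in> {-d..0}")
          case True
          have "(mexp ((t + s) *\<^sub>R a0) *v (\<beta> s *v k)) $ i = (\<Sum>j\<in>UNIV. (\<Sum>l\<in>UNIV. \<beta> s $ l $ j * mexp ((t + s) *\<^sub>R a0) $ i $ l) * k $ j)"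
            unfolding matrix_vector_mul_assoc by (simp add: matrix_vector_mult_def matrix_matrix_mult_def mult.commute)
          moreover have "L2_fun ?u s = \<beta> s *v k" using s True by simp
          ultimately show ?thesis using True by (cases "s \<in> {-t..0}") simp_all
        next
          case False
          then show ?thesis by simp
        qed
      qed
    qed
    also have "\<dots> = (\<Sum>j\<in>UNIV. (\<Sum>l\<in>UNIV. LINT r|lborel. indicat_real {-d..0} r * (\<beta> r $ l $ j * ?g i l r)) * k $ j)"
    proof -
      have s: "integrable lborel (\<lambda>r. \<Sum>l\<in>UNIV. indicat_real {-d..0} r * (\<beta> r $ l $ j * ?g i l r))" for j
        by (intro Bochner_Integration.integrable_sum intg)
      have "(LINT r|lborel. (\<Sum>j\<in>UNIV. (\<Sum>l\<in>UNIV. indicat_real {-d..0} r * (\<beta> r $ l $ j * ?g i l r)) * k $ j))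
        = (\<Sum>j\<in>UNIV. (LINT r|lborel. (\<Sum>l\<in>UNIV. indicat_real {-d..0} r * (\<beta> r $ l $ j * ?g i l r)) * k $ j))"
        by (intro Bochner_Integration.integral_sum integrable_mult_left s)
      also have "\<dots> = (\<Sum>j\<in>UNIV. (LINT r|lborel. (\<Sum>l\<in>UNIV. indicat_real {-d..0} r * (\<beta> r $ l $ j * ?g i l r))) * k $ j)"
        by (intro sum.cong refl Bochner_Integration.integral_mult_left s)
      also have "\<dots> = (\<Sum>j\<in>UNIV. (\<Sum>l\<in>UNIV. LINT r|lborel. indicat_real {-d..0} r * (\<beta> r $ l $ j * ?g i l r)) * k $ j)"
        by (intro sum.cong refl arg_cong2[where f="(*)"] Bochner_Integration.integral_sum intg)
      finally show ?thesis .
    qed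
    finally show ?thesis .
  qed
  then have "(LINT s|lborel. delay_integrand d a0 t ?u s) = (\<chi> i j. \<Sum>l\<in>UNIV. signed_integral {-d..0} (\<lambda>E. b1 E $ l $ j) (?g i l)) *v k"
    by (simp add: vec_eq_iff matrix_vector_mult_def signed_integral_L2_density[OF \<beta> t] set_lebesgue_integral_def)
  then show ?thesis
    by (simp add: fst_sgA Bop_def etB0_def matrix_vector_mult_add_rdistrib matrix_vector_mul_assoc)
qed

section \<open>Regularity of the transition semigroup\<close>

text \<open>Restriction to lines through \<open>x\<close> shows that both gradients pair equally
  with every element of \<open>S\<close>. As gradients are required to lie in \<open>S\<close>,
  their difference may itself be used for testing.\<close>

lemma has_gradient_on_unique:
  assumes S: "subspace S" and x: "x \<in> S"
    and g: "has_gradient_on S f x g" and g': "has_gradient_on S f x g'"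
  shows "g = g'"
proof -
  have inner: "g \<bullet> h = g' \<bullet> h" if h: "h \<in> S" for h
  proof -
    have *: "((\<lambda>s. f (x + s *\<^sub>R h)) has_derivative (\<lambda>s. c \<bullet> (s *\<^sub>R h))) (at 0)"
      if c: "has_gradient_on S f x c" for c
    proof -
      have lin: "((\<lambda>s::real. x + s *\<^sub>R h) has_derivative (\<lambda>s. s *\<^sub>R h)) (at 0 within UNIV)"
        by (auto intro!: derivative_eq_intros)
      have "(f has_derivative (\<lambda>h. c \<bullet> h)) (at (x + 0 *\<^sub>R h) within range (\<lambda>s. x + s *\<^sub>R h))"
        using c h x S by (auto simp: has_gradient_on_def intro!: subspace_add subspace_scale
            elim!: has_derivative_subset)
      from has_derivative_in_compose[OF lin this] show ?thesis by simp
    qed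
    have "(\<lambda>s::real. g \<bullet> (s *\<^sub>R h)) = (\<lambda>s. g' \<bullet> (s *\<^sub>R h))"
      by (rule has_derivative_unique[OF *[OF g] *[OF g']])
    from fun_cong[OF this, of 1] show ?thesis by simp
  qed
  have "g - g' \<in> S" using g g' S by (auto simp: has_gradient_on_def intro: subspace_diff)
  from inner[OF this] have "(g - g') \<bullet> (g - g') = 0" by (simp add: inner_diff_left)
  then show ?thesis by simp
qed

lemma gradient_on_eq:
  assumes "subspace S" "x \<in> S" "has_gradient_on S f x g"
  shows "gradient_on S f x = g"
  unfolding gradient_on_def
  by (rule the_equality) (use assms has_gradient_on_unique in blast)+

lemma has_gradient_on_quadratic_remainder:
  assumes g: "g \<in> S" and x: "x \<in> S" and S: "subspace S"
    and rem: "\<And>h. h \<in> S \<Longrightarrow> \<bar>f (x + h) - f x - g \<bullet> h\<bar> \<le> K * (norm h)\<^sup>2"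
  shows "has_gradient_on S f x g"
  unfolding has_gradient_on_def
proof
  show "(f has_derivative (\<lambda>h. g \<bullet> h)) (at x within S)"
  proof (rule has_derivativeI_sandwich[of 1])
    show "bounded_linear (\<lambda>h. g \<bullet> h)" by (rule bounded_linear_inner_right)
    show "((\<lambda>y. K * norm (y - x)) \<longlongrightarrow> 0) (at x within S)"
      by (auto intro!: tendsto_eq_intros)
    fix y assume y: "y \<in> S" "y \<noteq> x"
    have "\<bar>f (x + (y - x)) - f x - g \<bullet> (y - x)\<bar> \<le> K * (norm (y - x))\<^sup>2"
      using x y S by (intro rem subspace_diff)
    then show "norm (f y - f x - g \<bullet> (y - x)) / norm (y - x) \<le> K * norm (y - x)"
      using y by (simp add: field_simps power2_eq_square)
  qed simp
qed (rule g)

lemma abs_le_SUP_abs: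
  fixes \<phi> :: "'a \<Rightarrow> real"
  assumes "bounded (range \<phi>)"
  shows "\<bar>\<phi> z\<bar> \<le> (SUP z. \<bar>\<phi> z\<bar>)"
proof -
  have "bdd_above (range (\<lambda>z. \<bar>\<phi> z\<bar>))"
    using assms by (auto simp: bounded_iff bdd_above_def)
  then show ?thesis by (rule cSUP_upper[OF UNIV_I])
qed

text \<open>The a priori constant \<open>C\<close> makes the real supremum in
  \<open>opnorm_on\<close> meaningful; the quotient at 0 is 0 by convention.\<close>

lemma norm_le_opnorm_on:
  assumes bd: "\<And>x. x \<in> S \<Longrightarrow> norm (f x) \<le> C * norm x" and x: "x \<in> S"
  shows "norm (f x) \<le> opnorm_on S f * norm x"
proof (cases "x = 0")
  case True
  then show ?thesis using bd[OF x] by simp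
next
  case False
  have "norm (f y) / norm y \<le> max C 0" if "y \<in> S" for y
    using bd[OF that] by (cases "y = 0") (auto simp: field_simps intro: order_trans)
  then have "bdd_above ((\<lambda>x. norm (f x) / norm x) ` S)" by (intro bdd_aboveI2)
  then have "norm (f x) / norm x \<le> opnorm_on S f"
    unfolding opnorm_on_def by (intro cSUP_upper x)
  then show ?thesis using False by (simp add: field_simps)
qed

lemma directional_gradient_unique:
  assumes "directional_gradient F D" "directional_gradient F D'"
  shows "D = D'"
proof (rule vector_eq_rdot[THEN iffD1], rule allI)
  fix k
  have "((\<lambda>s. (F s k - F 0 k) / s) \<longlongrightarrow> D \<bullet> k) (at 0)" "((\<lambda>s. (F s k - F 0 k) / s) \<longlongrightarrow> D' \<bullet> k) (at 0)"
    using assms by (auto simp: directional_gradient_def)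
  then show "D \<bullet> k = D' \<bullet> k" by (rule tendsto_unique[OF at_neq_bot])
qed

text \<open>Dividing the remainder by \<open>s\<close> leaves
  \<open>K * \<bar>s\<bar> * (norm k)\<^sup>2\<close>, which tends to 0 uniformly on the unit
  ball.\<close>

lemma directional_gradient_quadratic_remainder:
  fixes F :: "real \<Rightarrow> real^'m \<Rightarrow> real" and D :: "real^'m"
  assumes rem: "\<And>s k. \<bar>F s k - F 0 k - s * (D \<bullet> k)\<bar> \<le> K * s\<^sup>2 * (norm k)\<^sup>2" and K: "0 \<le> K"
  shows "directional_gradient F D"
proof -
  have quot: "\<bar>(F s k - F 0 k) / s - D \<bullet> k\<bar> \<le> K * \<bar>s\<bar> * (norm k)\<^sup>2" if s: "s \<noteq> 0" for s and k :: "real^'m"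
  proof -
    have "(F s k - F 0 k) / s - D \<bullet> k = (F s k - F 0 k - s * (D \<bullet> k)) / s"
      using s by (simp add: diff_divide_distrib)
    then have "\<bar>(F s k - F 0 k) / s - D \<bullet> k\<bar> = \<bar>F s k - F 0 k - s * (D \<bullet> k)\<bar> / \<bar>s\<bar>"
      by (simp only: abs_divide)
    also have "\<dots> \<le> K * s\<^sup>2 * (norm k)\<^sup>2 / \<bar>s\<bar>"
      by (intro divide_right_mono rem) simp
    also have "s\<^sup>2 = \<bar>s\<bar> * \<bar>s\<bar>" by (simp add: power2_eq_square)
    also have "K * (\<bar>s\<bar> * \<bar>s\<bar>) * (norm k)\<^sup>2 / \<bar>s\<bar> = K * \<bar>s\<bar> * (norm k)\<^sup>2"
    proof -
      have "K * (a * a) * b / a = K * a * b" if "a \<noteq> 0" for a b :: real using that by simp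
      then show ?thesis using s by (simp only: abs_eq_0 not_False_eq_True)
    qed
    finally show ?thesis .
  qed
  have near: "\<forall>\<^sub>F s in at (0::real). s \<noteq> 0" by (simp add: eventually_at_filter)
  show ?thesis
    unfolding directional_gradient_def
  proof (intro conjI allI)
    fix k :: "real^'m"
    have "((\<lambda>s. K * \<bar>s\<bar> * (norm k)\<^sup>2) \<longlongrightarrow> 0) (at 0)" by (auto intro!: tendsto_eq_intros)
    then have "((\<lambda>s. (F s k - F 0 k) / s - D \<bullet> k) \<longlongrightarrow> 0) (at 0)"
      by (rule Lim_null_comparison[rotated]) (use near quot in \<open>auto elim!: eventually_mono\<close>)
    then show "((\<lambda>s. (F s k - F 0 k) / s) \<longlongrightarrow> D \<bullet> k) (at 0)" by (simp add: Lim_null[symmetric])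
  next
    show "uniform_limit (cball 0 1) (\<lambda>s k. (F s k - F 0 k) / s) (\<lambda>k. D \<bullet> k) (at 0)"
    proof (rule uniform_limitI)
      fix e :: real assume e: "0 < e"
      have "((\<lambda>s::real. K * \<bar>s\<bar>) \<longlongrightarrow> 0) (at 0)" by (auto intro!: tendsto_eq_intros)
      then have "\<forall>\<^sub>F s in at 0. K * \<bar>s\<bar> < e" using e by (rule order_tendstoD(2))
      then show "\<forall>\<^sub>F s in at 0. \<forall>k\<in>cball 0 1. dist ((F s k - F 0 k) / s) (D \<bullet> k) < e"
        using near
      proof eventually_elim
        fix s :: real assume s: "K * \<bar>s\<bar> < e" "s \<noteq> 0"
        show "\<forall>k\<in>cball 0 1. dist ((F s k - F 0 k) / s) (D \<bullet> k) < e"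
        proof
          fix k :: "real^'m" assume "k \<in> cball 0 1"
          then have "(norm k)\<^sup>2 \<le> 1" by (simp add: power_le_one)
          then have "K * \<bar>s\<bar> * (norm k)\<^sup>2 \<le> K * \<bar>s\<bar> * 1" using K by (intro mult_left_mono) auto
          with quot[OF s(2), of k] s(1) show "dist ((F s k - F 0 k) / s) (D \<bullet> k) < e"
            by (simp add: dist_real_def)
        qed
      qed
    qed
  qed
qed

text \<open>With a density, any one of them fixes the directional limits. Otherwise the function
  \<open>g\<close> is determined on all of R^n by \<open>fst_sgA_onto\<close>, and the limits
  follow.\<close>

lemma has_B_gradient_unique:
  assumes d: "0 \<le> d" and t: "0 \<le> t"
    and D: "has_B_gradient d a0 b0 b1 t f x D" and D': "has_B_gradient d a0 b0 b1 t f x D'"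
  shows "D = D'"
proof (cases "\<exists>\<beta>. has_L2_density d b1 \<beta>")
  case True
  then show ?thesis
    using D D' directional_gradient_unique unfolding has_B_gradient_def by (metis (no_types, lifting))
next
  case False
  let ?F = "\<lambda>g s k. g (fst (sgA d a0 t x) + s *\<^sub>R (etB0 d a0 b0 b1 t *v k))"
  obtain g where g: "\<forall>y\<in>Hsp d. f y = g (fst (sgA d a0 t y))" "directional_gradient (?F g) D"
    using D False unfolding has_B_gradient_def by auto
  obtain g' where g': "\<forall>y\<in>Hsp d. f y = g' (fst (sgA d a0 t y))" "directional_gradient (?F g') D'"
    using D' False unfolding has_B_gradient_def by auto
  have "g v = g' v" for v
    using fst_sgA_onto[OF d t, of a0 v] g(1) g'(1) by metis
  then have "g = g'" by blast
  then show ?thesis using g(2) g'(2) directional_gradient_unique by blast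
qed

section \<open>The transition semigroup for invertible covariances\<close>

context
  fixes d :: real and a0 :: "real^'n^'n" and \<sigma> :: "real^'q^'n"
  assumes d_pos: "d > 0" and Q0_invertible: "\<And>t. t > 0 \<Longrightarrow> invertible (Qt0 a0 \<sigma> t)"
begin

lemma posQ: "t > 0 \<Longrightarrow> pos_def (Qt0 a0 \<sigma> t)"
  by (rule pos_def_Qt0[OF Q0_invertible])

text \<open>The form of \<open>Qt0\<close> increases in time, so its lower bound at
  \<open>t0\<close> serves for all later times.\<close>

lemma inv_msqrt_Qt0_bound_away_from_0:
  assumes "0 < t0"
  obtains C where "0 < C" "\<And>t k. t0 \<le> t \<Longrightarrow> norm (inv_msqrt (Qt0 a0 \<sigma> t) *v k) \<le> C * norm k"
proof -
  obtain c where c: "c > 0" "\<And>y. c * (norm y)\<^sup>2 \<le> y \<bullet> (Qt0 a0 \<sigma> t0 *v y)"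
    using posQ[OF assms] by (auto simp: pos_def_def)
  have "norm (inv_msqrt (Qt0 a0 \<sigma> t) *v k) \<le> 1 / sqrt c * norm k" if t: "t0 \<le> t" for t k
    using norm_inv_msqrt_le[OF posQ c(1), of t k] order_trans[OF c(2) Qt0_form_mono[OF t]] assms t by simp
  then show ?thesis using that[of "1 / sqrt c"] c by simp
qed

lemma kalman_range_exponent: "kalman_range a0 \<sigma> (kalman_exponent a0 \<sigma>) = UNIV"
  using LeastI_ex[OF kalman_range_eventually_UNIV[OF Q0_invertible[of 1]]]
  by (simp add: kalman_exponent_def kalman_range_def)

text \<open>The inverse square root of the lower bound of order \<open>2 * r + 1\<close> has order
  \<open>- r - 1 / 2\<close>.\<close>

lemma inv_msqrt_Qt0_kalman_bound:
  assumes "0 < T"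
  obtains C where "0 < C" "\<And>t k. 0 < t \<Longrightarrow> t \<le> T \<Longrightarrow>
    norm (inv_msqrt (Qt0 a0 \<sigma> t) *v k) \<le> C * t powr (- real (kalman_exponent a0 \<sigma>) - 1 / 2) * norm k"
proof -
  let ?r = "kalman_exponent a0 \<sigma>"
  obtain c where c: "c > 0"
    "\<And>t y. 0 < t \<Longrightarrow> t \<le> T \<Longrightarrow> c * t ^ (2 * ?r + 1) * (norm y)\<^sup>2 \<le> y \<bullet> (Qt0 a0 \<sigma> t *v y)"
    using Qt0_kalman_lower_bound[OF kalman_range_exponent assms] by blast
  have "norm (inv_msqrt (Qt0 a0 \<sigma> t) *v k) \<le> 1 / sqrt c * t powr (- real ?r - 1 / 2) * norm k"
    if t: "0 < t" "t \<le> T" for t k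
  proof -
    have 1: "norm (inv_msqrt (Qt0 a0 \<sigma> t) *v k) \<le> norm k / sqrt (c * t ^ (2 * ?r + 1))"
      by (rule norm_inv_msqrt_le[OF posQ[OF t(1)] _ c(2)[OF t]]) (use c t in simp)
    have "sqrt (t ^ (2 * ?r + 1)) = (t powr real (2 * ?r + 1)) powr (1 / 2)"
      using t by (simp add: powr_realpow powr_half_sqrt del: of_nat_add of_nat_mult of_nat_Suc)
    also have "\<dots> = t powr (real (2 * ?r + 1) * (1 / 2))" by (rule powr_powr)
    finally have "norm k / sqrt (c * t ^ (2 * ?r + 1)) = norm k / (sqrt c * t powr (real ?r + 1 / 2))"
      by (simp add: real_sqrt_mult add_divide_distrib add.commute)
    also have "\<dots> = 1 / sqrt c * t powr (- (real ?r + 1 / 2)) * norm k"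
      by (simp only: powr_minus) (simp add: divide_simps)
    finally show ?thesis using 1 by simp
  qed
  then show ?thesis using that[of "1 / sqrt c"] c by simp
qed

text \<open>By \<open>Qt0_add\<close> the factor is \<open>mexp (s *\<^sub>R a0)\<close> times the
  root of the covariance at time \<open>t - s\<close>. The case \<open>s = t\<close> is separate
  because \<open>posQ\<close> requires a positive time.\<close>

lemma Qt0_increment:
  assumes "0 < s" "s \<le> t"
  obtains A :: "real^'n^'n" where "Qt0 a0 \<sigma> t = Qt0 a0 \<sigma> s + A ** transpose A"
proof (cases "s = t")
  case True
  then show ?thesis using that[of 0] by simp
next
  case False
  let ?R = "msqrt (Qt0 a0 \<sigma> (t - s))"
  have R: "?R ** transpose ?R = Qt0 a0 \<sigma> (t - s)"
    by (rule msqrt_transpose_square[OF posQ]) (use False assms in simp)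
  have "(mexp (s *\<^sub>R a0) ** ?R) ** transpose (mexp (s *\<^sub>R a0) ** ?R)
    = mexp (s *\<^sub>R a0) ** (?R ** transpose ?R) ** mexp (s *\<^sub>R transpose a0)"
    by (simp only: matrix_transpose_mul transpose_mexp_scaleR matrix_mul_assoc)
  also have "\<dots> = mexp (s *\<^sub>R a0) ** Qt0 a0 \<sigma> (t - s) ** mexp (s *\<^sub>R transpose a0)"
    by (simp only: R)
  finally show ?thesis
    using that[of "mexp (s *\<^sub>R a0) ** ?R"] Qt0_add[of s "t - s" a0 \<sigma>] assms by simp
qed

context
  fixes \<phi> :: "real^'n \<Rightarrow> real" and M :: real
  assumes meas: "\<phi> \<in> borel_measurable borel" and bd: "\<And>z. \<bar>\<phi> z\<bar> \<le> M"
begin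

lemma M_nonneg: "0 \<le> M"
  using bd[of 0] by linarith

lemma Rt_eq_gauss_shift_avg:
  "t > 0 \<Longrightarrow> Rt d a0 \<sigma> t (\<lambda>y. \<phi> (fst y)) x = gauss_shift_avg \<phi> (Qt0 a0 \<sigma> t) (fst (sgA d a0 t x))"
  unfolding gauss_shift_avg_def by (rule Rt_eq[OF meas msqrt_transpose_square[OF posQ]])

text \<open>The covariance comparison requires ordered times. The absolute values under the roots
  make the bound symmetric, so the opposite order follows by exchanging the two times.\<close>

lemma gauss_shift_avg_time_diff:
  assumes s: "0 < s" "s \<le> t" "s \<le> t'"
    and C: "0 \<le> C" "\<And>t k. s \<le> t \<Longrightarrow> norm (inv_msqrt (Qt0 a0 \<sigma> t) *v k) \<le> C * norm k"
  shows "\<bar>gauss_shift_avg \<phi> (Qt0 a0 \<sigma> t') v' - gauss_shift_avg \<phi> (Qt0 a0 \<sigma> t) v\<bar>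
    \<le> 2 * M * C * (norm (v' - v) + (\<Sum>i\<in>UNIV. sqrt \<bar>(Qt0 a0 \<sigma> t' - Qt0 a0 \<sigma> t) $ i $ i\<bar>))"
proof -
  have *: "\<bar>gauss_shift_avg \<phi> (Qt0 a0 \<sigma> t') v' - gauss_shift_avg \<phi> (Qt0 a0 \<sigma> t) v\<bar>
    \<le> 2 * M * C * (norm (v' - v) + (\<Sum>i\<in>UNIV. sqrt \<bar>(Qt0 a0 \<sigma> t' - Qt0 a0 \<sigma> t) $ i $ i\<bar>))"
    if t: "s \<le> t" "t \<le> t'" for t t' v v'
  proof -
    have t0: "0 < t" "0 < t'" using s t by auto
    obtain A :: "real^'n^'n" where A: "Qt0 a0 \<sigma> t' = Qt0 a0 \<sigma> t + A ** transpose A"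
      using Qt0_increment[OF t0(1) t(2)] by blast
    have "\<bar>gauss_shift_avg \<phi> (Qt0 a0 \<sigma> t') v' - gauss_shift_avg \<phi> (Qt0 a0 \<sigma> t) v\<bar>
      \<le> 2 * M * C * (norm (v' - v) + (\<Sum>i\<in>UNIV. sqrt ((Qt0 a0 \<sigma> t' - Qt0 a0 \<sigma> t) $ i $ i)))"
      by (rule gauss_shift_avg_covariance[OF meas bd posQ[OF t0(1)] posQ[OF t0(2)] A C(1) C(2)[OF t(1)]])
    also have "\<dots> \<le> 2 * M * C * (norm (v' - v) + (\<Sum>i\<in>UNIV. sqrt \<bar>(Qt0 a0 \<sigma> t' - Qt0 a0 \<sigma> t) $ i $ i\<bar>))"
      using M_nonneg C by (intro mult_left_mono add_left_mono sum_mono real_sqrt_le_mono) auto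
    finally show ?thesis .
  qed
  show ?thesis
  proof (cases "t \<le> t'")
    case True
    then show ?thesis using *[OF s(2)] by blast
  next
    case False
    then have "t' \<le> t" by simp
    have e: "\<bar>(Qt0 a0 \<sigma> t - Qt0 a0 \<sigma> t') $ i $ i\<bar> = \<bar>(Qt0 a0 \<sigma> t' - Qt0 a0 \<sigma> t) $ i $ i\<bar>" for i
      by (simp add: abs_minus_commute)
    show ?thesis
      using *[OF s(3) \<open>t' \<le> t\<close>, of v v']
      unfolding e norm_minus_commute[of v v'] abs_minus_commute[of "gauss_shift_avg \<phi> (Qt0 a0 \<sigma> t) v"] .
  qed
qed

lemma continuous_on_gauss_shift_avg:
  "continuous_on ({0<..} \<times> UNIV) (\<lambda>(t, v). gauss_shift_avg \<phi> (Qt0 a0 \<sigma> t) v)"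
  unfolding continuous_on_def
proof
  fix p :: "real \<times> (real^'n)" assume "p \<in> {0<..} \<times> UNIV"
  then obtain t v where p: "p = (t, v)" and t: "0 < t" by auto
  \<comment> \<open>Starting at \<open>t / 2\<close> keeps one constant valid for all times near
    \<open>t\<close>, earlier ones included.\<close>
  obtain C where C: "0 < C" "\<And>s k. t / 2 \<le> s \<Longrightarrow> norm (inv_msqrt (Qt0 a0 \<sigma> s) *v k) \<le> C * norm k"
    using inv_msqrt_Qt0_bound_away_from_0[of "t / 2"] t by auto
  let ?S = "{0<..} \<times> (UNIV :: (real^'n) set)"
  let ?F = "at p within ?S"
  let ?G = "\<lambda>q. gauss_shift_avg \<phi> (Qt0 a0 \<sigma> (fst q)) (snd q)"
  have f1: "(fst \<longlongrightarrow> t) ?F" and f2: "(snd \<longlongrightarrow> v) ?F"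
    using tendsto_fst[OF tendsto_ident_at, of p ?S] tendsto_snd[OF tendsto_ident_at, of p ?S] by (simp_all add: p)
  have lo: "\<forall>\<^sub>F q in ?F. t / 2 < fst q" by (rule order_tendstoD(1)[OF f1]) (use t in simp)
  have hi: "\<forall>\<^sub>F q in ?F. fst q < t + 1" by (rule order_tendstoD(2)[OF f1]) simp
  have inn: "\<forall>\<^sub>F q in ?F. fst q \<in> {0..t + 1}"
    using lo hi by eventually_elim (use t in auto)
  have Q: "((\<lambda>q. Qt0 a0 \<sigma> (fst q)) \<longlongrightarrow> Qt0 a0 \<sigma> t) ?F"
    by (rule continuous_on_tendsto_compose[OF continuous_on_Qt0[of "t + 1"] f1])
      (use t inn in auto)
  let ?B = "\<lambda>q. 2 * M * C * (norm (snd q - v) + (\<Sum>i\<in>UNIV. sqrt \<bar>(Qt0 a0 \<sigma> (fst q) - Qt0 a0 \<sigma> t) $ i $ i\<bar>))"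
  have "(?B \<longlongrightarrow> 2 * M * C * (norm (v - v) + (\<Sum>i\<in>UNIV. sqrt \<bar>(Qt0 a0 \<sigma> t - Qt0 a0 \<sigma> t) $ i $ i\<bar>))) ?F"
    by (intro tendsto_intros f2 Q)
  then have lim: "(?B \<longlongrightarrow> 0) ?F" by simp
  have "\<forall>\<^sub>F q in ?F. norm (?G q - gauss_shift_avg \<phi> (Qt0 a0 \<sigma> t) v) \<le> ?B q"
    using lo
  proof eventually_elim
    fix q :: "real \<times> (real^'n)" assume "t / 2 < fst q"
    then have "\<bar>?G q - gauss_shift_avg \<phi> (Qt0 a0 \<sigma> t) v\<bar> \<le> ?B q"
      by (intro gauss_shift_avg_time_diff[of "t / 2"]) (use t C in auto)
    then show "norm (?G q - gauss_shift_avg \<phi> (Qt0 a0 \<sigma> t) v) \<le> ?B q" by simp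
  qed
  then have "((\<lambda>q. ?G q - gauss_shift_avg \<phi> (Qt0 a0 \<sigma> t) v) \<longlongrightarrow> 0) ?F"
    by (rule Lim_null_comparison[OF _ lim])
  then show "((\<lambda>(t, v). gauss_shift_avg \<phi> (Qt0 a0 \<sigma> t) v) \<longlongrightarrow> (case p of (t, v) \<Rightarrow> gauss_shift_avg \<phi> (Qt0 a0 \<sigma> t) v)) ?F"
    by (simp add: Lim_null[symmetric] p case_prod_beta')
qed

lemma continuous_on_Rt: "continuous_on ({0<..} \<times> Hsp d) (\<lambda>(t, x). Rt d a0 \<sigma> t (\<lambda>y. \<phi> (fst y)) x)"
proof -
  have 1: "continuous_on ({0<..} \<times> Hsp d) (\<lambda>(t, x). fst (sgA d a0 t x))"
    by (rule continuous_on_subset[OF continuous_on_fst_sgA]) (use d_pos in auto)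
  have "continuous_on ({0<..} \<times> Hsp d) (\<lambda>q. (\<lambda>(t, v). gauss_shift_avg \<phi> (Qt0 a0 \<sigma> t) v) (fst q, (\<lambda>(t, x). fst (sgA d a0 t x)) q))"
    by (rule continuous_on_compose2[OF continuous_on_gauss_shift_avg]) (auto intro!: continuous_intros 1)
  then show ?thesis
    by (rule continuous_on_eq) (auto simp: Rt_eq_gauss_shift_avg)
qed

lemma bounded_Rt: "t > 0 \<Longrightarrow> \<bar>Rt d a0 \<sigma> t (\<lambda>y. \<phi> (fst y)) x\<bar> \<le> M"
  by (simp add: Rt_eq_gauss_shift_avg gauss_shift_avg_le[OF meas bd posQ])

lemma Lipschitz_Rt:
  assumes "0 < t0"
  shows "\<exists>L. \<forall>t\<in>{t0..t1}. L-lipschitz_on (Hsp d) (Rt d a0 \<sigma> t (\<lambda>y. \<phi> (fst y)))"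
proof -
  obtain C where C: "0 < C" "\<And>t k. t0 \<le> t \<Longrightarrow> norm (inv_msqrt (Qt0 a0 \<sigma> t) *v k) \<le> C * norm k"
    using inv_msqrt_Qt0_bound_away_from_0[OF assms] by blast
  obtain K where K: "0 < K" "\<And>t x. 0 \<le> t \<Longrightarrow> t \<le> t1 \<Longrightarrow> norm (fst (sgA d a0 t x)) \<le> K * norm x"
    using fst_sgA_bound[of d t1 a0] d_pos by auto
  have "(2 * M * (C * K))-lipschitz_on (Hsp d) (Rt d a0 \<sigma> t (\<lambda>y. \<phi> (fst y)))" if t: "t \<in> {t0..t1}" for t
  proof (rule lipschitz_onI)
    have t0: "0 < t" using t assms by auto
    fix x y
    have "dist (Rt d a0 \<sigma> t (\<lambda>y. \<phi> (fst y)) x) (Rt d a0 \<sigma> t (\<lambda>y. \<phi> (fst y)) y)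
      \<le> 2 * M * norm (inv_msqrt (Qt0 a0 \<sigma> t) *v (fst (sgA d a0 t x) - fst (sgA d a0 t y)))"
      unfolding dist_real_def Rt_eq_gauss_shift_avg[OF t0]
      by (rule gauss_shift_avg_Lipschitz[OF meas bd posQ[OF t0]])
    also have "\<dots> \<le> 2 * M * (C * (K * norm (x - y)))"
      using t t0 C K M_nonneg d_pos
      by (intro mult_left_mono order_trans[OF C(2)]) (auto simp: fst_sgA_diff[symmetric])
    finally show "dist (Rt d a0 \<sigma> t (\<lambda>y. \<phi> (fst y)) x) (Rt d a0 \<sigma> t (\<lambda>y. \<phi> (fst y)) y)
      \<le> 2 * M * (C * K) * dist x y" by (simp add: dist_norm mult.assoc)
  qed (use C K M_nonneg in simp)
  then show ?thesis by blast
qed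

text \<open>The candidate is \<open>adj0 d a0 t q\<close> for the vector \<open>q\<close>
  representing the finite-dimensional derivative: it lies in \<open>Hsp d\<close> and pairs with
  \<open>h\<close> as \<open>q\<close> pairs with the first component of the semigroup at
  \<open>h\<close>. The quadratic Taylor remainder makes it the gradient.\<close>

lemma Rt_gradient:
  fixes x h :: "(real^'n) \<times> (real^'n) L2"
  assumes t: "0 < t" and x: "x \<in> Hsp d"
  shows "has_gradient_on (Hsp d) (Rt d a0 \<sigma> t (\<lambda>y. \<phi> (fst y))) x
      (gradient_on (Hsp d) (Rt d a0 \<sigma> t (\<lambda>y. \<phi> (fst y))) x)" (is ?G)
    and "gradient_on (Hsp d) (Rt d a0 \<sigma> t (\<lambda>y. \<phi> (fst y))) x \<bullet> h
      = gauss_dir_deriv \<phi> (Qt0 a0 \<sigma> t) (fst (sgA d a0 t x)) (fst (sgA d a0 t h))" (is ?D)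
proof -
  let ?Q = "Qt0 a0 \<sigma> t" and ?v = "\<lambda>x. fst (sgA d a0 t x)" and ?f = "Rt d a0 \<sigma> t (\<lambda>y. \<phi> (fst y))"
  have t0: "0 \<le> t" using t by simp
  obtain q where q: "\<And>k. gauss_dir_deriv \<phi> ?Q (?v x) k = q \<bullet> k"
    using gauss_dir_deriv_represent[OF meas bd posQ[OF t]] by blast
  let ?g = "adj0 d a0 t q"
  have g: "?g \<bullet> h = gauss_dir_deriv \<phi> ?Q (?v x) (?v h)" for h
    unfolding q using fst_sgA_inner[OF t0, of d a0 h q] by (simp add: inner_commute)
  obtain C where C: "0 < C" "\<And>t' k. t \<le> t' \<Longrightarrow> norm (inv_msqrt (Qt0 a0 \<sigma> t') *v k) \<le> C * norm k"
    using inv_msqrt_Qt0_bound_away_from_0[OF t] by blast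
  obtain K where K: "0 < K" "\<And>s x. 0 \<le> s \<Longrightarrow> s \<le> t \<Longrightarrow> norm (fst (sgA d a0 s x)) \<le> K * norm x"
    using fst_sgA_bound[of d t a0] d_pos by auto
  have grad: "has_gradient_on (Hsp d) ?f x ?g"
  proof (rule has_gradient_on_quadratic_remainder[OF adj0_in_Hsp x subspace_Hsp])
    fix h :: "(real^'n) \<times> (real^'n) L2" assume "h \<in> Hsp d"
    have "\<bar>?f (x + h) - ?f x - ?g \<bullet> h\<bar> \<le> M * (norm (inv_msqrt ?Q *v ?v h))\<^sup>2"
      unfolding g Rt_eq_gauss_shift_avg[OF t] using d_pos
      by (subst fst_sgA_add[OF _ t0]) (auto intro: gauss_shift_avg_Taylor[OF meas bd posQ[OF t]])
    also have "\<dots> \<le> M * (C * (K * norm h))\<^sup>2"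
      using C K t0 M_nonneg by (intro mult_left_mono power_mono order_trans[OF C(2)]) auto
    finally show "\<bar>?f (x + h) - ?f x - ?g \<bullet> h\<bar> \<le> M * (C * K)\<^sup>2 * (norm h)\<^sup>2"
      by (simp add: power_mult_distrib mult_ac)
  qed
  have eq: "gradient_on (Hsp d) ?f x = ?g" by (rule gradient_on_eq[OF subspace_Hsp x grad])
  show ?G unfolding eq by (rule grad)
  show ?D unfolding eq by (rule g)
qed

lemma Rt_gradient_le:
  fixes x h :: "(real^'n) \<times> (real^'n) L2"
  assumes t: "0 < t" and x: "x \<in> Hsp d"
  shows "\<bar>gradient_on (Hsp d) (Rt d a0 \<sigma> t (\<lambda>y. \<phi> (fst y))) x \<bullet> h\<bar>
    \<le> M * norm (inv_msqrt (Qt0 a0 \<sigma> t) *v fst (sgA d a0 t h))"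
  unfolding Rt_gradient(2)[OF t x] by (rule gauss_dir_deriv_le[OF meas bd posQ[OF t]])

lemma Rt_gradient_le_opnorm:
  fixes x h :: "(real^'n) \<times> (real^'n) L2"
  assumes t: "0 < t" and x: "x \<in> Hsp d" and h: "h \<in> Hsp d"
  shows "\<bar>gradient_on (Hsp d) (Rt d a0 \<sigma> t (\<lambda>y. \<phi> (fst y))) x \<bullet> h\<bar>
    \<le> M * opnorm_on (Hsp d) (\<lambda>y. inv_msqrt (Qt0 a0 \<sigma> t) *v fst (sgA d a0 t y)) * norm h"
proof -
  obtain C where C: "0 < C" "\<And>t' k. t \<le> t' \<Longrightarrow> norm (inv_msqrt (Qt0 a0 \<sigma> t') *v k) \<le> C * norm k"
    using inv_msqrt_Qt0_bound_away_from_0[OF t] by blast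
  obtain K where K: "0 < K" "\<And>s x. 0 \<le> s \<Longrightarrow> s \<le> t \<Longrightarrow> norm (fst (sgA d a0 s x)) \<le> K * norm x"
    using fst_sgA_bound[of d t a0] d_pos by auto
  have "norm (inv_msqrt (Qt0 a0 \<sigma> t) *v fst (sgA d a0 t y)) \<le> C * K * norm y" for y
    using order_trans[OF C(2)[OF order_refl] mult_left_mono[OF K(2)]] C t by (simp add: mult.assoc)
  then have "norm (inv_msqrt (Qt0 a0 \<sigma> t) *v fst (sgA d a0 t h))
    \<le> opnorm_on (Hsp d) (\<lambda>y. inv_msqrt (Qt0 a0 \<sigma> t) *v fst (sgA d a0 t y)) * norm h"
    by (rule norm_le_opnorm_on[OF _ h])
  then show ?thesis
    using order_trans[OF Rt_gradient_le[OF t x, of h] mult_left_mono[OF _ M_nonneg]] by (simp add: mult.assoc)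
qed

context
  fixes b0 :: "real^'m^'n" and b1 :: "real set \<Rightarrow> real^'m^'n"
begin

text \<open>The candidate is \<open>transpose (etB0 d a0 b0 b1 t) *v q\<close>. One directional
  expansion in R^n serves both cases: with a density, linearity and \<open>fst_sgA_Bop\<close> carry
  \<open>x + s *\<^sub>R Bop d b0 \<beta> k\<close> to it; otherwise \<open>g\<close> is the
  Gaussian average itself.\<close>

lemma Rt_B_gradient:
  assumes t: "0 < t"
  shows "has_B_gradient d a0 b0 b1 t (Rt d a0 \<sigma> t (\<lambda>y. \<phi> (fst y))) x
      (B_gradient d a0 b0 b1 t (Rt d a0 \<sigma> t (\<lambda>y. \<phi> (fst y))) x)" (is ?G)
    and "B_gradient d a0 b0 b1 t (Rt d a0 \<sigma> t (\<lambda>y. \<phi> (fst y))) x \<bullet> k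
      = gauss_dir_deriv \<phi> (Qt0 a0 \<sigma> t) (fst (sgA d a0 t x)) (etB0 d a0 b0 b1 t *v k)" (is ?D)
proof -
  let ?Q = "Qt0 a0 \<sigma> t" and ?v = "fst (sgA d a0 t x)" and ?f = "Rt d a0 \<sigma> t (\<lambda>y. \<phi> (fst y))"
  let ?E = "etB0 d a0 b0 b1 t" and ?P = "gauss_shift_avg \<phi> (Qt0 a0 \<sigma> t)"
  have t0: "0 \<le> t" and d0: "0 \<le> d" using t d_pos by simp_all
  obtain q where q: "\<And>k. gauss_dir_deriv \<phi> ?Q ?v k = q \<bullet> k"
    using gauss_dir_deriv_represent[OF meas bd posQ[OF t]] by blast
  define D where "D = transpose ?E *v q"
  have D: "D \<bullet> k = gauss_dir_deriv \<phi> ?Q ?v (?E *v k)" for k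
    unfolding q D_def by (simp add: inner_matrix_vector[of q])
  let ?N = "onorm ((*v) (inv_msqrt ?Q ** ?E))"
  have dir: "directional_gradient (\<lambda>s k. ?P (?v + s *\<^sub>R (?E *v k))) D"
  proof (rule directional_gradient_quadratic_remainder)
    fix s and k :: "real^'m"
    have "\<bar>?P (?v + s *\<^sub>R (?E *v k)) - ?P ?v - gauss_dir_deriv \<phi> ?Q ?v (s *\<^sub>R (?E *v k))\<bar>
      \<le> M * (norm (inv_msqrt ?Q *v (s *\<^sub>R (?E *v k))))\<^sup>2"
      by (rule gauss_shift_avg_Taylor[OF meas bd posQ[OF t]])
    also have "gauss_dir_deriv \<phi> ?Q ?v (s *\<^sub>R (?E *v k)) = s * (D \<bullet> k)"
      unfolding D by (simp add: q)
    also have "norm (inv_msqrt ?Q *v (s *\<^sub>R (?E *v k))) = \<bar>s\<bar> * norm ((inv_msqrt ?Q ** ?E) *v k)"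
      by (simp add: matrix_vector_mult_scaleR matrix_vector_mul_assoc)
    also have "M * (\<bar>s\<bar> * norm ((inv_msqrt ?Q ** ?E) *v k))\<^sup>2 \<le> M * (\<bar>s\<bar> * (?N * norm k))\<^sup>2"
      by (intro mult_left_mono power_mono onorm M_nonneg) simp_all
    also have "\<dots> = M * ?N\<^sup>2 * s\<^sup>2 * (norm k)\<^sup>2" by (simp add: power_mult_distrib)
    finally show "\<bar>?P (?v + s *\<^sub>R (?E *v k)) - ?P (?v + 0 *\<^sub>R (?E *v k)) - s * (D \<bullet> k)\<bar> \<le> M * ?N\<^sup>2 * s\<^sup>2 * (norm k)\<^sup>2"
      by simp
  qed (use M_nonneg in simp)
  have grad: "has_B_gradient d a0 b0 b1 t ?f x D"
  proof (cases "\<exists>\<beta>. has_L2_density d b1 \<beta>")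
    case True
    have "directional_gradient (\<lambda>s k. ?f (x + s *\<^sub>R Bop d b0 \<beta> k)) D" if \<beta>: "has_L2_density d b1 \<beta>" for \<beta>
    proof -
      have "(\<lambda>s k. ?f (x + s *\<^sub>R Bop d b0 \<beta> k)) = (\<lambda>s k. ?P (?v + s *\<^sub>R (?E *v k)))"
        by (simp add: Rt_eq_gauss_shift_avg[OF t] fst_sgA_add[OF d0 t0] fst_sgA_scaleR[OF d0 t0] fst_sgA_Bop[OF \<beta> t0])
      then show ?thesis using dir by simp
    qed
    then show ?thesis using True by (simp add: has_B_gradient_def)
  next
    case False
    then show ?thesis
      unfolding has_B_gradient_def using dir Rt_eq_gauss_shift_avg[OF t] by auto
  qed
  have eq: "B_gradient d a0 b0 b1 t ?f x = D"
    unfolding B_gradient_def using grad has_B_gradient_unique[OF d0 t0] by blast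
  show ?G unfolding eq by (rule grad)
  show ?D unfolding eq by (rule D)
qed

lemma Rt_B_gradient_le:
  assumes t: "0 < t"
  shows "\<bar>B_gradient d a0 b0 b1 t (Rt d a0 \<sigma> t (\<lambda>y. \<phi> (fst y))) x \<bullet> k\<bar>
    \<le> M * norm (inv_msqrt (Qt0 a0 \<sigma> t) *v (etB0 d a0 b0 b1 t *v k))"
  unfolding Rt_B_gradient(2)[OF t] by (rule gauss_dir_deriv_le[OF meas bd posQ[OF t]])

lemma Rt_B_gradient_le_onorm:
  assumes t: "0 < t"
  shows "\<bar>B_gradient d a0 b0 b1 t (Rt d a0 \<sigma> t (\<lambda>y. \<phi> (fst y))) x \<bullet> k\<bar>
    \<le> M * onorm (\<lambda>y. inv_msqrt (Qt0 a0 \<sigma> t) *v (etB0 d a0 b0 b1 t *v y)) * norm k"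
proof -
  have "norm (inv_msqrt (Qt0 a0 \<sigma> t) *v (etB0 d a0 b0 b1 t *v k))
    \<le> onorm (\<lambda>y. inv_msqrt (Qt0 a0 \<sigma> t) *v (etB0 d a0 b0 b1 t *v y)) * norm k"
    by (rule onorm) (simp add: matrix_vector_mul_assoc)
  then show ?thesis
    using order_trans[OF Rt_B_gradient_le[OF t, of x k] mult_left_mono[OF _ M_nonneg]] by (simp add: mult.assoc)
qed

end

end

text \<open>The constant is the product of the one for \<open>inv_msqrt\<close> and the bound of the
  first semigroup component on \<open>{0..T}\<close>; both are fixed before the function, the time
  and the points are chosen.\<close>

lemma Rt_gradient_kalman_bound:
  assumes T: "T > 0"
  shows "\<exists>C. \<forall>\<phi>::real^'n \<Rightarrow> real. \<phi> \<in> borel_measurable borel \<longrightarrow> bounded (range \<phi>) \<longrightarrow>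
        (\<forall>t\<in>{0<..T}. \<forall>x\<in>Hsp d. \<forall>h\<in>Hsp d.
           \<bar>gradient_on (Hsp d) (Rt d a0 \<sigma> t (\<lambda>y. \<phi> (fst y))) x \<bullet> h\<bar> \<le>
             C * t powr (- real (kalman_exponent a0 \<sigma>) - 1/2) * (SUP z. \<bar>\<phi> z\<bar>) * norm h)"
proof -
  let ?e = "- real (kalman_exponent a0 \<sigma>) - 1 / 2"
  obtain C where C: "0 < C" "\<And>t k. 0 < t \<Longrightarrow> t \<le> T \<Longrightarrow> norm (inv_msqrt (Qt0 a0 \<sigma> t) *v k) \<le> C * t powr ?e * norm k"
    using inv_msqrt_Qt0_kalman_bound[OF T] by blast
  obtain K where K: "0 < K" "\<And>s x. 0 \<le> s \<Longrightarrow> s \<le> T \<Longrightarrow> norm (fst (sgA d a0 s x)) \<le> K * norm x"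
    using fst_sgA_bound[of d T a0] d_pos by auto
  show ?thesis
  proof (intro exI[of _ "C * K"] allI impI ballI)
    fix \<phi> :: "real^'n \<Rightarrow> real" and t and x h :: "(real^'n) \<times> (real^'n) L2"
    assume meas: "\<phi> \<in> borel_measurable borel" and bounded: "bounded (range \<phi>)"
      and "t \<in> {0<..T}" and x: "x \<in> Hsp d"
    then have t: "0 < t" "t \<le> T" by auto
    let ?M = "SUP z. \<bar>\<phi> z\<bar>"
    note bd = abs_le_SUP_abs[OF bounded]
    have M: "0 \<le> ?M" using order_trans[OF abs_ge_zero bd[of 0]] .
    have "\<bar>gradient_on (Hsp d) (Rt d a0 \<sigma> t (\<lambda>y. \<phi> (fst y))) x \<bullet> h\<bar>
      \<le> ?M * norm (inv_msqrt (Qt0 a0 \<sigma> t) *v fst (sgA d a0 t h))"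
      by (rule Rt_gradient_le[OF meas bd t(1) x])
    also have "\<dots> \<le> ?M * (C * t powr ?e * norm (fst (sgA d a0 t h)))"
      by (intro mult_left_mono C t M)
    also have "\<dots> \<le> ?M * (C * t powr ?e * (K * norm h))"
      using t C M by (intro mult_left_mono K) auto
    finally show "\<bar>gradient_on (Hsp d) (Rt d a0 \<sigma> t (\<lambda>y. \<phi> (fst y))) x \<bullet> h\<bar> \<le> C * K * t powr ?e * ?M * norm h"
      by (simp add: mult_ac)
  qed
qed

text \<open>As for the gradient, with \<open>etB0_bound\<close> supplying the second constant; there
  the finiteness of the signed measures enters.\<close>

lemma Rt_B_gradient_kalman_bound:
  fixes b0 :: "real^'m^'n" and b1 :: "real set \<Rightarrow> real^'m^'n"
  assumes b1: "\<And>i j. finite_signed_measure_on {-d..0} (\<lambda>E. b1 E $ i $ j)" and T: "T > 0"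
  shows "\<exists>C. \<forall>\<phi>::real^'n \<Rightarrow> real. \<phi> \<in> borel_measurable borel \<longrightarrow> bounded (range \<phi>) \<longrightarrow>
        (\<forall>t\<in>{0<..T}. \<forall>x\<in>Hsp d. \<forall>k.
           \<bar>B_gradient d a0 b0 b1 t (Rt d a0 \<sigma> t (\<lambda>y. \<phi> (fst y))) x \<bullet> k\<bar> \<le>
             C * t powr (- real (kalman_exponent a0 \<sigma>) - 1/2) * (SUP z. \<bar>\<phi> z\<bar>) * norm k)"
proof -
  let ?e = "- real (kalman_exponent a0 \<sigma>) - 1 / 2"
  obtain C where C: "0 < C" "\<And>t k. 0 < t \<Longrightarrow> t \<le> T \<Longrightarrow> norm (inv_msqrt (Qt0 a0 \<sigma> t) *v k) \<le> C * t powr ?e * norm k"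
    using inv_msqrt_Qt0_kalman_bound[OF T] by blast
  obtain K where K: "0 < K" "\<And>s k. 0 \<le> s \<Longrightarrow> s \<le> T \<Longrightarrow> norm (etB0 d a0 b0 b1 s *v k) \<le> K * norm k"
    using etB0_bound[OF b1] by blast
  show ?thesis
  proof (intro exI[of _ "C * K"] allI impI ballI)
    fix \<phi> :: "real^'n \<Rightarrow> real" and t and x :: "(real^'n) \<times> (real^'n) L2" and k :: "real^'m"
    assume meas: "\<phi> \<in> borel_measurable borel" and bounded: "bounded (range \<phi>)" and "t \<in> {0<..T}"
    then have t: "0 < t" "t \<le> T" by auto
    let ?M = "SUP z. \<bar>\<phi> z\<bar>"
    note bd = abs_le_SUP_abs[OF bounded]
    have M: "0 \<le> ?M" using order_trans[OF abs_ge_zero bd[of 0]] .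
    have "\<bar>B_gradient d a0 b0 b1 t (Rt d a0 \<sigma> t (\<lambda>y. \<phi> (fst y))) x \<bullet> k\<bar>
      \<le> ?M * norm (inv_msqrt (Qt0 a0 \<sigma> t) *v (etB0 d a0 b0 b1 t *v k))"
      by (rule Rt_B_gradient_le[OF meas bd t(1)])
    also have "\<dots> \<le> ?M * (C * t powr ?e * norm (etB0 d a0 b0 b1 t *v k))"
      by (intro mult_left_mono C t M)
    also have "\<dots> \<le> ?M * (C * t powr ?e * (K * norm k))"
      using t C M by (intro mult_left_mono K) auto
    finally show "\<bar>B_gradient d a0 b0 b1 t (Rt d a0 \<sigma> t (\<lambda>y. \<phi> (fst y))) x \<bullet> k\<bar> \<le> C * K * t powr ?e * ?M * norm k"
      by (simp add: mult_ac)
  qed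
qed

end

text \<open>For \<open>r = 0\<close> the block operator is \<open>\<sigma>\<close> itself. The
  existence of some full range guarantees that the value of \<open>LEAST\<close> satisfies the
  condition it minimises over.\<close>

lemma kalman_exponent_eq_0_iff:
  assumes "\<exists>r. kalman_range a0 \<sigma> r = UNIV"
  shows "kalman_exponent a0 \<sigma> = 0 \<longleftrightarrow> surj (\<lambda>y. \<sigma> *v y)"
proof -
  have ex: "kalman_exponent a0 \<sigma> = (LEAST r. kalman_range a0 \<sigma> r = UNIV)"
    by (simp add: kalman_exponent_def kalman_range_def)
  have "kalman_range a0 \<sigma> 0 = range (\<lambda>u::nat \<Rightarrow> real^'b. \<sigma> *v u 0)"
    by (simp add: kalman_range_def)
  also have "\<dots> = range (\<lambda>y. \<sigma> *v y)"
  proof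
    show "range (\<lambda>y. \<sigma> *v y) \<subseteq> range (\<lambda>u::nat \<Rightarrow> real^'b. \<sigma> *v u 0)"
    proof
      fix z assume "z \<in> range (\<lambda>y. \<sigma> *v y)"
      then obtain y where "z = \<sigma> *v y" by blast
      then show "z \<in> range (\<lambda>u::nat \<Rightarrow> real^'b. \<sigma> *v u 0)" by (intro range_eqI[where x="\<lambda>_. y"])
    qed
  qed auto
  finally have 0: "kalman_range a0 \<sigma> 0 = range (\<lambda>y. \<sigma> *v y)" .
  show ?thesis
  proof
    assume "kalman_exponent a0 \<sigma> = 0"
    then have "kalman_range a0 \<sigma> 0 = UNIV" using LeastI_ex[OF assms] ex by simp
    then show "surj (\<lambda>y. \<sigma> *v y)" using 0 by simp
  next
    assume "surj (\<lambda>y. \<sigma> *v y)"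
    then show "kalman_exponent a0 \<sigma> = 0" unfolding ex using 0 by (intro Least_eq_0) simp
  qed
qed

theorem proposition4p9:
  fixes d :: real
    and a0 :: "real^'n^'n" and \<sigma> :: "real^'q^'n"
    and b0 :: "real^'m^'n" and b1 :: "real set \<Rightarrow> real^'m^'n"
  assumes d_pos: "d > 0"
    and b1_measure: "\<And>i j. finite_signed_measure_on {-d..0} (\<lambda>E. b1 E $ i $ j)"
    and Q0_invertible: "\<And>t. t > 0 \<Longrightarrow> invertible (Qt0 a0 \<sigma> t)"
  shows
    "(\<comment> \<open>(i)\<close>
      \<forall>\<phi>::real^'n \<Rightarrow> real. \<phi> \<in> borel_measurable borel \<longrightarrow> bounded (range \<phi>) \<longrightarrow>
        continuous_on ({0<..} \<times> Hsp d) (\<lambda>(t, x). Rt d a0 \<sigma> t (\<lambda>y. \<phi> (fst y)) x) \<and>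
        bounded ((\<lambda>(t, x). Rt d a0 \<sigma> t (\<lambda>y. \<phi> (fst y)) x) ` ({0<..} \<times> Hsp d)) \<and>
        (\<forall>t0 t1. 0 < t0 \<longrightarrow> t0 < t1 \<longrightarrow>
           (\<exists>L. \<forall>t\<in>{t0..t1}. L-lipschitz_on (Hsp d) (Rt d a0 \<sigma> t (\<lambda>y. \<phi> (fst y))))))
     \<and>
     (\<comment> \<open>(ii)\<close>
      (\<forall>\<phi>::real^'n \<Rightarrow> real. \<phi> \<in> borel_measurable borel \<longrightarrow> bounded (range \<phi>) \<longrightarrow>
        (\<forall>t>0. \<forall>x\<in>Hsp d.
           has_gradient_on (Hsp d) (Rt d a0 \<sigma> t (\<lambda>y. \<phi> (fst y))) x
             (gradient_on (Hsp d) (Rt d a0 \<sigma> t (\<lambda>y. \<phi> (fst y))) x) \<and>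
           (\<forall>h\<in>Hsp d.
              gradient_on (Hsp d) (Rt d a0 \<sigma> t (\<lambda>y. \<phi> (fst y))) x \<bullet> h =
                (LINT z|gaussian_on UNIV (\<lambda>y. Qt0 a0 \<sigma> t *v y).
                   \<phi> (z + fst (sgA d a0 t x)) *
                   ((inv_msqrt (Qt0 a0 \<sigma> t) *v fst (sgA d a0 t h)) \<bullet>
                    (inv_msqrt (Qt0 a0 \<sigma> t) *v z))) \<and>
              \<bar>gradient_on (Hsp d) (Rt d a0 \<sigma> t (\<lambda>y. \<phi> (fst y))) x \<bullet> h\<bar> \<le>
                (SUP z. \<bar>\<phi> z\<bar>) *
                opnorm_on (Hsp d) (\<lambda>y. inv_msqrt (Qt0 a0 \<sigma> t) *v fst (sgA d a0 t y)) *
                norm h))) \<and>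
      (\<forall>T>0. \<exists>C. \<forall>\<phi>::real^'n \<Rightarrow> real. \<phi> \<in> borel_measurable borel \<longrightarrow> bounded (range \<phi>) \<longrightarrow>
        (\<forall>t\<in>{0<..T}. \<forall>x\<in>Hsp d. \<forall>h\<in>Hsp d.
           \<bar>gradient_on (Hsp d) (Rt d a0 \<sigma> t (\<lambda>y. \<phi> (fst y))) x \<bullet> h\<bar> \<le>
             C * t powr (- real (kalman_exponent a0 \<sigma>) - 1/2) * (SUP z. \<bar>\<phi> z\<bar>) * norm h)))
     \<and>
     (\<comment> \<open>(iii)\<close>
      (\<forall>\<phi>::real^'n \<Rightarrow> real. \<phi> \<in> borel_measurable borel \<longrightarrow> bounded (range \<phi>) \<longrightarrow>
        (\<forall>t>0. \<forall>x\<in>Hsp d.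
           has_B_gradient d a0 b0 b1 t (Rt d a0 \<sigma> t (\<lambda>y. \<phi> (fst y))) x
             (B_gradient d a0 b0 b1 t (Rt d a0 \<sigma> t (\<lambda>y. \<phi> (fst y))) x) \<and>
           (\<forall>k.
              B_gradient d a0 b0 b1 t (Rt d a0 \<sigma> t (\<lambda>y. \<phi> (fst y))) x \<bullet> k =
                (LINT z|gaussian_on UNIV (\<lambda>y. Qt0 a0 \<sigma> t *v y).
                   \<phi> (z + fst (sgA d a0 t x)) *
                   ((inv_msqrt (Qt0 a0 \<sigma> t) *v (etB0 d a0 b0 b1 t *v k)) \<bullet>
                    (inv_msqrt (Qt0 a0 \<sigma> t) *v z))) \<and>
              \<bar>B_gradient d a0 b0 b1 t (Rt d a0 \<sigma> t (\<lambda>y. \<phi> (fst y))) x \<bullet> k\<bar> \<le>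
                (SUP z. \<bar>\<phi> z\<bar>) *
                onorm (\<lambda>y. inv_msqrt (Qt0 a0 \<sigma> t) *v (etB0 d a0 b0 b1 t *v y)) *
                norm k))) \<and>
      (\<forall>T>0. \<exists>C. \<forall>\<phi>::real^'n \<Rightarrow> real. \<phi> \<in> borel_measurable borel \<longrightarrow> bounded (range \<phi>) \<longrightarrow>
        (\<forall>t\<in>{0<..T}. \<forall>x\<in>Hsp d. \<forall>k.
           \<bar>B_gradient d a0 b0 b1 t (Rt d a0 \<sigma> t (\<lambda>y. \<phi> (fst y))) x \<bullet> k\<bar> \<le>
             C * t powr (- real (kalman_exponent a0 \<sigma>) - 1/2) * (SUP z. \<bar>\<phi> z\<bar>) * norm k)))
     \<and>
     (kalman_exponent a0 \<sigma> = 0 \<longleftrightarrow> surj (\<lambda>y. \<sigma> *v y))"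
proof -
  note ctx = d_pos Q0_invertible
  show ?thesis
  proof (intro conjI allI impI ballI)
    fix \<phi> :: "real^'n \<Rightarrow> real"
    assume meas: "\<phi> \<in> borel_measurable borel" and bounded: "bounded (range \<phi>)"
    note hyps = ctx meas abs_le_SUP_abs[OF bounded]
    show "continuous_on ({0<..} \<times> Hsp d) (\<lambda>(t, x). Rt d a0 \<sigma> t (\<lambda>y. \<phi> (fst y)) x)"
      by (rule continuous_on_Rt[OF hyps])
    show "bounded ((\<lambda>(t, x). Rt d a0 \<sigma> t (\<lambda>y. \<phi> (fst y)) x) ` ({0<..} \<times> Hsp d))"
      unfolding bounded_iff
      by (rule exI[of _ "SUP z. \<bar>\<phi> z\<bar>"]) (auto simp: bounded_Rt[OF hyps])
    show "\<exists>L. \<forall>t\<in>{t0..t1}. L-lipschitz_on (Hsp d) (Rt d a0 \<sigma> t (\<lambda>y. \<phi> (fst y)))" if "0 < t0" for t0 t1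
      by (rule Lipschitz_Rt[OF hyps that])
    fix t :: real and x :: "(real^'n) \<times> (real^'n) L2"
    assume t: "0 < t" and x: "x \<in> Hsp d"
    show "has_gradient_on (Hsp d) (Rt d a0 \<sigma> t (\<lambda>y. \<phi> (fst y))) x
      (gradient_on (Hsp d) (Rt d a0 \<sigma> t (\<lambda>y. \<phi> (fst y))) x)"
      by (rule Rt_gradient(1)[OF hyps t x])
    show "has_B_gradient d a0 b0 b1 t (Rt d a0 \<sigma> t (\<lambda>y. \<phi> (fst y))) x
      (B_gradient d a0 b0 b1 t (Rt d a0 \<sigma> t (\<lambda>y. \<phi> (fst y))) x)"
      by (rule Rt_B_gradient(1)[OF hyps t])
    show "gradient_on (Hsp d) (Rt d a0 \<sigma> t (\<lambda>y. \<phi> (fst y))) x \<bullet> h =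
        (LINT z|gaussian_on UNIV (\<lambda>y. Qt0 a0 \<sigma> t *v y).
           \<phi> (z + fst (sgA d a0 t x)) *
           ((inv_msqrt (Qt0 a0 \<sigma> t) *v fst (sgA d a0 t h)) \<bullet> (inv_msqrt (Qt0 a0 \<sigma> t) *v z)))" for h
      using Rt_gradient(2)[OF hyps t x, of h] by (simp only: gauss_dir_deriv_def)
    show "\<bar>gradient_on (Hsp d) (Rt d a0 \<sigma> t (\<lambda>y. \<phi> (fst y))) x \<bullet> h\<bar> \<le> (SUP z. \<bar>\<phi> z\<bar>) *
        opnorm_on (Hsp d) (\<lambda>y. inv_msqrt (Qt0 a0 \<sigma> t) *v fst (sgA d a0 t y)) * norm h"
      if "h \<in> Hsp d" for h
      by (rule Rt_gradient_le_opnorm[OF hyps t x that])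
    show "B_gradient d a0 b0 b1 t (Rt d a0 \<sigma> t (\<lambda>y. \<phi> (fst y))) x \<bullet> k =
        (LINT z|gaussian_on UNIV (\<lambda>y. Qt0 a0 \<sigma> t *v y).
           \<phi> (z + fst (sgA d a0 t x)) *
           ((inv_msqrt (Qt0 a0 \<sigma> t) *v (etB0 d a0 b0 b1 t *v k)) \<bullet> (inv_msqrt (Qt0 a0 \<sigma> t) *v z)))" for k
      using Rt_B_gradient(2)[OF hyps t, of b0 b1 x k] by (simp only: gauss_dir_deriv_def)
    show "\<bar>B_gradient d a0 b0 b1 t (Rt d a0 \<sigma> t (\<lambda>y. \<phi> (fst y))) x \<bullet> k\<bar> \<le> (SUP z. \<bar>\<phi> z\<bar>) *
        onorm (\<lambda>y. inv_msqrt (Qt0 a0 \<sigma> t) *v (etB0 d a0 b0 b1 t *v y)) * norm k" for k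
      by (rule Rt_B_gradient_le_onorm[OF hyps t])
  next
    show "kalman_exponent a0 \<sigma> = 0 \<longleftrightarrow> surj (\<lambda>y. \<sigma> *v y)"
      by (rule kalman_exponent_eq_0_iff[OF kalman_range_eventually_UNIV[OF Q0_invertible]]) simp
  next
    fix T :: real assume T: "0 < T"
    show "\<exists>C. \<forall>\<phi>::real^'n \<Rightarrow> real. \<phi> \<in> borel_measurable borel \<longrightarrow> bounded (range \<phi>) \<longrightarrow>
        (\<forall>t\<in>{0<..T}. \<forall>x\<in>Hsp d. \<forall>h\<in>Hsp d.
           \<bar>gradient_on (Hsp d) (Rt d a0 \<sigma> t (\<lambda>y. \<phi> (fst y))) x \<bullet> h\<bar> \<le>
             C * t powr (- real (kalman_exponent a0 \<sigma>) - 1/2) * (SUP z. \<bar>\<phi> z\<bar>) * norm h)"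
      by (rule Rt_gradient_kalman_bound[OF ctx T])
    show "\<exists>C. \<forall>\<phi>::real^'n \<Rightarrow> real. \<phi> \<in> borel_measurable borel \<longrightarrow> bounded (range \<phi>) \<longrightarrow>
        (\<forall>t\<in>{0<..T}. \<forall>x\<in>Hsp d. \<forall>k.
           \<bar>B_gradient d a0 b0 b1 t (Rt d a0 \<sigma> t (\<lambda>y. \<phi> (fst y))) x \<bullet> k\<bar> \<le>
             C * t powr (- real (kalman_exponent a0 \<sigma>) - 1/2) * (SUP z. \<bar>\<phi> z\<bar>) * norm k)"
      by (rule Rt_B_gradient_kalman_bound[OF ctx b1_measure T])
  qed
qed

end
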